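(* Let $\mathbb{F}$ be an algebraically closed field of characteristic $p=2$, let $n\geq 6$ be even, let $V$ be an irreducible $\mathbb{F}\mathsf{S}_n$-module satisfying $d_3(V)>d_1(V)$, and let $X\leq \mathsf{S}_n$ be a subgroup with $X=O^2(X)$ such that $$f_1(X)=1,\qquad e_3(X)\geq h(X)+1,\qquad\text{and either } f_2(X)\geq 3 \text{ or } \mathcal{S}_2^X\neq 0.$$ Then the restriction $\mathrm{Res}^{\mathsf{S}_n}_X V$ is reducible.
   Context: $\mathsf{S}_n$ is the symmetric group on $\Omega=\{1,\ldots,n\}$. For $r\ge 1$, $M_r=\mathbb{F}\Omega_r$ is the permutation $\mathbb{F}\mathsf{S}_n$-module on the set $\Omega_r$ of $r$-element subsets of $\Omega$, and $d_r(V)=\dim\mathrm{Hom}_{\mathbb{F}\mathsf{S}_n}(M_r,\mathrm{End}_{\mathbb{F}}(V))$. For a module $U$, $U^X$ is the subspace of $X$-fixed points. For $X\le\mathsf{S}_n$ put $f_r(X)=\dim (M_r)^X$ (the number of $X$-orbits on $\Omega_r$) and $e_3(X)=f_3(X)-f_2(X)$. Let $T_1\in M_1$ be the sum of all the $1$-element subsets, $Q=M_1/\mathbb{F}\cdot T_1$, and $h(X)=\dim H^1(X,Q)$. $\mathcal{S}_2\subset M_2$ is the Specht module $S^{(n-2,2)}$; explicitly, $\mathcal{S}_2=\ker\eta_{2,0}\cap\ker\eta_{2,1}$, where $\eta_{2,1}:M_2\to M_1$, $\{i,j\}\mapsto\{i\}+\{j\}$, and $\eta_{2,0}:M_2\to\mathbb{F}$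 sends every $2$-element subset to $1$. $O^2(X)$ is the smallest normal subgroup of $X$ whose index is a power of $2$. *)

theory Defs
  imports "HOL-Algebra.AbelCoset" "HOL-Algebra.Sym_Groups" "Jordan_Normal_Form.VS_Connect"
begin

text \<open>A module over the group algebra is a vector space with a linear group action. Since the action
  is a field of the record, restriction to a subgroup \<open>X\<close> of \<open>G\<close> keeps \<open>V\<close> and replaces \<open>G\<close> by
  \<open>G\<lparr>carrier := X\<rparr>\<close>.\<close>

record ('k, 'v, 'g) gmodule = "('k, 'v) module" +
  act :: "'g \<Rightarrow> 'v \<Rightarrow> 'v"

locale group_module =
  G: group G + V: vectorspace "class_ring :: 'k ring" V
  for G :: "('g, 'a) monoid_scheme" and V :: "('k::field, 'v, 'g) gmodule" +
  assumes act_linear: "g \<in> carrier G \<Longrightarrow> act V g \<in> LinearCombinations.module_hom class_ring V V"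
    and act_one: "v \<in> carrier V \<Longrightarrow> act V \<one>\<^bsub>G\<^esub> v = v"
    and act_mult: "\<lbrakk>g \<in> carrier G; h \<in> carrier G; v \<in> carrier V\<rbrakk>
      \<Longrightarrow> act V (g \<otimes>\<^bsub>G\<^esub> h) v = act V g (act V h v)"

definition group_submodule ::
    "('g, 'a) monoid_scheme \<Rightarrow> 'v set \<Rightarrow> ('k::field, 'v, 'g) gmodule \<Rightarrow> bool" where
  "group_submodule G W V \<longleftrightarrow>
     subspace class_ring W V \<and> (\<forall>g\<in>carrier G. \<forall>w\<in>W. act V g w \<in> W)"

definition irreducible_module ::
    "('g, 'a) monoid_scheme \<Rightarrow> ('k::field, 'v, 'g) gmodule \<Rightarrow> bool" where
  "irreducible_module G V \<longleftrightarrow>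
     group_module G V \<and> carrier V \<noteq> {\<zero>\<^bsub>V\<^esub>} \<and>
     (\<forall>W. group_submodule G W V \<longrightarrow> W = {\<zero>\<^bsub>V\<^esub>} \<or> W = carrier V)"

definition reducible_module ::
    "('g, 'a) monoid_scheme \<Rightarrow> ('k::field, 'v, 'g) gmodule \<Rightarrow> bool" where
  "reducible_module G V \<longleftrightarrow>
     group_module G V \<and>
     (\<exists>W. group_submodule G W V \<and> W \<noteq> {\<zero>\<^bsub>V\<^esub>} \<and> W \<noteq> carrier V)"

definition fixed_points :: "'g set \<Rightarrow> ('k, 'v, 'g) gmodule \<Rightarrow> 'v set" where
  "fixed_points X V = {v \<in> carrier V. \<forall>g\<in>X. act V g v = v}"

text \<open>In the vector spaces below the fields \<^const>\<open>monoid.mult\<close> and \<^const>\<open>one\<close>, which the module record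
  inherits from the ring record, have no meaning; as in \<^const>\<open>ring.func_space\<close> they are filled
  with zero.\<close>

definition fun_module :: "'a set \<Rightarrow> ('k, 'w, 'c) module_scheme \<Rightarrow> ('k, 'a \<Rightarrow> 'w) module" where
  "fun_module S W =
     \<lparr>carrier = S \<rightarrow>\<^sub>E carrier W,
      monoid.mult = (\<lambda>f g. \<lambda>x\<in>S. \<zero>\<^bsub>W\<^esub>),
      one = (\<lambda>x\<in>S. \<zero>\<^bsub>W\<^esub>),
      zero = (\<lambda>x\<in>S. \<zero>\<^bsub>W\<^esub>),
      add = (\<lambda>f g. \<lambda>x\<in>S. f x \<oplus>\<^bsub>W\<^esub> g x),
      smult = (\<lambda>c f. \<lambda>x\<in>S. c \<odot>\<^bsub>W\<^esub> f x)\<rparr>"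

definition lin_maps ::
    "('k::field, 'u, 'c) module_scheme \<Rightarrow> ('k, 'w, 'd) module_scheme \<Rightarrow> ('k, 'u \<Rightarrow> 'w) module" where
  "lin_maps U W = (fun_module (carrier U) W)
     \<lparr>carrier := LinearCombinations.module_hom class_ring U W \<inter> extensional (carrier U)\<rparr>"

definition group_hom_space ::
    "('g, 'a) monoid_scheme \<Rightarrow> ('k::field, 'u, 'g) gmodule \<Rightarrow> ('k, 'w, 'g) gmodule
      \<Rightarrow> ('k, 'u \<Rightarrow> 'w) module" where
  "group_hom_space G U W = (lin_maps U W)
     \<lparr>carrier := {\<phi> \<in> carrier (lin_maps U W).
        \<forall>g\<in>carrier G. \<forall>u\<in>carrier U. \<phi> (act U g u) = act W g (\<phi> u)}\<rparr>"

definition end_module ::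
    "('g, 'a) monoid_scheme \<Rightarrow> ('k::field, 'v, 'g) gmodule \<Rightarrow> ('k, 'v \<Rightarrow> 'v, 'g) gmodule" where
  "end_module G V = module.extend (lin_maps V V)
     (gmodule.fields (\<lambda>g \<phi>. \<lambda>v\<in>carrier V. act V g (\<phi> (act V (inv\<^bsub>G\<^esub> g) v))))"

text \<open>The elements of the quotient by a subspace \<open>W\<close> are the cosets of \<open>W\<close>. As for
  the quotient rings of HOL-Algebra, the value of an operation on a coset is the union of the (equal) cosets
  obtained from its representatives.\<close>

definition quotient_module ::
    "('k, 'v, 'c) module_scheme \<Rightarrow> 'v set \<Rightarrow> ('k, 'v set) module" where
  "quotient_module V W =
     \<lparr>carrier = a_rcosets\<^bsub>V\<^esub> W,
      monoid.mult = (\<lambda>A B. W),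
      one = W,
      zero = W,
      add = (\<lambda>A B. A <+>\<^bsub>V\<^esub> B),
      smult = (\<lambda>c A. \<Union>a\<in>A. W +>\<^bsub>V\<^esub> (c \<odot>\<^bsub>V\<^esub> a))\<rparr>"

definition quotient_gmodule ::
    "('k, 'v, 'g) gmodule \<Rightarrow> 'v set \<Rightarrow> ('k, 'v set, 'g) gmodule" where
  "quotient_gmodule V W = module.extend (quotient_module V W)
     (gmodule.fields (\<lambda>g A. \<Union>a\<in>A. W +>\<^bsub>V\<^esub> act V g a))"

definition cocycles1 ::
    "('g, 'a) monoid_scheme \<Rightarrow> ('k, 'v, 'g) gmodule \<Rightarrow> ('g \<Rightarrow> 'v) set" where
  "cocycles1 G V = {z \<in> carrier G \<rightarrow>\<^sub>E carrier V.
     \<forall>g\<in>carrier G. \<forall>h\<in>carrier G. z (g \<otimes>\<^bsub>G\<^esub> h) = z g \<oplus>\<^bsub>V\<^esub> act V g (z h)}"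

definition coboundaries1 ::
    "('g, 'a) monoid_scheme \<Rightarrow> ('k, 'v, 'g) gmodule \<Rightarrow> ('g \<Rightarrow> 'v) set" where
  "coboundaries1 G V = {\<lambda>g\<in>carrier G. act V g v \<ominus>\<^bsub>V\<^esub> v | v. v \<in> carrier V}"

definition cohomology1 ::
    "('g, 'a) monoid_scheme \<Rightarrow> ('k, 'v, 'g) gmodule \<Rightarrow> ('k, ('g \<Rightarrow> 'v) set) module" where
  "cohomology1 G V = quotient_module
     ((fun_module (carrier G) V)\<lparr>carrier := cocycles1 G V\<rparr>) (coboundaries1 G V)"

text \<open>The order on sets is inclusion. For finite \<open>G\<close> and prime \<open>p\<close> the least element exists.\<close>

definition O_upper :: "nat \<Rightarrow> ('g, 'a) monoid_scheme \<Rightarrow> 'g set" where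
  "O_upper p G = (LEAST N. N \<lhd> G \<and> (\<exists>k. card (rcosets\<^bsub>G\<^esub> N) = p ^ k))"

definition \<Omega> :: "nat \<Rightarrow> nat \<Rightarrow> nat set set" where
  "\<Omega> n r = {A. A \<subseteq> {1..n} \<and> card A = r}"

text \<open>An element of \<open>M\<^sub>r\<close> is written as the function giving its coefficients with respect to the
  basis \<open>\<Omega> n r\<close>. The coefficient of \<open>\<sigma> f\<close> at \<open>A\<close> is the one of \<open>f\<close> at the preimage of \<open>A\<close> under
  \<open>\<sigma>\<close>, so that the basis vector of \<open>A\<close> is sent to the one of \<open>\<sigma> ` A\<close>.\<close>

definition perm_module :: "nat \<Rightarrow> nat \<Rightarrow> ('k::field, nat set \<Rightarrow> 'k, nat \<Rightarrow> nat) gmodule" where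
  "perm_module n r = module.extend (ring.func_space class_ring (\<Omega> n r))
     (gmodule.fields (\<lambda>\<sigma> f. \<lambda>A\<in>\<Omega> n r. f (\<sigma> -` A)))"

definition basis_vec :: "nat \<Rightarrow> nat \<Rightarrow> nat set \<Rightarrow> nat set \<Rightarrow> 'k::field" where
  "basis_vec n r A = (\<lambda>B\<in>\<Omega> n r. if B = A then 1 else 0)"

definition d_inv :: "nat \<Rightarrow> nat \<Rightarrow> ('k::field, 'v, nat \<Rightarrow> nat) gmodule \<Rightarrow> nat" where
  "d_inv n r V = vectorspace.dim class_ring
     (group_hom_space (sym_group n) (perm_module n r) (end_module (sym_group n) V))"

definition f_inv :: "'k::field itself \<Rightarrow> nat \<Rightarrow> nat \<Rightarrow> (nat \<Rightarrow> nat) set \<Rightarrow> nat" where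
  "f_inv _ n r X = vectorspace.dim class_ring
     ((perm_module n r :: ('k, _, _) gmodule)\<lparr>carrier := fixed_points X (perm_module n r)\<rparr>)"

definition e3_inv :: "'k::field itself \<Rightarrow> nat \<Rightarrow> (nat \<Rightarrow> nat) set \<Rightarrow> int" where
  "e3_inv k n X = int (f_inv k n 3 X) - int (f_inv k n 2 X)"

definition T1 :: "nat \<Rightarrow> nat set \<Rightarrow> 'k::field" where
  "T1 n = (\<Oplus>\<^bsub>perm_module n 1\<^esub>A\<in>\<Omega> n 1. basis_vec n 1 A)"

definition Q_module :: "nat \<Rightarrow> ('k::field, (nat set \<Rightarrow> 'k) set, nat \<Rightarrow> nat) gmodule" where
  "Q_module n = quotient_gmodule (perm_module n 1) {c \<odot>\<^bsub>perm_module n 1\<^esub> T1 n | c. True}"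

definition h_inv :: "'k::field itself \<Rightarrow> nat \<Rightarrow> (nat \<Rightarrow> nat) set \<Rightarrow> nat" where
  "h_inv _ n X = vectorspace.dim class_ring
     (cohomology1 ((sym_group n)\<lparr>carrier := X\<rparr>) (Q_module n :: ('k, _, _) gmodule))"

definition eta20 :: "nat \<Rightarrow> (nat set \<Rightarrow> 'k::field) \<Rightarrow> 'k" where
  "eta20 n f = (\<Sum>A\<in>\<Omega> n 2. f A)"

definition eta21 :: "nat \<Rightarrow> (nat set \<Rightarrow> 'k::field) \<Rightarrow> (nat set \<Rightarrow> 'k)" where
  "eta21 n f = (\<Oplus>\<^bsub>perm_module n 1\<^esub>A\<in>\<Omega> n 2.
     f A \<odot>\<^bsub>perm_module n 1\<^esub> (\<Oplus>\<^bsub>perm_module n 1\<^esub>i\<in>A. basis_vec n 1 {i}))"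

text \<open>The Specht module of the partition \<open>(n - 2, 2)\<close>, as a submodule of \<open>M\<^sub>2\<close>.\<close>

definition specht2 :: "nat \<Rightarrow> ('k::field, nat set \<Rightarrow> 'k, nat \<Rightarrow> nat) gmodule" where
  "specht2 n = (perm_module n 2)
     \<lparr>carrier := a_kernel (perm_module n 2) class_ring (eta20 n)
                 \<inter> a_kernel (perm_module n 2) (perm_module n 1) (eta21 n)\<rparr>"

end

theory Submission
  imports "HOL-Algebra.Sylow" "HOL-Algebra.Multiplicative_Group" "HOL-Library.Function_Algebras" Defs
    "Jordan_Normal_Form.DL_Rank"
begin

text \<open>Suppose that \<open>V\<close> stays irreducible on \<open>X\<close>. By Schur's lemma every \<open>X\<close>-fixed element of
  \<open>End V\<close> is a scalar, so the whole symmetric group fixes it. Let \<open>N\<close> be the kernel of a homomorphism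
  \<open>\<psi>\<close> from \<open>M\<^sub>3\<close> to \<open>End V\<close>. Then an element of \<open>M\<^sub>3\<close> that \<open>X\<close> fixes modulo \<open>N\<close> is fixed modulo
  \<open>N\<close> by the symmetric group. This property of \<open>N\<close> and the hypotheses on \<open>X\<close> imply that \<open>N\<close> contains
  the kernel \<open>K\<close> of the map \<open>\<eta>\<close> from \<open>M\<^sub>3\<close> to \<open>M\<^sub>1\<close> (lemma \<open>kernel_in_submodule\<close>). So \<open>\<psi>\<close> factors
  through \<open>\<eta>\<close>, which is surjective, and \<open>d\<^sub>3(V) \<le> d\<^sub>1(V)\<close> follows (lemma
  \<open>d_inv_le_if_kernel_vanishes\<close>), a contradiction.

  Elements of \<open>M\<^sub>r\<close> are regarded as functions on \<open>r\<close>-sets, and the coboundary of a function \<open>b\<close> on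
  pairs is \<open>ijk \<mapsto> b(ij) + b(ik) + b(jk)\<close>. The last two hypotheses
  provide one fixed function each.

  The inequality for \<open>e\<^sub>3(X)\<close> provides an \<open>X\<close>-fixed function \<open>f\<close> on triples that is not a coboundary
  (lemma \<open>exists_fixed_not_coboundary\<close>). Indeed, if \<open>f\<close> is an \<open>X\<close>-fixed coboundary of \<open>b\<close>, then
  the differences between \<open>b\<close> and its translates are coboundaries of functions on points and define a
  class in \<open>H\<^sup>1(X, Q)\<close>, which vanishes only if \<open>b\<close> can be chosen fixed. If all fixed functions were
  coboundaries, this would give \<open>f\<^sub>3(X) \<le> f\<^sub>2(X) + h(X)\<close>.

  The last hypothesis provides a nonzero \<open>X\<close>-fixed element \<open>x\<close> of the Specht module \<open>\<S>\<^sub>2\<close>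
  (lemma \<open>exists_fixed_specht\<close>).

  The functions orthogonal to all polytabloids are described explicitly (lemmas \<open>orthogonal_pairs\<close> and
  \<open>orthogonal_triples\<close>). With the help of \<open>f\<^sub>1(X) = 1\<close> and \<open>X = O\<^sup>2(X)\<close>, which force a function on
  points to be constant if \<open>X\<close> fixes it up to constants, neither \<open>f\<close> nor \<open>x\<close> is of this kind. By
  the argument of James's submodule theorem, a submodule that contains such a function contains all
  polytabloids (lemma \<open>james_submodule\<close>). This is applied to functions on triples that the
  symmetric group fixes modulo \<open>N\<close>, and to the images in \<open>M\<^sub>2\<close> of those among them that lie in
  \<open>K\<close>. The Garnir relation between three polytabloids shows that the polytabloids found in this way
  already belong to \<open>N\<close>, or to the image of \<open>K \<inter> N\<close> (lemma \<open>polytabloid_descends\<close>). Since the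
  polytabloids in \<open>M\<^sub>3\<close> span the part of \<open>K\<close> that is killed by the map to \<open>M\<^sub>2\<close>, and those in
  \<open>M\<^sub>2\<close> span the image of \<open>K\<close>, all of \<open>K\<close> is contained in \<open>N\<close>.\<close>

hide_const (open) Real_Vector_Spaces.subspace

section \<open>Finite-dimensional vector spaces\<close>

lemma vectorspace_cong:
  assumes V: "vectorspace K V"
    and eq: "carrier V' = carrier V" "\<zero>\<^bsub>V'\<^esub> = \<zero>\<^bsub>V\<^esub>"
      "\<And>v w. v \<in> carrier V \<Longrightarrow> w \<in> carrier V \<Longrightarrow> v \<oplus>\<^bsub>V'\<^esub> w = v \<oplus>\<^bsub>V\<^esub> w"
      "\<And>c v. c \<in> carrier K \<Longrightarrow> v \<in> carrier V \<Longrightarrow> c \<odot>\<^bsub>V'\<^esub> v = c \<odot>\<^bsub>V\<^esub> v"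
  shows "vectorspace K V'"
proof -
  interpret V: vectorspace K V by (rule V)
  show ?thesis
    by (rule vs_criteria; (unfold eq(1,2))?)
      (auto simp: eq V.field_axioms V.M.a_ac V.smult_l_distr V.smult_r_distr V.smult_assoc1
        intro: bexI[of _ "\<ominus>\<^bsub>V\<^esub> _"] V.M.r_neg)
qed

lemma (in vectorspace) subspaceI:
  assumes "W \<subseteq> carrier V" "\<zero>\<^bsub>V\<^esub> \<in> W" "\<And>v w. v \<in> W \<Longrightarrow> w \<in> W \<Longrightarrow> v \<oplus>\<^bsub>V\<^esub> w \<in> W"
    "\<And>c v. c \<in> carrier K \<Longrightarrow> v \<in> W \<Longrightarrow> c \<odot>\<^bsub>V\<^esub> v \<in> W"
  shows "subspace K W V"
  using assms vectorspace_axioms module_axioms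
  by (auto simp: subspace_def submodule_def)

lemma subspaceD:
  assumes "subspace K W V"
  shows subspace_subset: "W \<subseteq> carrier V"
    and subspace_zero: "\<zero>\<^bsub>V\<^esub> \<in> W"
    and subspace_add: "v \<in> W \<Longrightarrow> w \<in> W \<Longrightarrow> v \<oplus>\<^bsub>V\<^esub> w \<in> W"
    and subspace_smult: "c \<in> carrier K \<Longrightarrow> v \<in> W \<Longrightarrow> c \<odot>\<^bsub>V\<^esub> v \<in> W"
  using assms by (auto simp: subspace_def submodule_def)

lemma (in vectorspace) span_subspace_subset:
  "subspace K W V \<Longrightarrow> S \<subseteq> W \<Longrightarrow> span S \<subseteq> W"
  by (rule span_is_subset) (simp_all)

text \<open>Independent subsets of \<open>W\<close> are independent in \<open>V\<close>, so their size is bounded, and one of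
  maximal size is a finite basis of \<open>W\<close>.\<close>

lemma (in vectorspace) fin_dim_subspace:
  assumes fd: fin_dim and W: "subspace K W V"
  shows "vectorspace.fin_dim K (vs W)" and "vectorspace.dim K (vs W) \<le> dim"
proof -
  interpret W: vectorspace K "vs W" by (rule subspace_is_vs[OF W])
  have sub: "W \<subseteq> carrier V" by (rule subspace_subset[OF W])
  have small: "finite A \<and> card A \<le> dim" if "A \<subseteq> carrier (vs W) \<and> \<not> W.lin_dep A" for A
    using li_le_dim[OF fd, of A] span_li_not_depend(2)[of A W] that sub is_module[OF W] by auto
  have "\<not> W.lin_dep {}" by (auto simp: W.lin_dep_def)
  then obtain A where A: "finite A" "maximal A (\<lambda>S. S \<subseteq> carrier (vs W) \<and> \<not> W.lin_dep S)"
    using maximal_exists[of "\<lambda>S. S \<subseteq> carrier (vs W) \<and> \<not> W.lin_dep S" dim "{}"] small by auto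
  have "W.basis A" by (rule W.max_li_is_basis[OF A(2)])
  then show fd': "W.fin_dim" using A(1) unfolding W.fin_dim_def W.basis_def by auto
  show "W.dim \<le> dim" by (rule subspace_dim[OF W fd fd'])
qed

lemma linear_mapI:
  assumes "vectorspace K V" "vectorspace K W" "T \<in> LinearCombinations.module_hom K V W"
  shows "linear_map K V W T"
  using assms by (simp add: linear_map_def mod_hom_def mod_hom_axioms_def vectorspace_def)

text \<open>The inverse of \<open>T\<close> maps the image of \<open>T\<close>, a subspace of a finite-dimensional space, linearly
  onto \<open>V\<close>.\<close>

lemma (in linear_map) fin_dim_if_inj:
  assumes inj: "inj_on T (carrier V)" and fd: "W.fin_dim"
  shows "V.fin_dim" and "V.dim \<le> W.dim"
proof -
  have im: "subspace K imT W" by (rule imT_is_subspace)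
  interpret I: vectorspace K "W.vs imT" by (rule W.subspace_is_vs[OF im])
  let ?S = "the_inv_into (carrier V) T"
  have S: "?S w \<in> carrier V" "T (?S w) = w" if "w \<in> imT" for w
    using that the_inv_into_into[OF inj, of w "carrier V"] f_the_inv_into_f[OF inj, of w]
    by (auto simp: mod_hom.im_def im_def)
  have ST: "?S (T v) = v" if "v \<in> carrier V" for v
    by (rule the_inv_into_f_f[OF inj that])
  have hom: "?S \<in> LinearCombinations.module_hom K (W.vs imT) V"
    unfolding LinearCombinations.module_hom_def
  proof (intro CollectI conjI allI impI)
    show "?S \<in> carrier (W.vs imT) \<rightarrow> carrier V" using S by simp
    fix w w' assume "w \<in> carrier (W.vs imT) \<and> w' \<in> carrier (W.vs imT)"
    then have w: "w \<in> imT" "w' \<in> imT" by simp_all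
    have "w \<oplus>\<^bsub>W\<^esub> w' = T (?S w \<oplus>\<^bsub>V\<^esub> ?S w')" using S[OF w(1)] S[OF w(2)] by simp
    then have "?S (w \<oplus>\<^bsub>W\<^esub> w') = ?S (T (?S w \<oplus>\<^bsub>V\<^esub> ?S w'))" by (rule arg_cong)
    also have "\<dots> = ?S w \<oplus>\<^bsub>V\<^esub> ?S w'" by (rule ST) (simp add: S(1)[OF w(1)] S(1)[OF w(2)])
    finally show "?S (w \<oplus>\<^bsub>W.vs imT\<^esub> w') = ?S w \<oplus>\<^bsub>V\<^esub> ?S w'" by simp
  next
    fix c w assume "c \<in> carrier K \<and> w \<in> carrier (W.vs imT)"
    then have w: "c \<in> carrier K" "w \<in> imT" by simp_all
    have "c \<odot>\<^bsub>W\<^esub> w = T (c \<odot>\<^bsub>V\<^esub> ?S w)" using S[OF w(2)] w(1) by simp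
    then have "?S (c \<odot>\<^bsub>W\<^esub> w) = ?S (T (c \<odot>\<^bsub>V\<^esub> ?S w))" by (rule arg_cong)
    also have "\<dots> = c \<odot>\<^bsub>V\<^esub> ?S w" by (rule ST) (simp add: S(1)[OF w(2)] w(1))
    finally show "?S (c \<odot>\<^bsub>W.vs imT\<^esub> w) = c \<odot>\<^bsub>V\<^esub> ?S w" by simp
  qed
  interpret S: linear_map K "W.vs imT" V ?S
    by (rule linear_mapI[OF I.vectorspace_axioms V.vectorspace_axioms hom])
  have "?S ` carrier (W.vs imT) = carrier V"
  proof
    show "?S ` carrier (W.vs imT) \<subseteq> carrier V" using S by auto
    show "carrier V \<subseteq> ?S ` carrier (W.vs imT)"
    proof
      fix v assume "v \<in> carrier V"
      then show "v \<in> ?S ` carrier (W.vs imT)"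
        by (intro image_eqI[of _ _ "T v"]) (simp_all add: ST im_def)
    qed
  qed
  then show fdV: "V.fin_dim" by (rule S.surj_fin_dim[OF W.fin_dim_subspace(1)[OF fd im]])
  have "V.dim = vectorspace.dim K (W.vs imT)"
    using rank_nullity[OF fdV] inj_imp_dim_ker0[OF inj] by simp
  then show "V.dim \<le> W.dim" using W.fin_dim_subspace(2)[OF fd im] by simp
qed

lemma (in linear_map) dim_le_dim_plus_ker:
  assumes "V.fin_dim" "W.fin_dim"
  shows "V.dim \<le> W.dim + vectorspace.dim K (V.vs kerT)"
  using rank_nullity[OF assms(1)] W.fin_dim_subspace(2)[OF assms(2) imT_is_subspace] by linarith

lemma (in linear_map) dim_le_if_subset_im:
  assumes "V.fin_dim" and U: "subspace K U W" "U \<subseteq> T ` carrier V"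
  shows "vectorspace.dim K (W.vs U) \<le> V.dim"
proof -
  have im: "subspace K imT W" by (rule imT_is_subspace)
  interpret I: vectorspace K "W.vs imT" by (rule W.subspace_is_vs[OF im])
  interpret S: linear_map K V "W.vs imT" T
    by (rule linear_mapI[OF V.vectorspace_axioms I.vectorspace_axioms])
      (use f_hom in \<open>auto simp: LinearCombinations.module_hom_def im_def\<close>)
  have fd: "I.fin_dim" by (rule S.surj_fin_dim[OF assms(1)]) (simp add: im_def)
  have sub: "subspace K U (W.vs imT)"
    by (rule I.subspaceI) (use U subspaceD[OF U(1)] in \<open>auto simp: im_def\<close>)
  have "vectorspace.dim K (W.vs U) \<le> I.dim" using I.fin_dim_subspace(2)[OF fd sub] by simp
  also have "\<dots> \<le> V.dim" using rank_nullity[OF assms(1)] by simp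
  finally show ?thesis .
qed

lemma (in linear_map) linear_eq_on_span:
  assumes S: "linear_map K V W S" and A: "A \<subseteq> carrier V" and eq: "\<And>a. a \<in> A \<Longrightarrow> T a = S a"
    and v: "v \<in> V.module.span A"
  shows "T v = S v"
proof -
  interpret S: linear_map K V W S by (rule S)
  have "subspace K {v \<in> carrier V. T v = S v} V" by (rule V.subspaceI) auto
  then have "V.module.span A \<subseteq> {v \<in> carrier V. T v = S v}"
    by (rule V.span_subspace_subset) (use A eq in auto)
  then show ?thesis using v by blast
qed

text \<open>\<open>part T v\<close> stands for the sum of the components of \<open>v\<close> with index in \<open>T\<close>; by induction on \<open>T\<close>
  it lies in the span of all the \<open>G s\<close>. This yields generators of spaces of functions on a finite
  set.\<close>

lemma (in vectorspace) span_parts: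
  assumes S: "finite S" and G: "\<And>s. s \<in> S \<Longrightarrow> G s \<subseteq> carrier V"
    and part: "\<And>v. v \<in> carrier V \<Longrightarrow> part {} v = \<zero>\<^bsub>V\<^esub>"
      "\<And>v s T. v \<in> carrier V \<Longrightarrow> T \<subseteq> S \<Longrightarrow> s \<in> S - T \<Longrightarrow> \<exists>w\<in>span (G s). part (insert s T) v = part T v \<oplus>\<^bsub>V\<^esub> w"
      "\<And>v. v \<in> carrier V \<Longrightarrow> part S v = v"
  shows "span (\<Union>s\<in>S. G s) = carrier V"
proof
  have GS: "(\<Union>s\<in>S. G s) \<subseteq> carrier V" using G by blast
  show "span (\<Union>s\<in>S. G s) \<subseteq> carrier V" by (rule span_is_subset2[OF GS])
  have sub: "subspace K (span (\<Union>s\<in>S. G s)) V" by (rule span_is_subspace[OF GS])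
  show "carrier V \<subseteq> span (\<Union>s\<in>S. G s)"
  proof
    fix v assume v: "v \<in> carrier V"
    have "part T v \<in> span (\<Union>s\<in>S. G s)" if "finite T" "T \<subseteq> S" for T
      using that
    proof (induct T)
      case empty
      then show ?case using part(1)[OF v] subspace_zero[OF sub] by simp
    next
      case (insert s T)
      then obtain w where w: "w \<in> span (G s)" "part (insert s T) v = part T v \<oplus>\<^bsub>V\<^esub> w"
        using part(2)[OF v, of T s] by auto
      have "span (G s) \<subseteq> span (\<Union>s\<in>S. G s)" by (rule span_is_monotone) (use insert in auto)
      then show ?case using w insert subspace_add[OF sub] by auto
    qed
    from this[OF S] show "v \<in> span (\<Union>s\<in>S. G s)" using part(3)[OF v] by simp
  qed
qed

lemma class_vectorspace: "vectorspace (class_ring :: 'k::field ring) V \<longleftrightarrow> Module.module class_ring V"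
  by (simp add: vectorspace_def class_field)

section \<open>Spaces of functions and quotients\<close>

context
  fixes W :: "('k::field, 'w, 'c) module_scheme"
  assumes W: "vectorspace class_ring W"
begin

interpretation W: vectorspace class_ring W by (rule W)

lemma fun_module_vectorspace: "vectorspace class_ring (fun_module S W :: ('k, 'a \<Rightarrow> 'w) module)"
proof (rule vs_criteria)
  show "\<forall>v\<in>carrier (fun_module S W). \<exists>neg_v\<in>carrier (fun_module S W).
    v \<oplus>\<^bsub>fun_module S W\<^esub> neg_v = \<zero>\<^bsub>(fun_module S W :: ('k, 'a \<Rightarrow> 'w) module)\<^esub>"
  proof
    fix v :: "'a \<Rightarrow> 'w" assume v: "v \<in> carrier (fun_module S W)"
    show "\<exists>neg_v\<in>carrier (fun_module S W).
      v \<oplus>\<^bsub>fun_module S W\<^esub> neg_v = \<zero>\<^bsub>(fun_module S W :: ('k, 'a \<Rightarrow> 'w) module)\<^esub>"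
    proof (rule bexI)
      show "(\<lambda>x\<in>S. \<ominus>\<^bsub>W\<^esub> v x) \<in> carrier (fun_module S W)" using v by (auto simp: fun_module_def)
      show "v \<oplus>\<^bsub>fun_module S W\<^esub> (\<lambda>x\<in>S. \<ominus>\<^bsub>W\<^esub> v x) = \<zero>\<^bsub>(fun_module S W :: ('k, 'a \<Rightarrow> 'w) module)\<^esub>"
        using v by (auto simp: fun_module_def fun_eq_iff PiE_def Pi_def W.M.r_neg)
    qed
  qed
qed (auto simp: fun_module_def class_field fun_eq_iff PiE_def Pi_def extensional_def restrict_def
      W.M.a_ac W.smult_l_distr[simplified] W.smult_r_distr[simplified] W.smult_assoc1[simplified]
      W.smult_one[simplified])

lemma fin_dim_fun_module:
  assumes S: "finite S" and fd: "vectorspace.fin_dim class_ring W"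
  shows "vectorspace.fin_dim class_ring (fun_module S W :: ('k, 'a \<Rightarrow> 'w) module)"
proof -
  interpret F: vectorspace class_ring "fun_module S W :: ('k, 'a \<Rightarrow> 'w) module"
    by (rule fun_module_vectorspace)
  obtain B where B: "finite B" "B \<subseteq> carrier W" "W.span B = carrier W"
    using fd unfolding W.fin_dim_def by blast
  define e where "e s w = (\<lambda>x\<in>S. if x = s then w else \<zero>\<^bsub>W\<^esub>)" for s w
  have e_hom: "e s \<in> LinearCombinations.module_hom class_ring W (fun_module S W)" for s
    by (auto simp: LinearCombinations.module_hom_def e_def fun_module_def fun_eq_iff)
  have e_span: "e s w \<in> F.span (e s ` B)" if "w \<in> carrier W" for s w
  proof -
    interpret E: linear_map class_ring W "fun_module S W" "e s"
      by (rule linear_mapI[OF W F.vectorspace_axioms e_hom])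
    have eB: "e s ` B \<subseteq> carrier (fun_module S W)" using B(2) by auto
    have sub: "subspace class_ring (F.span (e s ` B)) (fun_module S W)" by (rule F.span_is_subspace[OF eB])
    have "subspace class_ring {w \<in> carrier W. e s w \<in> F.span (e s ` B)} W"
      by (rule W.subspaceI) (use subspaceD[OF sub] in auto)
    then have "W.span B \<subseteq> {w \<in> carrier W. e s w \<in> F.span (e s ` B)}"
      by (rule W.span_subspace_subset) (use B(2) F.in_own_span[OF eB] in auto)
    then show ?thesis using that B(3) by blast
  qed
  have "F.span (\<Union>s\<in>S. e s ` B) = carrier (fun_module S W)"
  proof (rule F.span_parts[OF S, where part = "\<lambda>T f. \<lambda>x\<in>S. if x \<in> T then f x else \<zero>\<^bsub>W\<^esub>"])
    show "e s ` B \<subseteq> carrier (fun_module S W)" for s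
      using e_hom[of s] B(2) by (auto simp: LinearCombinations.module_hom_def)
    fix f :: "'a \<Rightarrow> 'w" assume f: "f \<in> carrier (fun_module S W)"
    then have f': "f x \<in> carrier W" if "x \<in> S" for x using that by (auto simp: fun_module_def)
    show "(\<lambda>x\<in>S. if x \<in> {} then f x else \<zero>\<^bsub>W\<^esub>) = \<zero>\<^bsub>(fun_module S W :: ('k, 'a \<Rightarrow> 'w) module)\<^esub>"
      by (simp add: fun_module_def)
    show "(\<lambda>x\<in>S. if x \<in> S then f x else \<zero>\<^bsub>W\<^esub>) = f"
      using f by (auto simp: fun_module_def fun_eq_iff PiE_def extensional_def)
    fix s T assume s: "T \<subseteq> S" "s \<in> S - T"
    show "\<exists>w\<in>F.span (e s ` B). (\<lambda>x\<in>S. if x \<in> insert s T then f x else \<zero>\<^bsub>W\<^esub>)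
        = (\<lambda>x\<in>S. if x \<in> T then f x else \<zero>\<^bsub>W\<^esub>) \<oplus>\<^bsub>fun_module S W\<^esub> w"
      using s f' by (intro bexI[of _ "e s (f s)"] e_span) (auto simp: e_def fun_module_def fun_eq_iff)
  qed
  moreover have "(\<Union>s\<in>S. e s ` B) \<subseteq> carrier (fun_module S W)"
    using e_hom B(2) by (fastforce simp: LinearCombinations.module_hom_def)
  moreover have "finite (\<Union>s\<in>S. e s ` B)" using S B(1) by blast
  ultimately show ?thesis unfolding F.fin_dim_def by blast
qed

end

lemma func_space_vectorspace: "vectorspace class_ring (class_ring.func_space S :: ('k::field, 'a \<Rightarrow> 'k) module)"
proof -
  interpret F: vectorspace "class_ring :: 'k ring" "class_ring.func_space S :: ('k, 'a \<Rightarrow> 'k) module"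
    by (simp add: class_vectorspace class_cring.func_space_is_module)
  show ?thesis by (rule F.vectorspace_axioms)
qed

lemma fin_dim_func_space:
  assumes S: "finite S"
  shows "vectorspace.fin_dim class_ring (class_ring.func_space S :: ('k::field, 'a \<Rightarrow> 'k) module)"
    and "vectorspace.dim class_ring (class_ring.func_space S :: ('k, 'a \<Rightarrow> 'k) module) \<le> card S"
proof -
  let ?F = "class_ring.func_space S :: ('k, 'a \<Rightarrow> 'k) module"
  interpret F: vectorspace class_ring ?F by (rule func_space_vectorspace)
  define e where "e s = (\<lambda>x\<in>S. if x = s then 1 else 0 :: 'k)" for s
  have e: "e s \<in> carrier ?F" for s by (auto simp: e_def class_ring.func_space_def)
  have gen: "F.span (\<Union>s\<in>S. {e s}) = carrier ?F"
  proof (rule F.span_parts[OF S, where part = "\<lambda>T f. \<lambda>x\<in>S. if x \<in> T then f x else 0"])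
    show "{e s} \<subseteq> carrier ?F" for s using e by simp
    fix f assume f: "f \<in> carrier ?F"
    show "(\<lambda>x\<in>S. if x \<in> {} then f x else 0) = \<zero>\<^bsub>?F\<^esub>"
      by (simp add: class_ring.func_space_def)
    show "(\<lambda>x\<in>S. if x \<in> S then f x else 0) = f"
      using f by (auto simp: class_ring.func_space_def fun_eq_iff PiE_def extensional_def)
    fix s T assume s: "T \<subseteq> S" "s \<in> S - T"
    have sp: "f s \<odot>\<^bsub>?F\<^esub> e s \<in> F.span {e s}"
      using subspaceD[OF F.span_is_subspace[of "{e s}"]] F.in_own_span[of "{e s}"] e by auto
    show "\<exists>w\<in>F.span {e s}. (\<lambda>x\<in>S. if x \<in> insert s T then f x else 0)
        = (\<lambda>x\<in>S. if x \<in> T then f x else 0) \<oplus>\<^bsub>?F\<^esub> w"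
      using s by (intro bexI[OF _ sp]) (auto simp: e_def class_ring.func_space_def fun_eq_iff)
  qed
  have "(\<Union>s\<in>S. {e s}) \<subseteq> carrier ?F" "finite (\<Union>s\<in>S. {e s})" using e S by auto
  then show F.fin_dim "F.dim \<le> card S"
    using gen F.gen_ge_dim[of "\<Union>s\<in>S. {e s}"] card_image_le[OF S, of e]
    unfolding F.fin_dim_def by (blast, force simp: UNION_singleton_eq_range)
qed

lemma (in abelian_group) a_inv_zero: "\<ominus> \<zero> = \<zero>"
  by (rule minus_equality) simp_all

text \<open>Transport of the vector space axioms along a surjection that commutes with the operations;
  used for the projection onto a quotient.\<close>

lemma vectorspace_image:
  assumes V: "vectorspace (class_ring :: 'k::field ring) V"
    and surj: "carrier Q = \<pi> ` carrier V" and zero: "\<zero>\<^bsub>Q\<^esub> = \<pi> \<zero>\<^bsub>V\<^esub>"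
    and add: "\<And>v w. v \<in> carrier V \<Longrightarrow> w \<in> carrier V \<Longrightarrow> \<pi> v \<oplus>\<^bsub>Q\<^esub> \<pi> w = \<pi> (v \<oplus>\<^bsub>V\<^esub> w)"
    and smult: "\<And>c v. v \<in> carrier V \<Longrightarrow> c \<odot>\<^bsub>Q\<^esub> \<pi> v = \<pi> (c \<odot>\<^bsub>V\<^esub> v)"
  shows "vectorspace (class_ring :: 'k ring) Q" and "linear_map (class_ring :: 'k ring) V Q \<pi>"
proof -
  interpret V: vectorspace "class_ring :: 'k ring" V by (rule V)
  show Q: "vectorspace (class_ring :: 'k ring) Q"
  proof (rule vs_criteria)
    show "\<forall>v\<in>carrier Q. \<exists>neg_v\<in>carrier Q. v \<oplus>\<^bsub>Q\<^esub> neg_v = \<zero>\<^bsub>Q\<^esub>"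
    proof
      fix v assume "v \<in> carrier Q"
      then obtain w where "w \<in> carrier V" "v = \<pi> w" unfolding surj by blast
      then show "\<exists>neg_v\<in>carrier Q. v \<oplus>\<^bsub>Q\<^esub> neg_v = \<zero>\<^bsub>Q\<^esub>"
        by (intro bexI[of _ "\<pi> (\<ominus>\<^bsub>V\<^esub> w)"]) (simp_all add: surj zero add V.M.r_neg)
    qed
  qed (auto simp: class_field surj zero add smult V.M.a_ac V.smult_l_distr[simplified]
        V.smult_r_distr[simplified] V.smult_assoc1[simplified] V.smult_one[simplified])
  show "linear_map (class_ring :: 'k ring) V Q \<pi>"
    by (rule linear_mapI[OF V Q]) (auto simp: LinearCombinations.module_hom_def surj add smult)
qed

lemma module_homD:
  assumes "T \<in> LinearCombinations.module_hom class_ring V W"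
  shows hom_closed: "v \<in> carrier V \<Longrightarrow> T v \<in> carrier W"
    and hom_add: "v \<in> carrier V \<Longrightarrow> w \<in> carrier V \<Longrightarrow> T (v \<oplus>\<^bsub>V\<^esub> w) = T v \<oplus>\<^bsub>W\<^esub> T w"
    and hom_smult: "v \<in> carrier V \<Longrightarrow> T (c \<odot>\<^bsub>V\<^esub> v) = c \<odot>\<^bsub>W\<^esub> T v"
  using assms by (auto simp: LinearCombinations.module_hom_def)

context
  fixes V :: "('k::field, 'v, 'c) module_scheme" and W :: "'v set"
  assumes V: "vectorspace class_ring V" and W: "subspace class_ring W V"
begin

interpretation V: vectorspace class_ring V by (rule V)

interpretation W: abelian_subgroup W V
proof (rule abelian_subgroupI3)
  have "\<ominus>\<^bsub>V\<^esub> w \<in> W" if "w \<in> W" for w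
  proof -
    have "w \<in> carrier V" using that subspace_subset[OF W] by blast
    then have "\<ominus>\<^bsub>V\<^esub> w = (- 1) \<odot>\<^bsub>V\<^esub> w"
      using V.smult_minus_1[of w] by (simp add: class_ring_simps)
    then show ?thesis using subspace_smult[OF W, of "- 1" w] that by simp
  qed
  then show "additive_subgroup W V"
    using subspaceD[OF W] by (auto intro!: additive_subgroup.intro subgroup.intro simp: a_inv_def)
  show "abelian_group V" by (rule V.M.abelian_group_axioms)
qed

lemma coset_eq_iff:
  assumes "v \<in> carrier V" "w \<in> carrier V"
  shows "W +>\<^bsub>V\<^esub> v = W +>\<^bsub>V\<^esub> w \<longleftrightarrow> v \<ominus>\<^bsub>V\<^esub> w \<in> W"
  using W.a_rcos_module[OF assms(2,1)] W.a_repr_independence'[of v w]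
    W.a_repr_independenceD[of v w] assms
  by (auto simp: a_minus_def)

text \<open>The value of an operation on a coset is defined as the union of the cosets obtained from its
  representatives. These all coincide for a linear \<open>T\<close> that preserves \<open>W\<close>. Multiplication by a
  scalar and the action of a group element are both of this form.\<close>

lemma union_coset:
  assumes T: "T \<in> LinearCombinations.module_hom class_ring V V" "T ` W \<subseteq> W" and v: "v \<in> carrier V"
  shows "(\<Union>a\<in>W +>\<^bsub>V\<^esub> v. W +>\<^bsub>V\<^esub> T a) = W +>\<^bsub>V\<^esub> T v"
proof -
  interpret T: linear_map class_ring V V T by (rule linear_mapI[OF V V T(1)])
  have "W +>\<^bsub>V\<^esub> T a = W +>\<^bsub>V\<^esub> T v" if a: "a \<in> W +>\<^bsub>V\<^esub> v" for a
  proof -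
    have ac: "a \<in> carrier V"
      using a V.M.a_r_coset_subset_G[OF subspace_subset[OF W] v] by blast
    have "a \<ominus>\<^bsub>V\<^esub> v \<in> W" using W.a_rcos_module[OF v ac] a by (simp add: a_minus_def)
    then have "T (a \<ominus>\<^bsub>V\<^esub> v) \<in> W" using T(2) by blast
    then show ?thesis using ac v by (subst coset_eq_iff) simp_all
  qed
  moreover have "v \<in> W +>\<^bsub>V\<^esub> v" by (rule W.a_rcos_self[OF v])
  ultimately show ?thesis by blast
qed

lemma quotient_projection:
  shows quotient_vectorspace: "vectorspace class_ring (quotient_module V W)"
    and quotient_linear: "linear_map class_ring V (quotient_module V W) (\<lambda>v. W +>\<^bsub>V\<^esub> v)"
proof -
  have 1: "carrier (quotient_module V W) = (\<lambda>v. W +>\<^bsub>V\<^esub> v) ` carrier V"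
    by (auto simp: quotient_module_def A_RCOSETS_def')
  have 2: "\<zero>\<^bsub>quotient_module V W\<^esub> = W +>\<^bsub>V\<^esub> \<zero>\<^bsub>V\<^esub>"
    using W.a_rcos_const[OF subspace_zero[OF W]] by (simp add: quotient_module_def)
  have 3: "(W +>\<^bsub>V\<^esub> v) \<oplus>\<^bsub>quotient_module V W\<^esub> (W +>\<^bsub>V\<^esub> w) = W +>\<^bsub>V\<^esub> (v \<oplus>\<^bsub>V\<^esub> w)"
    if "v \<in> carrier V" "w \<in> carrier V" for v w
    using W.a_rcos_sum[OF that] by (simp add: quotient_module_def)
  have 4: "c \<odot>\<^bsub>quotient_module V W\<^esub> (W +>\<^bsub>V\<^esub> v) = W +>\<^bsub>V\<^esub> (c \<odot>\<^bsub>V\<^esub> v)" if "v \<in> carrier V" for c v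
  proof -
    have "(\<lambda>v. c \<odot>\<^bsub>V\<^esub> v) \<in> LinearCombinations.module_hom class_ring V V"
      by (auto simp: LinearCombinations.module_hom_def V.smult_r_distr[simplified] mult.commute
        V.smult_assoc1[simplified, symmetric])
    then show ?thesis
      using union_coset[OF _ _ that] subspace_smult[OF W] by (simp add: quotient_module_def image_subset_iff)
  qed
  show "vectorspace class_ring (quotient_module V W)" by (rule vectorspace_image[OF V 1 2 3 4])
  show "linear_map class_ring V (quotient_module V W) (\<lambda>v. W +>\<^bsub>V\<^esub> v)"
    by (rule vectorspace_image[OF V 1 2 3 4])
qed

lemma carrier_quotient: "carrier (quotient_module V W) = (\<lambda>v. W +>\<^bsub>V\<^esub> v) ` carrier V"
  by (auto simp: quotient_module_def A_RCOSETS_def')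

lemma fin_dim_quotient:
  assumes "vectorspace.fin_dim class_ring V"
  shows "vectorspace.fin_dim class_ring (quotient_module V W)"
  by (rule linear_map.surj_fin_dim[OF quotient_linear assms]) (simp add: carrier_quotient)

lemma coset_eq_zero_iff: "v \<in> carrier V \<Longrightarrow> W +>\<^bsub>V\<^esub> v = \<zero>\<^bsub>quotient_module V W\<^esub> \<longleftrightarrow> v \<in> W"
proof -
  assume v: "v \<in> carrier V"
  have "\<zero>\<^bsub>quotient_module V W\<^esub> = W +>\<^bsub>V\<^esub> \<zero>\<^bsub>V\<^esub>"
    using W.a_rcos_const[OF subspace_zero[OF W]] by (simp add: quotient_module_def)
  then show ?thesis using coset_eq_iff[OF v V.M.zero_closed] v
    by (simp add: a_minus_def V.M.a_inv_zero)
qed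

end

section \<open>Spaces of linear maps\<close>

context
  fixes U :: "('k::field, 'u, 'c) module_scheme" and W :: "('k, 'w, 'd) module_scheme"
  assumes U: "vectorspace class_ring U" and W: "vectorspace class_ring W"
begin

interpretation U: vectorspace class_ring U by (rule U)
interpretation W: vectorspace class_ring W by (rule W)

lemma lin_maps_subspace:
  "subspace class_ring (LinearCombinations.module_hom class_ring U W \<inter> extensional (carrier U))
     (fun_module (carrier U) W)"
  by (rule vectorspace.subspaceI[OF fun_module_vectorspace[OF W]])
    (auto simp: fun_module_def LinearCombinations.module_hom_def PiE_def Pi_iff W.M.a_ac
      W.smult_r_distr[simplified] W.smult_assoc1[simplified, symmetric] mult.commute extensional_def)

lemma lin_maps_vectorspace: "vectorspace class_ring (lin_maps U W)"
  unfolding lin_maps_def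
  by (rule vectorspace.subspace_is_vs[OF fun_module_vectorspace[OF W] lin_maps_subspace])

text \<open>A linear map is determined by its values on a finite generating set \<open>B\<close> of \<open>U\<close>, so restriction
  to \<open>B\<close> embeds the space of linear maps into the finite-dimensional space of functions from \<open>B\<close> to
  \<open>W\<close>.\<close>

lemma fin_dim_lin_maps:
  assumes "vectorspace.fin_dim class_ring U" "vectorspace.fin_dim class_ring W"
  shows "vectorspace.fin_dim class_ring (lin_maps U W)"
proof -
  obtain B where B: "finite B" "B \<subseteq> carrier U" "U.span B = carrier U"
    using assms(1) unfolding U.fin_dim_def by blast
  interpret T: linear_map class_ring "lin_maps U W" "fun_module B W" "\<lambda>f. restrict f B"
    by (rule linear_mapI[OF lin_maps_vectorspace fun_module_vectorspace[OF W]])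
      (use B(2) in \<open>auto simp: LinearCombinations.module_hom_def lin_maps_def fun_module_def fun_eq_iff\<close>)
  show ?thesis
  proof (rule T.fin_dim_if_inj(1)[OF _ fin_dim_fun_module[OF W B(1) assms(2)]])
    show "inj_on (\<lambda>f. restrict f B) (carrier (lin_maps U W))"
    proof (rule inj_onI)
      fix f g assume f: "f \<in> carrier (lin_maps U W)" and g: "g \<in> carrier (lin_maps U W)"
        and eq: "restrict f B = restrict g B"
      have "linear_map class_ring U W f" "linear_map class_ring U W g"
        using f g by (auto simp: lin_maps_def intro!: linear_mapI U W)
      then have "f u = g u" if "u \<in> carrier U" for u
        using linear_map.linear_eq_on_span[of class_ring U W f g B u] B eq that
        by (metis restrict_apply')
      then show "f = g" using f g extensionalityI[of f "carrier U" g] by (auto simp: lin_maps_def)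
    qed
  qed
qed

end

section \<open>Group modules\<close>

context group_module
begin

lemma act_closed: "g \<in> carrier G \<Longrightarrow> v \<in> carrier V \<Longrightarrow> act V g v \<in> carrier V"
  by (rule hom_closed[OF act_linear])

lemma act_add: "g \<in> carrier G \<Longrightarrow> v \<in> carrier V \<Longrightarrow> w \<in> carrier V \<Longrightarrow>
    act V g (v \<oplus>\<^bsub>V\<^esub> w) = act V g v \<oplus>\<^bsub>V\<^esub> act V g w"
  by (rule hom_add[OF act_linear])

lemma act_smult: "g \<in> carrier G \<Longrightarrow> v \<in> carrier V \<Longrightarrow> act V g (c \<odot>\<^bsub>V\<^esub> v) = c \<odot>\<^bsub>V\<^esub> act V g v"
  by (rule hom_smult[OF act_linear])

lemma act_linear_map: "g \<in> carrier G \<Longrightarrow> linear_map class_ring V V (act V g)"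
  by (rule linear_mapI[OF V.vectorspace_axioms V.vectorspace_axioms act_linear])

lemma act_minus: "g \<in> carrier G \<Longrightarrow> v \<in> carrier V \<Longrightarrow> w \<in> carrier V \<Longrightarrow>
    act V g (v \<ominus>\<^bsub>V\<^esub> w) = act V g v \<ominus>\<^bsub>V\<^esub> act V g w"
  by (rule mod_hom.f_minus[OF linear_map.axioms(3)[OF act_linear_map]])

lemma act_zero: "g \<in> carrier G \<Longrightarrow> act V g \<zero>\<^bsub>V\<^esub> = \<zero>\<^bsub>V\<^esub>"
  by (rule linear_map.T0_is_0[OF act_linear_map])

lemma restrict_group_module:
  assumes "subgroup H G"
  shows "group_module (G\<lparr>carrier := H\<rparr>) V"
proof -
  have "H \<subseteq> carrier G" by (rule subgroup.subset[OF assms])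
  then show ?thesis
    by (intro group_module.intro group_module_axioms.intro G.subgroup_imp_group[OF assms]
        V.vectorspace_axioms) (auto simp: act_linear act_one act_mult subset_iff)
qed

lemma fixed_points_subspace:
  "X \<subseteq> carrier G \<Longrightarrow> subspace class_ring (fixed_points X V) V"
  by (rule V.subspaceI) (auto simp: fixed_points_def act_add act_smult act_zero subset_iff)

lemma quotient_group_module:
  assumes W: "group_submodule G W V"
  shows "group_module G (quotient_gmodule V W)"
    and "linear_map class_ring V (quotient_gmodule V W) (\<lambda>v. W +>\<^bsub>V\<^esub> v)"
    and "\<And>g v. g \<in> carrier G \<Longrightarrow> v \<in> carrier V \<Longrightarrow>
      act (quotient_gmodule V W) g (W +>\<^bsub>V\<^esub> v) = W +>\<^bsub>V\<^esub> act V g v"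
proof -
  have sub: "subspace class_ring W V" and inv: "\<And>g. g \<in> carrier G \<Longrightarrow> act V g ` W \<subseteq> W"
    using W by (auto simp: group_submodule_def)
  note vs = V.vectorspace_axioms
  let ?Q = "quotient_gmodule V W"
  have Qs: "carrier ?Q = carrier (quotient_module V W)" "\<zero>\<^bsub>?Q\<^esub> = \<zero>\<^bsub>quotient_module V W\<^esub>"
    "add ?Q = add (quotient_module V W)" "smult ?Q = smult (quotient_module V W)"
    by (simp_all add: quotient_gmodule_def module.extend_def gmodule.fields_def quotient_module_def)
  have Q: "vectorspace class_ring ?Q"
    by (rule vectorspace_cong[OF quotient_vectorspace[OF vs sub]]) (simp_all add: Qs)
  show proj: "linear_map class_ring V ?Q (\<lambda>v. W +>\<^bsub>V\<^esub> v)"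
    by (rule linear_mapI[OF vs Q])
      (use mod_hom.f_hom[OF linear_map.axioms(3)[OF quotient_linear[OF vs sub]]]
        in \<open>simp add: LinearCombinations.module_hom_def Qs\<close>)
  interpret P: linear_map class_ring V ?Q "\<lambda>v. W +>\<^bsub>V\<^esub> v" by (rule proj)
  show act: "act ?Q g (W +>\<^bsub>V\<^esub> v) = W +>\<^bsub>V\<^esub> act V g v" if "g \<in> carrier G" "v \<in> carrier V" for g v
    using union_coset[OF vs sub act_linear[OF that(1)] inv[OF that(1)] that(2)]
    by (simp add: quotient_gmodule_def module.extend_def gmodule.fields_def quotient_module_def)
  have car: "carrier ?Q = (\<lambda>v. W +>\<^bsub>V\<^esub> v) ` carrier V" unfolding Qs by (rule carrier_quotient[OF vs sub])
  show "group_module G ?Q"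
  proof (intro group_module.intro group_module_axioms.intro)
    show "group G" by (rule G.group_axioms)
    show "vectorspace class_ring ?Q" by (rule Q)
    show "act ?Q g \<in> LinearCombinations.module_hom class_ring ?Q ?Q" if g: "g \<in> carrier G" for g
      unfolding LinearCombinations.module_hom_def
    proof (intro CollectI conjI allI impI Pi_I)
      fix v w assume "v \<in> carrier ?Q \<and> w \<in> carrier ?Q"
      then obtain v' w' where vw: "v = W +>\<^bsub>V\<^esub> v'" "w = W +>\<^bsub>V\<^esub> w'" "v' \<in> carrier V" "w' \<in> carrier V"
        unfolding car by blast
      show "act ?Q g (v \<oplus>\<^bsub>?Q\<^esub> w) = act ?Q g v \<oplus>\<^bsub>?Q\<^esub> act ?Q g w"
        unfolding vw(1,2) using vw(3,4) g
        by (simp add: P.T_add[symmetric] act act_add act_closed del: P.T_add)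
    next
      fix c :: 'k and v assume "c \<in> carrier class_ring \<and> v \<in> carrier ?Q"
      then obtain v' where v: "v = W +>\<^bsub>V\<^esub> v'" "v' \<in> carrier V" unfolding car by blast
      show "act ?Q g (c \<odot>\<^bsub>?Q\<^esub> v) = c \<odot>\<^bsub>?Q\<^esub> act ?Q g v"
        unfolding v(1) using v(2) g
        by (simp add: P.T_smult[symmetric] act act_smult act_closed del: P.T_smult)
    next
      fix v assume "v \<in> carrier ?Q"
      then obtain v' where v: "v = W +>\<^bsub>V\<^esub> v'" "v' \<in> carrier V" unfolding car by blast
      then show "act ?Q g v \<in> carrier ?Q" using g by (simp add: act act_closed)
    qed
    show "act ?Q \<one>\<^bsub>G\<^esub> v = v" if "v \<in> carrier ?Q" for v
      using that unfolding car by (auto simp: act act_one)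
    show "act ?Q (g \<otimes>\<^bsub>G\<^esub> h) v = act ?Q g (act ?Q h v)"
      if "g \<in> carrier G" "h \<in> carrier G" "v \<in> carrier ?Q" for g h v
      using that unfolding car by (auto simp: act act_mult act_closed)
  qed
qed

section \<open>The first cohomology space\<close>

lemma cocycles1_subspace: "subspace class_ring (cocycles1 G V) (fun_module (carrier G) V)"
proof (rule vectorspace.subspaceI[OF fun_module_vectorspace[OF V.vectorspace_axioms]])
  show "cocycles1 G V \<subseteq> carrier (fun_module (carrier G) V)" by (auto simp: cocycles1_def fun_module_def)
  show "\<zero>\<^bsub>fun_module (carrier G) V\<^esub> \<in> cocycles1 G V" by (auto simp: cocycles1_def fun_module_def act_zero)
  fix z assume z: "z \<in> cocycles1 G V"
  then have zc: "\<And>g. g \<in> carrier G \<Longrightarrow> z g \<in> carrier V" by (auto simp: cocycles1_def)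
  show "c \<odot>\<^bsub>fun_module (carrier G) V\<^esub> z \<in> cocycles1 G V" for c
    using z zc by (auto simp: cocycles1_def fun_module_def act_smult act_closed V.smult_r_distr[simplified])
  fix z' assume z': "z' \<in> cocycles1 G V"
  then have zc': "\<And>g. g \<in> carrier G \<Longrightarrow> z' g \<in> carrier V" by (auto simp: cocycles1_def)
  show "z \<oplus>\<^bsub>fun_module (carrier G) V\<^esub> z' \<in> cocycles1 G V"
    using z z' zc zc' by (auto simp: cocycles1_def fun_module_def act_add V.M.a_ac act_closed)
qed

abbreviation cocycle_space where
  "cocycle_space \<equiv> (fun_module (carrier G) V)\<lparr>carrier := cocycles1 G V\<rparr>"

lemma cocycle_space_vectorspace: "vectorspace class_ring cocycle_space"
  by (rule vectorspace.subspace_is_vs[OF fun_module_vectorspace[OF V.vectorspace_axioms] cocycles1_subspace])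

lemma coboundaries1_subspace: "subspace class_ring (coboundaries1 G V) cocycle_space"
proof (rule vectorspace.subspaceI[OF cocycle_space_vectorspace])
  show "coboundaries1 G V \<subseteq> carrier cocycle_space"
  proof
    fix z assume "z \<in> coboundaries1 G V"
    then obtain v where v: "z = (\<lambda>g\<in>carrier G. act V g v \<ominus>\<^bsub>V\<^esub> v)" "v \<in> carrier V"
      unfolding coboundaries1_def by blast
    have "act V (g \<otimes>\<^bsub>G\<^esub> h) v \<ominus>\<^bsub>V\<^esub> v = (act V g v \<ominus>\<^bsub>V\<^esub> v) \<oplus>\<^bsub>V\<^esub> act V g (act V h v \<ominus>\<^bsub>V\<^esub> v)"
      if gh: "g \<in> carrier G" "h \<in> carrier G" for g h
    proof -
      let ?a = "act V g v" and ?b = "act V g (act V h v)"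
      have c: "?a \<in> carrier V" "?b \<in> carrier V" using gh v(2) by (simp_all add: act_closed)
      have "(?a \<ominus>\<^bsub>V\<^esub> v) \<oplus>\<^bsub>V\<^esub> (?b \<ominus>\<^bsub>V\<^esub> ?a) = (?a \<ominus>\<^bsub>V\<^esub> ?a) \<oplus>\<^bsub>V\<^esub> (?b \<ominus>\<^bsub>V\<^esub> v)"
        using c v(2) by (simp add: a_minus_def V.M.a_ac)
      also have "\<dots> = ?b \<ominus>\<^bsub>V\<^esub> v" using c v(2) by simp
      finally show ?thesis using gh v(2) by (simp add: act_mult act_minus act_closed)
    qed
    then show "z \<in> carrier cocycle_space"
      using v by (auto simp: cocycles1_def act_closed)
  qed
  show "\<zero>\<^bsub>cocycle_space\<^esub> \<in> coboundaries1 G V"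
    unfolding coboundaries1_def
    by (intro CollectI exI[of _ "\<zero>\<^bsub>V\<^esub>"]) (auto simp: fun_module_def act_zero a_minus_def V.M.a_inv_zero fun_eq_iff)
  fix z assume "z \<in> coboundaries1 G V"
  then obtain v where v: "z = (\<lambda>g\<in>carrier G. act V g v \<ominus>\<^bsub>V\<^esub> v)" "v \<in> carrier V"
    unfolding coboundaries1_def by blast
  show "c \<odot>\<^bsub>cocycle_space\<^esub> z \<in> coboundaries1 G V" for c
    unfolding coboundaries1_def
    by (intro CollectI exI[of _ "c \<odot>\<^bsub>V\<^esub> v"])
      (use v in \<open>auto simp: fun_module_def act_smult act_closed a_minus_def V.smult_r_distr[simplified]
        V.smult_r_minus[simplified] fun_eq_iff\<close>)
  fix z' assume "z' \<in> coboundaries1 G V"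
  then obtain v' where v': "z' = (\<lambda>g\<in>carrier G. act V g v' \<ominus>\<^bsub>V\<^esub> v')" "v' \<in> carrier V"
    unfolding coboundaries1_def by blast
  show "z \<oplus>\<^bsub>cocycle_space\<^esub> z' \<in> coboundaries1 G V"
    unfolding coboundaries1_def
    by (intro CollectI exI[of _ "v \<oplus>\<^bsub>V\<^esub> v'"])
      (use v v' in \<open>auto simp: fun_module_def act_add act_closed a_minus_def V.M.minus_add V.M.a_ac fun_eq_iff\<close>)
qed

lemma cohomology1_linear:
  "linear_map class_ring cocycle_space (cohomology1 G V) (\<lambda>z. coboundaries1 G V +>\<^bsub>cocycle_space\<^esub> z)"
  unfolding cohomology1_def by (rule quotient_linear[OF cocycle_space_vectorspace coboundaries1_subspace])

lemma cohomology1_eq_zero_iff: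
  "z \<in> cocycles1 G V \<Longrightarrow>
   coboundaries1 G V +>\<^bsub>cocycle_space\<^esub> z = \<zero>\<^bsub>cohomology1 G V\<^esub> \<longleftrightarrow> z \<in> coboundaries1 G V"
  unfolding cohomology1_def
  by (rule coset_eq_zero_iff[OF cocycle_space_vectorspace coboundaries1_subspace]) simp

lemma fin_dim_cohomology1:
  assumes "finite (carrier G)" "V.fin_dim"
  shows "vectorspace.fin_dim class_ring (cohomology1 G V)"
proof -
  note F = fun_module_vectorspace[OF V.vectorspace_axioms]
  have "vectorspace.fin_dim class_ring cocycle_space"
    by (rule vectorspace.fin_dim_subspace(1)[OF F
          fin_dim_fun_module[OF V.vectorspace_axioms assms] cocycles1_subspace])
  then show ?thesis
    unfolding cohomology1_def by (rule fin_dim_quotient[OF cocycle_space_vectorspace coboundaries1_subspace])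
qed

end

section \<open>Schur's lemma\<close>

definition poly_space :: "('k::field, 'k poly) module" where
  "poly_space = \<lparr>carrier = UNIV, monoid.mult = (*), one = 1, zero = 0, add = (+), smult = Polynomial.smult\<rparr>"

lemma poly_space_vectorspace: "vectorspace class_ring (poly_space :: ('k::field, 'k poly) module)"
proof (rule vs_criteria)
  show "\<forall>v\<in>carrier poly_space. \<exists>neg_v\<in>carrier poly_space.
      v \<oplus>\<^bsub>poly_space\<^esub> neg_v = \<zero>\<^bsub>(poly_space :: ('k, 'k poly) module)\<^esub>"
    by (simp add: poly_space_def) (metis add.right_inverse)
qed (simp_all add: poly_space_def class_field smult_add_left smult_add_right add_ac)

text \<open>The degrees of finitely many polynomials are bounded, and so are the degrees of the
  polynomials in their span.\<close>

lemma poly_space_infinite_dim: "\<not> vectorspace.fin_dim class_ring (poly_space :: ('k::field, 'k poly) module)"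
proof
  interpret P: vectorspace class_ring "poly_space :: ('k, 'k poly) module" by (rule poly_space_vectorspace)
  assume "P.fin_dim"
  then obtain A :: "'k poly set" where A: "finite A" "P.span A = UNIV"
    unfolding P.fin_dim_def by (auto simp: poly_space_def)
  define d where "d = Max (insert 0 (degree ` A))"
  have d: "degree p \<le> d" if "p \<in> A" for p unfolding d_def using A(1) that by (intro Max_ge) auto
  have "subspace class_ring {p :: 'k poly. degree p \<le> d} poly_space"
    by (rule P.subspaceI) (auto simp: poly_space_def degree_add_le order_trans[OF degree_smult_le])
  then have "P.span A \<subseteq> {p. degree p \<le> d}" by (rule P.span_subspace_subset) (use d in auto)
  then have "degree (monom (1::'k) (Suc d)) \<le> d" using A(2) by blast
  then show False by (simp add: degree_monom_eq)
qed

text \<open>The linear map \<open>p \<mapsto> p(\<phi>) v\<close> from the polynomials to \<open>V\<close> is not injective, because the space of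
  polynomials has infinite dimension. A nonzero polynomial \<open>p\<close> of least degree with \<open>p(\<phi>) v = 0\<close> has
  a root \<open>c\<close>. If \<open>p = (X - c) q\<close>, then \<open>q(\<phi>) v\<close> is nonzero by minimality and is an eigenvector for
  \<open>c\<close>.\<close>

lemma eigenvector_exists:
  fixes V :: "('k::alg_closed_field, 'v, 'c) module_scheme"
  assumes V: "vectorspace class_ring V" and fd: "vectorspace.fin_dim class_ring V"
    and \<phi>: "\<phi> \<in> LinearCombinations.module_hom class_ring V V"
    and v: "v \<in> carrier V" "v \<noteq> \<zero>\<^bsub>V\<^esub>"
  obtains c w where "w \<in> carrier V" "w \<noteq> \<zero>\<^bsub>V\<^esub>" "\<phi> w = c \<odot>\<^bsub>V\<^esub> w"
proof -
  interpret V: vectorspace class_ring V by (rule V)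
  interpret F: linear_map class_ring V V \<phi> by (rule linear_mapI[OF V V \<phi>])
  \<comment> \<open>\<open>ev p\<close> is \<open>p(\<phi>) v\<close>, evaluated by Horner's scheme.\<close>
  define ev where "ev p = foldr (\<lambda>a w. a \<odot>\<^bsub>V\<^esub> v \<oplus>\<^bsub>V\<^esub> \<phi> w) (coeffs p) \<zero>\<^bsub>V\<^esub>" for p :: "'k poly"
  have ev_0: "ev 0 = \<zero>\<^bsub>V\<^esub>" by (simp add: ev_def)
  have l0: "0 \<odot>\<^bsub>V\<^esub> w = \<zero>\<^bsub>V\<^esub>" if "w \<in> carrier V" for w
    using V.lmult_0[OF that] by simp
  have ev_pCons: "ev (pCons a p) = a \<odot>\<^bsub>V\<^esub> v \<oplus>\<^bsub>V\<^esub> \<phi> (ev p)" for a p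
    by (cases "p = 0 \<and> a = 0") (auto simp: ev_def coeffs_pCons_eq_cCons cCons_def l0[OF v(1)])
  have ev_closed: "ev p \<in> carrier V" for p
    by (induct p) (simp_all add: ev_0 ev_pCons v(1))
  have ev_add: "ev (p + q) = ev p \<oplus>\<^bsub>V\<^esub> ev q" for p q
  proof (induct p q rule: poly_induct2)
    case 0
    then show ?case by (simp add: ev_0)
  next
    case (pCons a p b q)
    have "(a + b) \<odot>\<^bsub>V\<^esub> v = a \<odot>\<^bsub>V\<^esub> v \<oplus>\<^bsub>V\<^esub> b \<odot>\<^bsub>V\<^esub> v" using V.smult_l_distr[of a b v] v(1) by simp
    then show ?case using pCons v(1) ev_closed by (simp add: ev_pCons V.M.a_ac)
  qed
  have ev_smult: "ev (Polynomial.smult c p) = c \<odot>\<^bsub>V\<^esub> ev p" for c p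
  proof (induct p)
    case 0
    show ?case using V.rmult_0[of c] by (simp add: ev_0)
  next
    case (pCons a p)
    then show ?case using v(1) ev_closed
      by (simp add: ev_pCons V.smult_r_distr[simplified] V.smult_assoc1[simplified])
  qed
  interpret E: linear_map class_ring poly_space V ev
    by (rule linear_mapI[OF poly_space_vectorspace V])
      (auto simp: LinearCombinations.module_hom_def poly_space_def ev_closed ev_add ev_smult)
  have "\<not> inj_on ev UNIV"
    using E.fin_dim_if_inj(1)[OF _ fd] poly_space_infinite_dim by (auto simp: poly_space_def)
  then obtain p q where pq: "p \<noteq> q" "ev p = ev q" by (auto simp: inj_on_def)
  have "ev (p - q) = ev p \<oplus>\<^bsub>V\<^esub> (- 1) \<odot>\<^bsub>V\<^esub> ev q"
    by (simp flip: ev_smult ev_add)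
  also have "\<dots> = \<zero>\<^bsub>V\<^esub>"
    using V.smult_minus_1[OF ev_closed[of q]] pq(2) V.M.r_neg[OF ev_closed] by (simp add: class_ring_simps)
  finally have "\<exists>p. p \<noteq> 0 \<and> ev p = \<zero>\<^bsub>V\<^esub>" using pq(1) by (intro exI[of _ "p - q"]) simp
  then obtain p where p: "p \<noteq> 0" "ev p = \<zero>\<^bsub>V\<^esub>"
    and min: "\<And>q. q \<noteq> 0 \<Longrightarrow> ev q = \<zero>\<^bsub>V\<^esub> \<Longrightarrow> degree p \<le> degree q"
    using ex_has_least_nat[of "\<lambda>p. p \<noteq> 0 \<and> ev p = \<zero>\<^bsub>V\<^esub>" _ degree] by blast
  have "degree p > 0"
  proof (rule ccontr)
    assume "\<not> degree p > 0"
    then obtain c where c: "p = [:c:]" using degree_eq_zeroE by blast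
    then have "c \<noteq> 0" using p(1) by simp
    moreover have "c \<odot>\<^bsub>V\<^esub> v = \<zero>\<^bsub>V\<^esub>" using p(2) v(1) by (simp add: c ev_pCons ev_0)
    then have "inverse c \<odot>\<^bsub>V\<^esub> (c \<odot>\<^bsub>V\<^esub> v) = \<zero>\<^bsub>V\<^esub>" using V.rmult_0[of "inverse c"] by simp
    ultimately show False
      using v V.smult_assoc1[of "inverse c" c v] V.smult_one[of v] by simp
  qed
  then obtain c where "poly p c = 0" using alg_closed_imp_poly_has_root by blast
  then obtain q where q: "p = [:-c, 1:] * q" by (auto simp: poly_eq_0_iff_dvd dvd_def)
  have q0: "q \<noteq> 0" using p(1) q by auto
  have "degree p = Suc (degree q)" unfolding q using q0 by (subst degree_mult_eq) auto
  then have ne: "ev q \<noteq> \<zero>\<^bsub>V\<^esub>" using min[OF q0] by fastforce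
  have "p = Polynomial.smult (- c) q + pCons 0 q" unfolding q by simp
  then have "ev p = ev (Polynomial.smult (- c) q + pCons 0 q)" by (rule arg_cong)
  also have "\<dots> = (- c) \<odot>\<^bsub>V\<^esub> ev q \<oplus>\<^bsub>V\<^esub> \<phi> (ev q)"
    unfolding ev_add ev_smult ev_pCons using v(1) ev_closed by (simp add: l0)
  finally have "ev p = (- c) \<odot>\<^bsub>V\<^esub> ev q \<oplus>\<^bsub>V\<^esub> \<phi> (ev q)" .
  moreover have "(- c) \<odot>\<^bsub>V\<^esub> ev q = \<ominus>\<^bsub>V\<^esub> (c \<odot>\<^bsub>V\<^esub> ev q)"
  proof -
    have "(- c) \<odot>\<^bsub>V\<^esub> ev q = (- 1) \<odot>\<^bsub>V\<^esub> (c \<odot>\<^bsub>V\<^esub> ev q)"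
      using V.smult_assoc1[of "- 1" c "ev q"] ev_closed by simp
    then show ?thesis using V.smult_minus_1[of "c \<odot>\<^bsub>V\<^esub> ev q"] ev_closed by (simp add: class_ring_simps)
  qed
  ultimately have "\<ominus>\<^bsub>V\<^esub> (c \<odot>\<^bsub>V\<^esub> ev q) \<oplus>\<^bsub>V\<^esub> \<phi> (ev q) = \<zero>\<^bsub>V\<^esub>" using p(2) by simp
  then have "\<phi> (ev q) = c \<odot>\<^bsub>V\<^esub> ev q"
    using ev_closed[of q] V.M.add.inv_solve_left[of "c \<odot>\<^bsub>V\<^esub> ev q" "\<zero>\<^bsub>V\<^esub>" "\<phi> (ev q)"]
      V.M.r_neg2[of "c \<odot>\<^bsub>V\<^esub> ev q" "\<phi> (ev q)"] by simp
  then show ?thesis using that ev_closed ne by blast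
qed

text \<open>An eigenspace of \<open>\<phi>\<close> is a nonzero submodule, hence everything.\<close>

lemma schur:
  fixes V :: "('k::alg_closed_field, 'v, 'g) gmodule"
  assumes gm: "group_module G V" and fd: "vectorspace.fin_dim class_ring V"
    and v: "v \<in> carrier V" "v \<noteq> \<zero>\<^bsub>V\<^esub>"
    and irr: "\<And>W. group_submodule G W V \<Longrightarrow> W = {\<zero>\<^bsub>V\<^esub>} \<or> W = carrier V"
    and \<phi>: "\<phi> \<in> LinearCombinations.module_hom class_ring V V"
    and comm: "\<And>g v. g \<in> carrier G \<Longrightarrow> v \<in> carrier V \<Longrightarrow> \<phi> (act V g v) = act V g (\<phi> v)"
  obtains c where "\<And>v. v \<in> carrier V \<Longrightarrow> \<phi> v = c \<odot>\<^bsub>V\<^esub> v"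
proof -
  interpret group_module G V by (rule gm)
  interpret F: linear_map class_ring V V \<phi>
    by (rule linear_mapI[OF V.vectorspace_axioms V.vectorspace_axioms \<phi>])
  obtain c w where w: "w \<in> carrier V" "w \<noteq> \<zero>\<^bsub>V\<^esub>" "\<phi> w = c \<odot>\<^bsub>V\<^esub> w"
    using eigenvector_exists[OF V.vectorspace_axioms fd \<phi> v] .
  let ?W = "{v \<in> carrier V. \<phi> v = c \<odot>\<^bsub>V\<^esub> v}"
  have "subspace class_ring ?W V"
    by (rule V.subspaceI) (use V.rmult_0[of c] V.smult_assoc1[of _ c, simplified, symmetric]
        V.smult_assoc1[of c, simplified, symmetric] in \<open>auto simp: V.smult_r_distr[simplified] mult.commute\<close>)
  then have "group_submodule G ?W V"
    by (auto simp: group_submodule_def act_closed comm act_smult)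
  then have "?W = carrier V" using irr[of ?W] w by blast
  then show ?thesis using that[of c] by blast
qed

text \<open>The orbit of a nonzero vector is finite and spans a submodule.\<close>

lemma irreducible_fin_dim:
  fixes V :: "('k::field, 'v, 'g) gmodule"
  assumes irr: "irreducible_module G V" and fin: "finite (carrier G)"
  shows "vectorspace.fin_dim class_ring V"
proof -
  interpret group_module G V using irr by (simp add: irreducible_module_def)
  obtain v where v: "v \<in> carrier V" "v \<noteq> \<zero>\<^bsub>V\<^esub>"
    using irr V.M.zero_closed unfolding irreducible_module_def by blast
  define A where "A = (\<lambda>g. act V g v) ` carrier G"
  have A: "A \<subseteq> carrier V" "finite A" using fin v by (auto simp: A_def act_closed)
  have sub: "subspace class_ring (V.span A) V" by (rule V.span_is_subspace[OF A(1)])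
  have "act V g w \<in> V.span A" if g: "g \<in> carrier G" and w: "w \<in> V.span A" for g w
  proof -
    have "subspace class_ring {w \<in> carrier V. act V g w \<in> V.span A} V"
      by (rule V.subspaceI) (use subspaceD[OF sub] g in \<open>auto simp: act_zero act_add act_smult\<close>)
    moreover have "A \<subseteq> {w \<in> carrier V. act V g w \<in> V.span A}"
    proof
      fix a assume "a \<in> A"
      then obtain h where h: "h \<in> carrier G" "a = act V h v" by (auto simp: A_def)
      then have "act V g a = act V (g \<otimes>\<^bsub>G\<^esub> h) v" using g v by (simp add: act_mult)
      then have "act V g a \<in> A" using g h by (auto simp: A_def)
      then show "a \<in> {w \<in> carrier V. act V g w \<in> V.span A}"
        using \<open>a \<in> A\<close> A(1) V.in_own_span[OF A(1)] by auto
    qed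
    ultimately have "V.span A \<subseteq> {w \<in> carrier V. act V g w \<in> V.span A}"
      by (rule V.span_subspace_subset)
    then show ?thesis using w by blast
  qed
  then have "group_submodule G (V.span A) V" using sub by (simp add: group_submodule_def)
  moreover have "v \<in> V.span A"
  proof -
    have "v \<in> A" unfolding A_def by (rule image_eqI[of _ _ "\<one>\<^bsub>G\<^esub>"]) (simp_all add: act_one v)
    then show ?thesis using V.in_own_span[OF A(1)] by blast
  qed
  ultimately have "V.span A = carrier V" using irr v unfolding irreducible_module_def by blast
  then show ?thesis unfolding V.fin_dim_def using A by blast
qed

section \<open>Groups without quotients of order \<open>p\<close>\<close>

text \<open>The homomorphism theorem, with the target replaced by the image.\<close>

lemma card_rcosets_kernel:
  assumes h: "group_hom G H h"
  shows "card (rcosets\<^bsub>G\<^esub> kernel G H h) = card (h ` carrier G)"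
proof -
  interpret group_hom G H h by (rule h)
  let ?H = "H\<lparr>carrier := h ` carrier G\<rparr>"
  have g: "group ?H" by (rule H.subgroup_imp_group[OF img_is_subgroup])
  have "h \<in> hom G ?H" using homh by (auto simp: hom_def)
  then have gh: "group_hom G ?H h"
    by (simp add: group_hom_def group_hom_axioms_def g G.group_axioms)
  have "G Mod kernel G ?H h \<cong> ?H" by (rule group_hom.FactGroup_iso[OF gh]) simp
  then have "card (carrier (G Mod kernel G ?H h)) = card (carrier ?H)"
    by (rule iso_same_card)
  moreover have "kernel G ?H h = kernel G H h" by (simp add: kernel_def)
  ultimately show ?thesis by (simp add: FactGroup_def)
qed

definition index_p_power :: "nat \<Rightarrow> ('g, 'a) monoid_scheme \<Rightarrow> 'g set \<Rightarrow> bool" where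
  "index_p_power p G N \<longleftrightarrow> N \<lhd> G \<and> (\<exists>k. card (rcosets\<^bsub>G\<^esub> N) = p ^ k)"

text \<open>\<open>A \<inter> B\<close> is the kernel of the map to \<open>G/A \<times> G/B\<close>, a group whose order is a power of \<open>p\<close>; the
  order of the image divides it.\<close>

lemma index_p_power_Int:
  assumes G: "group G" "finite (carrier G)" and p: "prime p"
    and A: "index_p_power p G A" and B: "index_p_power p G B"
  shows "index_p_power p G (A \<inter> B)"
proof -
  interpret G: group G by (rule G)
  interpret A: normal A G using A by (simp add: index_p_power_def)
  interpret B: normal B G using B by (simp add: index_p_power_def)
  let ?P = "(G Mod A) \<times>\<times> (G Mod B)"
  let ?h = "\<lambda>g. (A #>\<^bsub>G\<^esub> g, B #>\<^bsub>G\<^esub> g)"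
  have P: "group ?P" by (rule DirProd_group[OF A.factorgroup_is_group B.factorgroup_is_group])
  have hom: "?h \<in> hom G ?P"
    using A.r_coset_hom_Mod B.r_coset_hom_Mod by (auto simp: hom_def DirProd_def)
  have gh: "group_hom G ?P ?h" by (simp add: group_hom_def group_hom_axioms_def G P hom)
  interpret gh: group_hom G ?P ?h by (rule gh)
  have coset_id: "M #>\<^bsub>G\<^esub> g = M \<longleftrightarrow> g \<in> M" if "subgroup M G" "g \<in> carrier G" for M g
    using G.coset_join1[OF _ that(2,1)] G.coset_join2[OF that(2,1)] by blast
  have "kernel G ?P ?h = {g \<in> carrier G. A #>\<^bsub>G\<^esub> g = A \<and> B #>\<^bsub>G\<^esub> g = B}"
    by (simp add: kernel_def DirProd_def FactGroup_def)
  also have "\<dots> = {g \<in> carrier G. g \<in> A \<and> g \<in> B}"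
    by (rule Collect_cong) (use coset_id[OF A.subgroup_axioms] coset_id[OF B.subgroup_axioms] in blast)
  also have "\<dots> = A \<inter> B" using A.subset by blast
  finally have ker: "kernel G ?P ?h = A \<inter> B" .
  obtain k l where kl: "card (rcosets\<^bsub>G\<^esub> A) = p ^ k" "card (rcosets\<^bsub>G\<^esub> B) = p ^ l"
    using A B by (auto simp: index_p_power_def)
  have "card (?h ` carrier G) dvd Coset.order ?P"
    unfolding group.lagrange[OF P gh.img_is_subgroup, symmetric] by simp
  also have "Coset.order ?P = p ^ (k + l)"
    by (simp add: Coset.order_def DirProd_def FactGroup_def card_cartesian_product kl[unfolded RCOSETS_def] kl power_add)
  finally obtain m where "card (?h ` carrier G) = p ^ m"
    using p by (auto simp: divides_primepow_nat)
  moreover have "card (rcosets\<^bsub>G\<^esub> (A \<inter> B)) = card (?h ` carrier G)"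
    using card_rcosets_kernel[OF gh] by (simp only: ker)
  moreover have "A \<inter> B \<lhd> G" using gh.normal_kernel by (simp only: ker)
  ultimately show ?thesis by (auto simp: index_p_power_def)
qed

text \<open>A normal subgroup of \<open>p\<close>-power index with the smallest number of elements is contained in
  every other one, since intersections have \<open>p\<close>-power index again. So the least subgroup in the
  definition of \<^const>\<open>O_upper\<close> exists.\<close>

lemma O_upper_le:
  assumes G: "group G" "finite (carrier G)" and p: "prime p" and N: "index_p_power p G N"
  shows "O_upper p G \<subseteq> N"
proof -
  have sub: "M \<subseteq> carrier G" if "index_p_power p G M" for M
    using that normal_imp_subgroup subgroup.subset unfolding index_p_power_def by blast
  obtain M where M: "index_p_power p G M" "\<And>N. index_p_power p G N \<Longrightarrow> card M \<le> card N"
    using ex_has_least_nat[of "index_p_power p G" N card] N by blast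
  have least: "M \<subseteq> N" if "index_p_power p G N" for N
  proof -
    have "index_p_power p G (M \<inter> N)" by (rule index_p_power_Int[OF G p M(1) that])
    then have "card M \<le> card (M \<inter> N)" by (rule M(2))
    moreover have "finite M" using sub[OF M(1)] G(2) finite_subset by blast
    ultimately have "M \<inter> N = M" by (intro card_seteq) auto
    then show ?thesis by blast
  qed
  have "O_upper p G = M"
    unfolding O_upper_def
    by (rule Least_equality) (use M(1) least in \<open>auto simp: index_p_power_def\<close>)
  then show ?thesis using least[OF N] by simp
qed

text \<open>Cauchy's theorem: a prime divisor \<open>q\<close> of the order is the order of a subgroup, any nontrivial
  element of which has an order dividing both \<open>q\<close> and \<open>p\<close>.\<close>

lemma order_p_power_if_exponent:
  assumes G: "group G" "finite (carrier G)" and p: "prime p"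
    and exp: "\<And>x. x \<in> carrier G \<Longrightarrow> x [^]\<^bsub>G\<^esub> p = \<one>\<^bsub>G\<^esub>"
  shows "\<exists>k. Coset.order G = p ^ k"
proof -
  interpret G: group G by (rule G)
  have n0: "Coset.order G \<noteq> 0" using G(2) G.one_closed by (auto simp: Coset.order_def)
  have "q = p" if q: "prime q" "q dvd Coset.order G" for q
  proof -
    obtain m where m: "Coset.order G = q ^ 1 * m" using q(2) by auto
    \<comment> \<open>Sylow's theorem with exponent one.\<close>
    obtain H where H: "subgroup H G" "card H = q ^ 1" using sylow_thm[OF q(1) G(1) m G(2)] by blast
    have "1 < card H" using H(2) prime_gt_1_nat[OF q(1)] by simp
    have "\<not> H \<subseteq> {\<one>\<^bsub>G\<^esub>}"
    proof
      assume "H \<subseteq> {\<one>\<^bsub>G\<^esub>}"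
      then have "card H \<le> card {\<one>\<^bsub>G\<^esub>}" by (intro card_mono) simp_all
      then show False using \<open>1 < card H\<close> by simp
    qed
    then obtain x where x: "x \<in> H" "x \<noteq> \<one>\<^bsub>G\<^esub>" by blast
    have xG: "x \<in> carrier G" using x(1) subgroup.subset[OF H(1)] by blast
    interpret H: group "G\<lparr>carrier := H\<rparr>" by (rule G.subgroup_imp_group[OF H(1)])
    have "x [^]\<^bsub>G\<lparr>carrier := H\<rparr>\<^esub> Coset.order (G\<lparr>carrier := H\<rparr>) = \<one>\<^bsub>G\<lparr>carrier := H\<rparr>\<^esub>"
      by (rule H.pow_order_eq_1) (use x(1) in simp)
    then have "x [^]\<^bsub>G\<^esub> q = \<one>\<^bsub>G\<^esub>" using H(2) by (simp add: Coset.order_def nat_pow_def)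
    then have "G.ord x dvd q" "G.ord x dvd p" using G.pow_eq_id[OF xG] exp[OF xG] by auto
    moreover have "G.ord x \<noteq> 1" using G.ord_eq_1[OF xG] x(2) by simp
    ultimately show "q = p" using q(1) p by (metis prime_nat_iff)
  qed
  then have "prime_factors (Coset.order G) \<subseteq> {p}" by (auto simp: in_prime_factors_iff)
  then consider "prime_factors (Coset.order G) = {}" | "prime_factors (Coset.order G) = {p}" by blast
  then show ?thesis
  proof cases
    case 1
    then have "Coset.order G = p ^ 0" using prime_factorization_nat[of "Coset.order G"] n0 by simp
    then show ?thesis ..
  next
    case 2
    then have "Coset.order G = p ^ multiplicity p (Coset.order G)"
      using prime_factorization_nat[of "Coset.order G"] n0 by simp
    then show ?thesis ..
  qed
qed

text \<open>The image of \<open>c\<close> is an elementary abelian \<open>p\<close>-group, so the kernel has \<open>p\<close>-power index and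
  contains \<open>O\<^sup>p(G) = G\<close>.\<close>

lemma additive_hom_trivial:
  fixes c :: "'g \<Rightarrow> 'k::field"
  assumes G: "group G" "finite (carrier G)" and p: "prime p" "CHAR('k) = p"
    and O: "carrier G = O_upper p G"
    and c: "\<And>g h. g \<in> carrier G \<Longrightarrow> h \<in> carrier G \<Longrightarrow> c (g \<otimes>\<^bsub>G\<^esub> h) = c g + c h"
    and g: "g \<in> carrier G"
  shows "c g = 0"
proof -
  let ?H = "\<lparr>carrier = UNIV :: 'k set, monoid.mult = (+), one = 0\<rparr>"
  have H: "group ?H"
    by (rule groupI) (auto simp: add_ac intro: exI[of _ "- _"])
  interpret h: group_hom G ?H c
    by (simp add: group_hom_def group_hom_axioms_def G H hom_def c)
  let ?I = "?H\<lparr>carrier := c ` carrier G\<rparr>"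
  have I: "group ?I" by (rule group.subgroup_imp_group[OF H h.img_is_subgroup])
  have pow: "x [^]\<^bsub>?I\<^esub> m = of_nat m * x" for x and m :: nat
    by (induct m) (simp_all add: nat_pow_def algebra_simps)
  have "\<exists>k. Coset.order ?I = p ^ k"
  proof (rule order_p_power_if_exponent[OF I _ p(1)])
    show "finite (carrier ?I)" using G(2) by simp
    show "x [^]\<^bsub>?I\<^esub> p = \<one>\<^bsub>?I\<^esub>" for x
      using of_nat_CHAR[where 'a = 'k] p(2) unfolding pow by simp
  qed
  then have "index_p_power p G (kernel G ?H c)"
    using card_rcosets_kernel[OF h.group_hom_axioms] h.normal_kernel
    by (auto simp: index_p_power_def Coset.order_def)
  then have "g \<in> kernel G ?H c" using O_upper_le[OF G p(1)] O g by blast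
  then show ?thesis by (simp add: kernel_def)
qed

section \<open>Permutation modules as function spaces\<close>

definition perm_act :: "(nat \<Rightarrow> nat) \<Rightarrow> (nat set \<Rightarrow> 'k) \<Rightarrow> nat set \<Rightarrow> 'k" where
  "perm_act g f = (\<lambda>A. f (g -` A))"

text \<open>Elements of the permutation module on \<^term>\<open>\<Omega> n r\<close> are represented by functions on all sets of
  numbers, of which only the values on \<^term>\<open>\<Omega> n r\<close> matter. The last clause makes membership in \<open>N\<close>
  depend on these values alone, so that functions need not be restricted explicitly.\<close>

definition perm_submodule :: "nat \<Rightarrow> nat \<Rightarrow> (nat set \<Rightarrow> 'k::field) set \<Rightarrow> bool" where
  "perm_submodule n r N \<longleftrightarrow>
     (\<lambda>_. 0) \<in> N \<and>
     (\<forall>f\<in>N. \<forall>f'\<in>N. (\<lambda>A. f A + f' A) \<in> N) \<and>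
     (\<forall>c. \<forall>f\<in>N. (\<lambda>A. c * f A) \<in> N) \<and>
     (\<forall>g. g permutes {1..n} \<longrightarrow> (\<forall>f\<in>N. perm_act g f \<in> N)) \<and>
     (\<forall>f\<in>N. \<forall>f'. (\<forall>A\<in>\<Omega> n r. f A = f' A) \<longrightarrow> f' \<in> N)"

lemma perm_submoduleD:
  assumes "perm_submodule n r N"
  shows perm_submodule_zero: "(\<lambda>_. 0) \<in> N"
    and perm_submodule_add: "f \<in> N \<Longrightarrow> f' \<in> N \<Longrightarrow> (\<lambda>A. f A + f' A) \<in> N"
    and perm_submodule_smult: "f \<in> N \<Longrightarrow> (\<lambda>A. c * f A) \<in> N"
    and perm_submodule_act: "g permutes {1..n} \<Longrightarrow> f \<in> N \<Longrightarrow> perm_act g f \<in> N"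
    and perm_submodule_cong: "f \<in> N \<Longrightarrow> (\<And>A. A \<in> \<Omega> n r \<Longrightarrow> f A = f' A) \<Longrightarrow> f' \<in> N"
  using assms unfolding perm_submodule_def by blast+

lemma finite_Omega [simp]: "finite (\<Omega> n r)"
  unfolding \<Omega>_def by (rule finite_subset[of _ "Pow {1..n}"]) auto

lemma vimage_in_Omega_iff:
  assumes "g permutes {1..n}"
  shows "g -` A \<in> \<Omega> n r \<longleftrightarrow> A \<in> \<Omega> n r"
proof -
  have b: "bij g" using assms by (rule permutes_bij)
  have "g -` A \<subseteq> {1..n} \<longleftrightarrow> A \<subseteq> {1..n}"
  proof
    assume "g -` A \<subseteq> {1..n}"
    then have "g ` (g -` A) \<subseteq> g ` {1..n}" by blast
    then show "A \<subseteq> {1..n}"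
      using permutes_image[OF assms] surj_image_vimage_eq[OF bij_is_surj[OF b]] by simp
  next
    assume "A \<subseteq> {1..n}"
    then have "g -` A \<subseteq> g -` {1..n}" by blast
    then show "g -` A \<subseteq> {1..n}" using permutes_vimage[OF assms] by simp
  qed
  moreover have "card (g -` A) = card A"
    using card_vimage_inj[OF bij_is_inj[OF b], of A] bij_is_surj[OF b] by auto
  ultimately show ?thesis by (simp add: \<Omega>_def)
qed

lemma bij_betw_vimage_Omega:
  assumes g: "g permutes {1..n}"
  shows "bij_betw (\<lambda>A. g -` A) (\<Omega> n r) (\<Omega> n r)"
proof (rule bij_betwI[where g = "\<lambda>A. g ` A"])
  have b: "bij g" using g by (rule permutes_bij)
  show "(\<lambda>A. g -` A) \<in> \<Omega> n r \<rightarrow> \<Omega> n r" using vimage_in_Omega_iff[OF g] by auto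
  have img: "g -` (g ` A) = A" for A using b by (simp add: bij_is_inj inj_vimage_image_eq)
  show "(\<lambda>A. g ` A) \<in> \<Omega> n r \<rightarrow> \<Omega> n r" using vimage_in_Omega_iff[OF g, of "g ` _"] img by auto
  show "g -` (g ` A) = A" for A by (rule img)
  show "g ` (g -` A) = A" for A using b by (simp add: bij_is_surj surj_image_vimage_eq)
qed

lemma perm_act_comp: "perm_act (g \<circ> h) f = perm_act g (perm_act h f)"
  by (simp add: perm_act_def vimage_comp)

lemma sum_fun_apply: "(\<Sum>i\<in>S. g i) x = (\<Sum>i\<in>S. g i x :: 'k::comm_monoid_add)"
  by (induct S rule: infinite_finite_induct) auto

text \<open>A submodule is cut out by the linear functionals that vanish on it, and a functional on the
  functions on a finite set is the pairing with some function.\<close>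

lemma perm_submodule_separation:
  fixes v :: "nat set \<Rightarrow> 'k::field"
  assumes N: "perm_submodule n r N" and v: "v \<notin> N"
  obtains u where "\<And>f. f \<in> N \<Longrightarrow> (\<Sum>A\<in>\<Omega> n r. f A * u A) = 0" "(\<Sum>A\<in>\<Omega> n r. v A * u A) \<noteq> 0"
proof -
  interpret F: vector_space "\<lambda>(c::'k) (f::nat set \<Rightarrow> 'k) A. c * f A"
    by unfold_locales (auto simp: fun_eq_iff algebra_simps plus_fun_def)
  interpret K: vector_space "(*) :: 'k \<Rightarrow> 'k \<Rightarrow> 'k"
    by unfold_locales (auto simp: algebra_simps)
  interpret vector_space_pair "\<lambda>(c::'k) (f::nat set \<Rightarrow> 'k) A. c * f A" "(*) :: 'k \<Rightarrow> 'k \<Rightarrow> 'k"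
    by unfold_locales
  have sub: "F.subspace N"
    unfolding F.subspace_def using perm_submoduleD[OF N] by (auto simp: plus_fun_def zero_fun_def)
  obtain B where B: "B \<subseteq> N" "F.independent B" "N \<subseteq> F.span B"
    by (rule F.basis_exists[of N])
  have vB: "v \<notin> F.span B" using v B(1) sub F.span_minimal by blast
  have ind: "F.independent (insert v B)" using B(2) vB by (simp add: F.independent_insert)
  obtain \<phi> where lin: "Vector_Spaces.linear (\<lambda>(c::'k) (f::nat set \<Rightarrow> 'k) A. c * f A) (*) \<phi>"
    and \<phi>: "\<And>b. b \<in> insert v B \<Longrightarrow> \<phi> b = (if b = v then 1 else 0)"
    using linear_independent_extend[OF ind, of "\<lambda>b. if b = v then 1 else 0"] by blast
  interpret L: Vector_Spaces.linear "\<lambda>(c::'k) (f::nat set \<Rightarrow> 'k) A. c * f A" "(*) :: 'k \<Rightarrow> 'k \<Rightarrow> 'k" \<phi>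
    by (rule lin)
  have phiN: "\<phi> f = 0" if "f \<in> N" for f
  proof -
    have "f \<in> F.span B" using that B(3) by blast
    then show ?thesis
    proof (induct rule: F.span_induct)
      case base
      show ?case by (auto simp: F.subspace_def L.add L.scale L.zero)
    next
      case (step b)
      then show ?case using \<phi>[of b] vB F.span_base by auto
    qed
  qed
  \<comment> \<open>The pairing is with the values of \<open>\<phi>\<close> on the point masses: \<open>f\<close> and its expansion \<open>f0\<close> in point
    masses agree on \<^term>\<open>\<Omega> n r\<close>, so they differ by an element of \<open>N\<close>.\<close>
  define \<delta> :: "nat set \<Rightarrow> nat set \<Rightarrow> 'k" where "\<delta> = (\<lambda>A B. if B = A then 1 else 0)"
  have phi: "\<phi> f = (\<Sum>A\<in>\<Omega> n r. f A * \<phi> (\<delta> A))" for f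
  proof -
    define f0 where "f0 = (\<Sum>A\<in>\<Omega> n r. (\<lambda>B. f A * \<delta> A B))"
    have f0: "f0 A = f A" if "A \<in> \<Omega> n r" for A
    proof -
      have "f0 A = (\<Sum>A'\<in>\<Omega> n r. f A' * \<delta> A' A)" unfolding f0_def by (rule sum_fun_apply)
      also have "\<dots> = (\<Sum>A'\<in>\<Omega> n r. if A' = A then f A' else 0)"
        by (rule sum.cong) (auto simp: \<delta>_def)
      also have "\<dots> = f A" using that by simp
      finally show ?thesis .
    qed
    have "f - f0 \<in> N"
      by (rule perm_submodule_cong[OF N perm_submodule_zero[OF N]]) (simp add: f0)
    then have "\<phi> f - \<phi> f0 = 0" unfolding L.diff[of f f0, symmetric] by (rule phiN)
    then have "\<phi> f = \<phi> f0" by (rule eq_iff_diff_eq_0[THEN iffD2])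
    also have "\<phi> f0 = (\<Sum>A\<in>\<Omega> n r. \<phi> (\<lambda>B. f A * \<delta> A B))"
      unfolding f0_def by (rule L.sum)
    also have "\<dots> = (\<Sum>A\<in>\<Omega> n r. f A * \<phi> (\<delta> A))"
      by (rule sum.cong[OF refl]) (rule L.scale)
    finally show ?thesis .
  qed
  have v1: "\<phi> v = 1" by (rule trans[OF \<phi>[OF insertI1]]) (rule if_P[OF refl])
  have nz: "(\<Sum>A\<in>\<Omega> n r. v A * \<phi> (\<delta> A)) \<noteq> 0"
    using v1 by (rule ssubst[OF trans[OF phi[of v, symmetric]]]) (rule one_neq_zero)
  have z: "(\<Sum>A\<in>\<Omega> n r. f A * \<phi> (\<delta> A)) = 0" if "f \<in> N" for f
    by (rule trans[OF phi[of f, symmetric] phiN[OF that]])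
  show ?thesis by (rule that[OF z nz])
qed

section \<open>Polytabloids in characteristic two\<close>

definition points :: "(nat \<times> nat) list \<Rightarrow> nat list" where
  "points ps = concat (map (\<lambda>(x, x'). [x, x']) ps)"

lemma points_simps [simp]:
  "points [] = []" "points ((x, x') # ps) = x # x' # points ps"
  by (simp_all add: points_def)

definition splits :: "(nat \<times> nat) list \<Rightarrow> nat set \<Rightarrow> bool" where
  "splits ps A \<longleftrightarrow> (\<forall>(x, x')\<in>set ps. x \<in> A \<longleftrightarrow> x' \<notin> A)"

lemma splits_simps [simp]:
  "splits [] A" "splits ((x, x') # ps) A \<longleftrightarrow> (x \<in> A \<longleftrightarrow> x' \<notin> A) \<and> splits ps A"
  by (auto simp: splits_def)

lemma splits_cong:
  "(\<And>z. z \<in> set (points ps) \<Longrightarrow> z \<in> A \<longleftrightarrow> z \<in> B) \<Longrightarrow> splits ps A \<longleftrightarrow> splits ps B"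
  by (induct ps) auto

text \<open>The list \<open>ps\<close>, of length \<open>r\<close>, holds the columns of length two of a tableau of shape
  \<open>(n - r, r)\<close>. Signs are immaterial in characteristic two, so the polytabloid is the sum of all
  sets consisting of one point from each column: a four-cycle for \<open>r = 2\<close>, and the eight faces of an
  octahedron for \<open>r = 3\<close>.\<close>

definition polytabloid :: "(nat \<times> nat) list \<Rightarrow> nat set \<Rightarrow> 'k::field" where
  "polytabloid ps A = of_bool (A \<subseteq> set (points ps) \<and> splits ps A)"

text \<open>The pairing of \<open>f\<close> with the polytabloid (lemma \<open>sum_polytabloid\<close> below), computed by choosing
  a point from one column after the other.\<close>

fun altsum :: "(nat \<times> nat) list \<Rightarrow> (nat set \<Rightarrow> 'k::field) \<Rightarrow> 'k" where
  "altsum [] f = f {}"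
| "altsum ((x, x') # ps) f = altsum ps (\<lambda>A. f (insert x A)) + altsum ps (\<lambda>A. f (insert x' A))"

text \<open>The product of the elements \<open>1 + (x x')\<close> of the group algebra over the columns \<open>(x, x')\<close>,
  applied to \<open>f\<close>; in characteristic two it is the signed column sum of James.\<close>

fun symmetrize :: "(nat \<times> nat) list \<Rightarrow> (nat set \<Rightarrow> 'k::field) \<Rightarrow> nat set \<Rightarrow> 'k" where
  "symmetrize [] f = f"
| "symmetrize ((x, x') # ps) f =
     (\<lambda>A. symmetrize ps f A + perm_act (transpose x x') (symmetrize ps f) A)"

lemma card_splits:
  assumes "distinct (points ps)" "A \<subseteq> set (points ps)" "splits ps A"
  shows "card A = length ps"
  using assms
proof (induct ps arbitrary: A)
  case Nil
  then show ?case by simp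
next
  case (Cons p ps)
  obtain x x' where p: "p = (x, x')" by (cases p)
  have dx: "x \<notin> set (points ps)" "x' \<notin> set (points ps)" "x \<noteq> x'" "distinct (points ps)"
    using Cons.prems(1) p by auto
  have "splits ps (A - {x, x'}) \<longleftrightarrow> splits ps A"
    by (rule splits_cong) (use dx in auto)
  then have c: "card (A - {x, x'}) = length ps"
    using Cons.prems p dx by (intro Cons.hyps) auto
  have f: "finite (A - {x, x'})" using Cons.prems(2) finite_subset by blast
  define y where "y = (if x \<in> A then x else x')"
  have "insert y (A - {x, x'}) = A" using Cons.prems(3) p dx(3) by (auto simp: y_def)
  moreover have "card (insert y (A - {x, x'})) = Suc (card (A - {x, x'}))"
    by (rule card_insert_disjoint[OF f]) (simp add: y_def)
  ultimately have "card A = Suc (card (A - {x, x'}))" by (rule subst)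
  then show ?case by (simp only: c length_Cons)
qed

locale char_two =
  fixes ty :: "'k::field itself"
  assumes char2: "CHAR('k) = 2"
begin

lemma two_eq_0: "(2::'k) = 0"
  using of_nat_CHAR[where 'a = 'k] char2 by simp

lemma add_self [simp]: "(x::'k) + x = 0"
  using two_eq_0 by (metis mult_2 mult_zero_left)

lemma add_left_self [simp]: "(x::'k) + (x + y) = y"
  by (simp flip: add.assoc)

lemma add_eq_0_iff': "(x::'k) + y = 0 \<longleftrightarrow> x = y"
  by (metis add_self add_left_self add.right_neutral)

text \<open>If a column lies inside \<open>A\<close> or outside \<open>A\<close>, its transposition fixes \<open>A\<close>, and the two terms
  from this column cancel. Otherwise it exchanges the two choices of a point from the column.\<close>

lemma symmetrize_eq:
  fixes f :: "nat set \<Rightarrow> 'k"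
  assumes "distinct (points ps)"
  shows "symmetrize ps f A =
    (if splits ps A then altsum ps (\<lambda>B. f (B \<union> (A - set (points ps)))) else 0)"
  using assms
proof (induct ps arbitrary: A)
  case Nil
  then show ?case by simp
next
  case (Cons p ps)
  obtain x x' where p: "p = (x, x')" by (cases p)
  let ?t = "transpose x x'"
  have dx: "x \<notin> set (points ps)" "x' \<notin> set (points ps)" "x \<noteq> x'" "distinct (points ps)"
    using Cons.prems(1) p by auto
  have mem: "z \<in> ?t -` A \<longleftrightarrow> ?t z \<in> A" for z by simp
  have oth: "?t z = z" if "z \<in> set (points ps)" for z using that dx by (auto simp: transpose_def)
  have sp: "splits ps (?t -` A) \<longleftrightarrow> splits ps A"
    by (rule splits_cong) (use oth in auto)
  have rec: "symmetrize (p # ps) f A = symmetrize ps f A + symmetrize ps f (?t -` A)"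
    by (simp add: p perm_act_def)
  show ?case
  proof (cases "splits ps A \<and> (x \<in> A \<longleftrightarrow> x' \<notin> A)")
    case True
    let ?R = "A - set (points (p # ps))"
    have "A - set (points ps) = insert (if x \<in> A then x else x') ?R"
      using True p dx by auto
    moreover have "?t -` A - set (points ps) = insert (if x \<in> A then x' else x) ?R"
    proof (rule Set.set_eqI)
      fix z
      show "z \<in> ?t -` A - set (points ps) \<longleftrightarrow> z \<in> insert (if x \<in> A then x' else x) ?R"
        using True p dx by (cases "z = x"; cases "z = x'") (auto simp: transpose_def)
    qed
    ultimately show ?thesis
      unfolding rec using True sp by (simp add: Cons.hyps[OF dx(4)] p add.commute)
  next
    case False
    show ?thesis
    proof (cases "splits ps A")
      case True
      then have "x \<in> A \<longleftrightarrow> x' \<in> A" using False by blast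
      then have "?t -` A = A" by (auto simp: transpose_def split: if_splits)
      then show ?thesis unfolding rec using False True by (simp add: p)
    next
      case False
      then show ?thesis unfolding rec using sp by (simp add: Cons.hyps[OF dx(4)] p)
    qed
  qed
qed

text \<open>A set of size \<open>r\<close> that meets each of the \<open>r\<close> columns in one point contains no further point.\<close>

lemma symmetrize_eq_polytabloid:
  fixes f :: "nat set \<Rightarrow> 'k"
  assumes d: "distinct (points ps)" and A: "finite A" "card A = length ps"
  shows "symmetrize ps f A = altsum ps f * polytabloid ps A"
proof (cases "splits ps A")
  case True
  let ?I = "A \<inter> set (points ps)"
  have "splits ps ?I" using True splits_cong[of ps ?I A] by blast
  then have "card ?I = card A" using card_splits[OF d, of ?I] A by simp
  then have "?I = A" using A by (metis card_subset_eq inf_le1)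
  then have "A \<subseteq> set (points ps)" by blast
  then show ?thesis using True by (simp add: symmetrize_eq[OF d] polytabloid_def Diff_eq_empty_iff[THEN iffD2])
next
  case False
  then show ?thesis by (simp add: symmetrize_eq[OF d] polytabloid_def)
qed

lemma symmetrize_in:
  fixes f :: "nat set \<Rightarrow> 'k"
  assumes N: "perm_submodule n r N" and ps: "set (points ps) \<subseteq> {1..n}" and f: "f \<in> N"
  shows "symmetrize ps f \<in> N"
  using ps
proof (induct ps)
  case Nil
  then show ?case using f by simp
next
  case (Cons p ps)
  obtain x x' where p: "p = (x, x')" by (cases p)
  have t: "transpose x x' permutes {1..n}" using Cons.prems p by (intro permutes_swap_id) auto
  have s: "symmetrize ps f \<in> N" using Cons p by auto
  show ?case
    using perm_submodule_add[OF N s perm_submodule_act[OF N t s]] by (simp add: p)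
qed

end

lemma splits_perm_act:
  assumes "bij g"
  shows "splits (map (map_prod g g) ps) A \<longleftrightarrow> splits ps (g -` A)"
  by (induct ps) auto

lemma points_map: "points (map (map_prod g g) ps) = map g (points ps)"
  by (induct ps) auto

lemma perm_act_polytabloid:
  assumes "bij g"
  shows "perm_act g (polytabloid ps) = polytabloid (map (map_prod g g) ps)"
proof (rule ext)
  fix A
  have "g -` A \<subseteq> set (points ps) \<longleftrightarrow> A \<subseteq> g ` set (points ps)"
    using assms by (metis bij_def inj_image_subset_iff surj_image_vimage_eq)
  then show "perm_act g (polytabloid ps) A = (polytabloid (map (map_prod g g) ps) A :: 'a::field)"
    by (simp add: perm_act_def polytabloid_def splits_perm_act[OF assms] points_map)
qed

lemma permutes_map_list:
  assumes "distinct xs" "distinct ys" "length xs = length ys"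
    and "set xs \<subseteq> S" "set ys \<subseteq> S" "finite S"
  obtains g where "g permutes S" "map g xs = ys"
proof -
  have "card (S - set xs) = card (S - set ys)"
    using assms by (simp add: card_Diff_subset distinct_card)
  then obtain h where h: "bij_betw h (S - set xs) (S - set ys)"
    using finite_same_card_bij assms(6) by (metis finite_Diff)
  define m where "m = (\<lambda>x. the (map_of (zip xs ys) x))"
  have m: "m (xs ! i) = ys ! i" if "i < length xs" for i
    unfolding m_def using that assms(1,3) by (simp add: map_of_zip_nth)
  have mys: "map m xs = ys" using m assms(3) by (intro nth_equalityI) auto
  have mb: "bij_betw m (set xs) (set ys)"
  proof (rule bij_betw_imageI)
    show "inj_on m (set xs)" using mys assms(2) by (metis distinct_map)
    show "m ` set xs = set ys" using mys by (metis set_map)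
  qed
  define g where "g = (\<lambda>x. if x \<in> S then if x \<in> set xs then m x else h x else x)"
  have "bij_betw g S S"
  proof -
    have "bij_betw g (set xs) (set ys)"
      using mb by (rule bij_betw_cong[THEN iffD1, rotated]) (use assms(4) in \<open>auto simp: g_def\<close>)
    moreover have "bij_betw g (S - set xs) (S - set ys)"
      using h by (rule bij_betw_cong[THEN iffD1, rotated]) (auto simp: g_def)
    ultimately have "bij_betw g (set xs \<union> (S - set xs)) (set ys \<union> (S - set ys))"
      by (rule bij_betw_combine) blast
    then show ?thesis using assms(4,5) by (simp add: Un_absorb1)
  qed
  then have "g permutes S" by (rule bij_imp_permutes) (simp add: g_def)
  moreover have "map g xs = ys"
    unfolding mys[symmetric] using assms(4) by (auto simp: g_def)
  ultimately show ?thesis using that by blast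
qed

definition tableau :: "nat \<Rightarrow> nat \<Rightarrow> (nat \<times> nat) list \<Rightarrow> bool" where
  "tableau n r ps \<longleftrightarrow> length ps = r \<and> distinct (points ps) \<and> set (points ps) \<subseteq> {1..n}"

lemma length_points [simp]: "length (points ps) = 2 * length ps"
  by (induct ps) auto

lemma points_inj: "length ps = length qs \<Longrightarrow> points ps = points qs \<Longrightarrow> ps = qs"
  by (induct ps qs rule: list_induct2) auto

text \<open>Any two lists of distinct points of equal length are related by a permutation.\<close>

lemma tableau_transitive:
  assumes "tableau n r ps" "tableau n r qs"
  obtains g where "g permutes {1..n}" "map (map_prod g g) ps = qs"
proof -
  obtain g where g: "g permutes {1..n}" "map g (points ps) = points qs"
    by (rule permutes_map_list[of "points ps" "points qs" "{1..n}"])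
      (use assms in \<open>auto simp: tableau_def\<close>)
  have "map (map_prod g g) ps = qs"
    by (rule points_inj) (use g(2) assms in \<open>auto simp: tableau_def points_map\<close>)
  then show ?thesis using g that by blast
qed

lemma polytabloid_transitive:
  assumes N: "perm_submodule n r N" and ps: "tableau n r ps" and qs: "tableau n r qs"
    and e: "polytabloid ps \<in> N"
  shows "polytabloid qs \<in> N"
proof -
  obtain g where g: "g permutes {1..n}" "map (map_prod g g) ps = qs"
    using tableau_transitive[OF ps qs] .
  show ?thesis
    using perm_submodule_act[OF N g(1) e] perm_act_polytabloid[OF permutes_bij[OF g(1)], of ps] g(2)
    by metis
qed

context char_two
begin

text \<open>James's submodule theorem: the column sum of \<open>f\<close> lies in \<open>N\<close> and is the polytabloid times the
  pairing of \<open>f\<close> with it. If this factor is not zero, one polytabloid lies in \<open>N\<close>, and the symmetric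
  group permutes the polytabloids transitively.\<close>

lemma james_submodule:
  fixes f :: "nat set \<Rightarrow> 'k"
  assumes N: "perm_submodule n r N" and f: "f \<in> N"
    and ps: "tableau n r ps" and nz: "altsum ps f \<noteq> 0" and qs: "tableau n r qs"
  shows "polytabloid qs \<in> N"
proof (rule polytabloid_transitive[OF N ps qs])
  have s: "symmetrize ps f \<in> N"
    by (rule symmetrize_in[OF N _ f]) (use ps in \<open>auto simp: tableau_def\<close>)
  show "polytabloid ps \<in> N"
  proof (rule perm_submodule_cong[OF N perm_submodule_smult[OF N s]])
    fix A assume "A \<in> \<Omega> n r"
    then have "finite A" "card A = length ps"
      using ps finite_subset by (auto simp: \<Omega>_def tableau_def)
    then show "inverse (altsum ps f) * symmetrize ps f A = polytabloid ps A"
      using symmetrize_eq_polytabloid[of ps A f] ps nz by (simp add: tableau_def)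
  qed
qed

text \<open>The Garnir relation: a two-element subset of \<open>{w, x, y, z}\<close> is split by exactly two of the
  three partitions of these points into pairs, and every other subset by none of them.\<close>

lemma polytabloid_garnir:
  assumes "distinct (points ((w, x) # (y, z) # ps))"
  shows "polytabloid ((w, x) # (y, z) # ps) A + polytabloid ((w, y) # (x, z) # ps) A
      + polytabloid ((w, z) # (x, y) # ps) A = (0::'k)"
proof -
  have S: "set (points ((w, y) # (x, z) # ps)) = set (points ((w, x) # (y, z) # ps))"
     "set (points ((w, z) # (x, y) # ps)) = set (points ((w, x) # (y, z) # ps))" by auto
  show ?thesis
    unfolding polytabloid_def S splits_simps
    by (cases "A \<subseteq> set (points ((w, x) # (y, z) # ps)) \<and> splits ps A";
        cases "w \<in> A"; cases "x \<in> A"; cases "y \<in> A"; cases "z \<in> A") (simp_all del: points_simps)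
qed

text \<open>All polytabloids are congruent modulo \<open>N\<close>, since the symmetric group permutes them
  transitively and fixes each of them modulo \<open>N\<close>. Three of them add up to zero, and three times a
  vector is the vector itself in characteristic two.\<close>

lemma polytabloid_descends:
  assumes N: "perm_submodule n r (N :: (nat set \<Rightarrow> 'k) set)" and r: "r \<ge> 2"
    and triv: "\<And>qs g. tableau n r qs \<Longrightarrow> g permutes {1..n} \<Longrightarrow>
      (\<lambda>A. perm_act g (polytabloid qs) A + polytabloid qs A) \<in> N"
    and ps: "tableau n r ps"
  shows "polytabloid ps \<in> N"
proof -
  obtain w x y z qs where ps_eq: "ps = (w, x) # (y, z) # qs"
    using r ps unfolding tableau_def
    by (metis (no_types, lifting) One_nat_def Suc_le_length_iff numeral_2_eq_2 old.prod.exhaust)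
  let ?p2 = "(w, y) # (x, z) # qs" and ?p3 = "(w, z) # (x, y) # qs"
  have t: "tableau n r ?p2" "tableau n r ?p3" using ps by (auto simp: ps_eq tableau_def)
  have d: "(\<lambda>A. polytabloid qs A + polytabloid ps A) \<in> N" if t: "tableau n r qs" for qs
  proof -
    obtain g where g: "g permutes {1..n}" "map (map_prod g g) ps = qs"
      using tableau_transitive[OF ps t] .
    show ?thesis using triv[OF ps g(1)] g(2) perm_act_polytabloid[OF permutes_bij[OF g(1)]] by metis
  qed
  have "polytabloid ps = (\<lambda>A. (polytabloid ?p2 A + polytabloid ps A)
      + (polytabloid ?p3 A + polytabloid ps A) :: 'k)"
  proof
    fix A
    have "polytabloid ps A + polytabloid ?p2 A + polytabloid ?p3 A = (0::'k)"
      unfolding ps_eq by (rule polytabloid_garnir) (use ps in \<open>simp add: ps_eq tableau_def\<close>)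
    then show "polytabloid ps A = (polytabloid ?p2 A + polytabloid ps A)
      + (polytabloid ?p3 A + polytabloid ps A :: 'k)"
      by (simp add: add_ac add_eq_0_iff')
  qed
  then show ?thesis using perm_submodule_add[OF N d[OF t(1)] d[OF t(2)]] by simp
qed

end

lemma two_to_n_iff: "x \<in> {2..n} \<longleftrightarrow> x \<in> {1..n} \<and> x \<noteq> (1::nat)"
  by auto

(* Distinctness of points supplies many disequalities between natural numbers.
   Splitting them into cases is exponential, so linear arithmetic is told to ignore them. *)
declare [[linarith_neq_limit = 0]]

section \<open>Functions orthogonal to all polytabloids\<close>

text \<open>On functions on \<open>r\<close>-sets, \<open>superset_sum n r\<close> evaluated at \<open>s\<close>-sets is the map \<open>\<eta>\<close> from \<open>M\<^sub>r\<close>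
  to \<open>M\<^sub>s\<close>, and \<open>subset_sum n s\<close> evaluated at \<open>r\<close>-sets is its transpose. For \<open>r = s + 1\<close> the two are
  the boundary and coboundary maps of the full simplex with vertices \<open>1, \<dots>, n\<close> over a field of
  characteristic two.\<close>

definition subset_sum :: "nat \<Rightarrow> nat \<Rightarrow> (nat set \<Rightarrow> 'k::field) \<Rightarrow> nat set \<Rightarrow> 'k" where
  "subset_sum n s b A = (\<Sum>B\<in>{B \<in> \<Omega> n s. B \<subseteq> A}. b B)"

definition superset_sum :: "nat \<Rightarrow> nat \<Rightarrow> (nat set \<Rightarrow> 'k::field) \<Rightarrow> nat set \<Rightarrow> 'k" where
  "superset_sum n r v B = (\<Sum>A\<in>{A \<in> \<Omega> n r. B \<subseteq> A}. v A)"

lemma subset_sum_superset_sum_adjoint: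
  "(\<Sum>A\<in>\<Omega> n r. v A * subset_sum n s b A) = (\<Sum>B\<in>\<Omega> n s. superset_sum n r v B * b B)"
proof -
  have "(\<Sum>A\<in>\<Omega> n r. v A * subset_sum n s b A) = (\<Sum>A\<in>\<Omega> n r. \<Sum>B\<in>\<Omega> n s. if B \<subseteq> A then v A * b B else 0)"
    by (simp add: subset_sum_def sum_distrib_left sum.inter_filter if_distrib[where f = "\<lambda>x. v _ * x"] cong: if_cong)
  also have "\<dots> = (\<Sum>B\<in>\<Omega> n s. \<Sum>A\<in>\<Omega> n r. if B \<subseteq> A then v A * b B else 0)"
    by (rule sum.swap)
  also have "\<dots> = (\<Sum>B\<in>\<Omega> n s. superset_sum n r v B * b B)"
    by (simp add: superset_sum_def sum_distrib_right sum.inter_filter if_distrib[where f = "\<lambda>x. x * b _"] cong: if_cong)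
  finally show ?thesis .
qed

lemma Omega_0 [simp]: "\<Omega> n 0 = {{}}"
  using finite_subset[of _ "{1..n}"] by (auto simp: \<Omega>_def)

lemma Omega_1: "\<Omega> n 1 = (\<lambda>i. {i}) ` {1..n}"
  by (auto simp: \<Omega>_def card_Suc_eq)

lemma singleton_in_Omega [simp]: "{i} \<in> \<Omega> n (Suc 0) \<longleftrightarrow> i \<in> {1..n}"
  using Omega_1[of n] by auto

lemma Omega_1E:
  assumes "B \<in> \<Omega> n 1" obtains i where "B = {i}" "i \<in> {1..n}"
  using assms unfolding Omega_1 by blast

lemma pair_in_Omega: "{i, j} \<in> \<Omega> n 2 \<longleftrightarrow> i \<noteq> j \<and> i \<in> {1..n} \<and> j \<in> {1..n}"
  by (auto simp: \<Omega>_def card_insert_if)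

lemma triple_in_Omega:
  "{i, j, k} \<in> \<Omega> n 3 \<longleftrightarrow> distinct [i, j, k] \<and> {i, j, k} \<subseteq> {1..n}"
  by (auto simp: \<Omega>_def card_insert_if)

lemma Omega_2E:
  assumes "A \<in> \<Omega> n 2" obtains i j where "A = {i, j}" "i \<noteq> j" "i \<in> {1..n}" "j \<in> {1..n}"
  using assms by (auto simp: \<Omega>_def card_2_iff)

lemma Omega_3E:
  assumes "A \<in> \<Omega> n 3"
  obtains i j k where "A = {i, j, k}" "distinct [i, j, k]" "i \<in> {1..n}" "j \<in> {1..n}" "k \<in> {1..n}"
  using assms by (auto simp: \<Omega>_def card_3_iff)

lemma subset_sum_0 [simp]: "subset_sum n 0 b A = b {}"
proof -
  have "{B \<in> \<Omega> n 0. B \<subseteq> A} = {{}}" by auto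
  then show ?thesis by (simp add: subset_sum_def)
qed

lemma subset_sum_1: "A \<subseteq> {1..n} \<Longrightarrow> subset_sum n 1 b A = (\<Sum>i\<in>A. b {i})"
proof -
  assume "A \<subseteq> {1..n}"
  then have "{B \<in> \<Omega> n 1. B \<subseteq> A} = (\<lambda>i. {i}) ` A" unfolding Omega_1 by auto
  then show ?thesis by (simp add: subset_sum_def sum.reindex)
qed

lemma subset_sum_2_triple:
  assumes "distinct [i, j, k]" "{i, j, k} \<subseteq> {1..n}"
  shows "subset_sum n 2 b {i, j, k} = b {i, j} + (b {i, k} + b {j, k})"
proof -
  have "{B \<in> \<Omega> n 2. B \<subseteq> {i, j, k}} = {{i, j}, {i, k}, {j, k}}" (is "?L = ?R")
  proof (intro Set.equalityI subsetI)
    fix B assume "B \<in> ?L"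
    then obtain x y where "B = {x, y}" "x \<noteq> y" "{x, y} \<subseteq> {i, j, k}" by (auto elim: Omega_2E)
    then show "B \<in> ?R" by auto
  next
    fix B assume "B \<in> ?R"
    then show "B \<in> ?L" using assms pair_in_Omega[of _ _ n] by auto
  qed
  moreover have "distinct [{i, j}, {i, k}, {j, k}]" using assms(1) by (auto simp: doubleton_eq_iff)
  ultimately show ?thesis by (simp add: subset_sum_def)
qed

lemma obtain_two_outside:
  assumes "finite S" "finite T" "card T + 2 \<le> card S"
  obtains i j where "i \<in> S - T" "j \<in> S - T" "i \<noteq> j"
proof -
  have "2 \<le> card (S - T)" using assms diff_card_le_card_Diff[OF assms(2), of S] by linarith
  then obtain U where "U \<subseteq> S - T" "card U = 2" by (metis obtain_subset_with_card_n)
  then show ?thesis using that by (auto simp: card_2_iff)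
qed

text \<open>Two edges with a common vertex have the same value, and any two edges are joined by an edge
  that meets both.\<close>

lemma pair_function_constant:
  assumes sym: "\<And>i j. h i j = h j i"
    and step: "\<And>i j k. i \<in> S \<Longrightarrow> j \<in> S \<Longrightarrow> k \<in> S \<Longrightarrow> distinct [i, j, k] \<Longrightarrow> h i j = h i k"
    and "i \<in> S" "j \<in> S" "i \<noteq> j" "k \<in> S" "l \<in> S" "k \<noteq> l"
  shows "h i j = h k l"
proof -
  have st: "h i j = h i k" if "i \<in> S" "j \<in> S" "k \<in> S" "i \<noteq> j" "i \<noteq> k" for i j k
    using step[of i j k] that by (cases "j = k") auto
  show ?thesis
  proof (cases "j = k")
    case True
    then show ?thesis using st[of j i l] sym[of i j] assms(3-) by simp
  next
    case False
    then show ?thesis using st[of j i k] st[of k j l] sym[of i j] sym[of k j] assms(3-) by simp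
  qed
qed

context char_two
begin

lemma subset_sum_1_pair:
  "{i, j} \<in> \<Omega> n 2 \<Longrightarrow> subset_sum n 1 a {i, j} = a {i} + a {j}"
  unfolding pair_in_Omega by (subst subset_sum_1) auto

lemma subset_sum_1_triple:
  "{i, j, k} \<in> \<Omega> n 3 \<Longrightarrow> subset_sum n 1 a {i, j, k} = a {i} + (a {j} + a {k})"
  unfolding triple_in_Omega by (subst subset_sum_1) auto

text \<open>On the pairs \<open>ij\<close> that avoid \<open>1\<close>, subtracting \<open>u(1i) + u(1j)\<close> from \<open>u(ij)\<close> leaves \<open>\<tau>\<close>, and
  orthogonality to the four-cycles through \<open>1\<close> says that \<open>\<tau>\<close> is constant.\<close>

lemma orthogonal_pairs:
  fixes u :: "nat set \<Rightarrow> 'k"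
  assumes n: "n \<ge> 3" and orth: "\<And>ps. tableau n 2 ps \<Longrightarrow> altsum ps u = 0"
  obtains a b where "\<And>A. A \<in> \<Omega> n 2 \<Longrightarrow> u A = subset_sum n 1 a A + subset_sum n 0 b A"
proof -
  define \<tau> where "\<tau> i j = u {i, j} + (u {1, i} + u {1, j})" for i j
  have const: "\<tau> i j = \<tau> 2 3" if "i \<in> {2..n}" "j \<in> {2..n}" "i \<noteq> j" for i j
  proof (rule pair_function_constant[where S = "{2..n}"])
    show "\<tau> i j = \<tau> j i" for i j by (simp add: \<tau>_def insert_commute add_ac)
    fix i j k assume "i \<in> {2..n}" "j \<in> {2..n}" "k \<in> {2..n}" "distinct [i, j, k]"
    then have "altsum [(i, 1), (j, k)] u = 0" by (intro orth) (auto simp: tableau_def)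
    moreover have "altsum [(i, 1), (j, k)] u = \<tau> i j + \<tau> i k" by (simp add: \<tau>_def add_ac)
    ultimately show "\<tau> i j = \<tau> i k" by (simp only: add_eq_0_iff')
  qed (use that n in auto)
  define a where "a B = (if B = {1} then 0 else u (insert 1 B) + \<tau> 2 3)" for B
  show ?thesis
  proof (rule that[of a "\<lambda>_. \<tau> 2 3"])
    fix A assume A: "A \<in> \<Omega> n 2"
    then obtain i j where ij: "A = {i, j}" "i \<noteq> j" "i \<in> {1..n}" "j \<in> {1..n}" "j \<noteq> 1"
      by (metis Omega_2E insert_commute)
    have up: "subset_sum n 1 a A = a {i} + a {j}" using A subset_sum_1_pair ij(1) by simp
    show "u A = subset_sum n 1 a A + subset_sum n 0 (\<lambda>_. \<tau> 2 3) A"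
    proof (cases "i = 1")
      case True
      then show ?thesis using up ij by (simp add: a_def add_ac)
    next
      case False
      then have "u {i, j} + (u {1, i} + u {1, j}) = \<tau> 2 3" using const[of i j] ij
        unfolding two_to_n_iff \<tau>_def by blast
      then have "u {i, j} = u {i, j} + (u {i, j} + (u {1, i} + u {1, j}) + \<tau> 2 3)" by simp
      also have "\<dots> = u {1, i} + (u {1, j} + \<tau> 2 3)" by (simp add: add_ac)
      finally have "u {i, j} = u {1, i} + (u {1, j} + \<tau> 2 3)" .
      then show ?thesis using up ij False by (simp add: a_def add_ac)
    qed
  qed
qed

text \<open>The functions orthogonal to all octahedra. Subtracting the coboundary of \<open>jk \<mapsto> f(1jk)\<close> leaves
  a function \<open>F\<close> that vanishes on the triples through \<open>1\<close>. Orthogonality to the octahedra with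
  vertex \<open>1\<close> makes \<open>F(ijk) + F(ijl)\<close> independent of \<open>i\<close> and \<open>j\<close>. As a function of \<open>k\<close> and \<open>l\<close> it is
  then additive, hence of the form \<open>\<alpha>(k) + \<alpha>(l)\<close>, and \<open>F(ijk)\<close> is \<open>\<alpha>(i) + \<alpha>(j) + \<alpha>(k)\<close> up to a
  constant.\<close>

lemma orthogonal_triples:
  fixes f :: "nat set \<Rightarrow> 'k"
  assumes n: "n \<ge> 6" and orth: "\<And>ps. tableau n 3 ps \<Longrightarrow> altsum ps f = 0"
  obtains a b where "\<And>A. A \<in> \<Omega> n 3 \<Longrightarrow> f A = subset_sum n 1 a A + subset_sum n 2 b A"
proof -
  let ?S = "{2..n}"
  define F where "F i j k = f {i, j, k} + (f {1, i, j} + (f {1, i, k} + f {1, j, k}))" for i j k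
  have F12: "F i j k = F j i k" and F23: "F i j k = F i k j" for i j k
    by (simp_all add: F_def insert_commute add_ac)
  have step: "F i j k + F i j l = F i m k + F i m l"
    if "i \<in> ?S" "j \<in> ?S" "k \<in> ?S" "l \<in> ?S" "m \<in> ?S" "distinct [i, j, k, l, m]" for i j k l m
  proof -
    have "altsum [(i, 1), (j, m), (k, l)] f = 0"
      using that by (intro orth) (auto simp: tableau_def)
    moreover have "altsum [(i, 1), (j, m), (k, l)] f = (F i j k + F i j l) + (F i m k + F i m l)"
      by (simp add: F_def add_ac)
    ultimately show ?thesis by (simp only: add_eq_0_iff')
  qed
  define P where "P k l d \<longleftrightarrow> (\<forall>i\<in>?S - {k, l}. \<forall>j\<in>?S - {k, l}. i \<noteq> j \<longrightarrow> F i j k + F i j l = d)"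
    for k l d
  have two: "\<exists>i j. i \<in> ?S - {k, l, m} \<and> j \<in> ?S - {k, l, m} \<and> i \<noteq> j" for k l m
  proof -
    have "card {k, l, m} \<le> 3" by (simp add: card_insert_if)
    then have c: "card {k, l, m} + 2 \<le> card ?S" using n by simp
    have fin: "finite {k, l, m}" by simp
    obtain i j where "i \<in> ?S - {k, l, m}" "j \<in> ?S - {k, l, m}" "i \<noteq> j"
      by (rule obtain_two_outside[OF finite_atLeastAtMost fin c])
    then show ?thesis by blast
  qed
  have ex: "\<exists>d. P k l d" if kl: "k \<in> ?S" "l \<in> ?S" "k \<noteq> l" for k l
  proof -
    obtain i j where ij: "i \<in> ?S - {k, l}" "j \<in> ?S - {k, l}" "i \<noteq> j"
      using two[of k l l, unfolded insert_absorb2] by (elim exE conjE)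
    have "P k l (F i j k + F i j l)"
      unfolding P_def
    proof (intro ballI impI)
      fix i' j' assume ij': "i' \<in> ?S - {k, l}" "j' \<in> ?S - {k, l}" "i' \<noteq> j'"
      show "F i' j' k + F i' j' l = F i j k + F i j l"
      proof (rule pair_function_constant[where S = "?S - {k, l}" and h = "\<lambda>i j. F i j k + F i j l",
            OF _ _ ij'(1,2,3) ij(1,2,3)])
        show "F x y k + F x y l = F y x k + F y x l" for x y by (simp only: F12[of x y])
        show "F x y k + F x y l = F x z k + F x z l"
          if "x \<in> ?S - {k, l}" "y \<in> ?S - {k, l}" "z \<in> ?S - {k, l}" "distinct [x, y, z]" for x y z
        proof -
          have "z \<noteq> k" "z \<noteq> l" using that(3) by simp_all
          note this[symmetric]
          then show ?thesis by - (rule step, use that kl in simp_all)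
        qed
      qed
    qed
    then show ?thesis by (rule exI)
  qed
  define D where "D k l = (SOME d. P k l d)" for k l
  have D: "P k l (D k l)" if "k \<in> ?S" "l \<in> ?S" "k \<noteq> l" for k l
    unfolding D_def by (rule someI_ex[OF ex[OF that]])
  have D': "F i j k + F i j l = D k l"
    if "i \<in> ?S" "j \<in> ?S" "k \<in> ?S" "l \<in> ?S" "distinct [i, j, k, l]" for i j k l
    using D[of k l] that unfolding P_def by auto
  have D_add: "D k l = D m k + D m l" if "k \<in> ?S" "l \<in> ?S" "m \<in> ?S" "distinct [k, l, m]" for k l m
  proof -
    obtain i j where ij: "i \<in> ?S - {k, l, m}" "j \<in> ?S - {k, l, m}" "i \<noteq> j" using two[of k l m] by (elim exE conjE)
    have "D k l = F i j k + F i j l" "D m k = F i j m + F i j k" "D m l = F i j m + F i j l"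
      using D'[of i j k l] D'[of i j m k] D'[of i j m l] ij that by auto
    then show ?thesis by (simp add: add_ac)
  qed
  \<comment> \<open>\<open>D\<close> is meaningful for distinct arguments only, so the value of \<open>\<alpha>\<close> at \<open>2\<close> is given separately.\<close>
  define \<alpha> where "\<alpha> k = (if k = 2 then 0 else D 2 k)" for k
  define H where "H i j k = F i j k + (\<alpha> i + (\<alpha> j + \<alpha> k))" for i j k
  have H12: "H i j k = H j i k" for i j k
    unfolding H_def F12[of i j k] by (simp only: add_ac)
  have H23: "H i j k = H i k j" for i j k
    unfolding H_def F23[of i j k] by (simp only: add_ac)
  have Hstep: "H i j k = H i j l"
    if "i \<in> ?S" "j \<in> ?S" "k \<in> ?S" "l \<in> ?S" "distinct [i, j, k, l]" for i j k l
  proof -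
    have "D k l = \<alpha> k + \<alpha> l"
    proof -
      have DS: "D l k = D k l" using D'[of i j k l] D'[of i j l k] that by (auto simp: add_ac)
      show ?thesis
        using that D_add[of k l 2] n DS by (cases "k = 2"; cases "l = 2") (auto simp: \<alpha>_def)
    qed
    then have "F i j k + F i j l + (\<alpha> k + \<alpha> l) = 0" using D'[of i j k l] that by simp
    then have "H i j k + H i j l = 0" by (simp add: H_def add_ac)
    then show ?thesis by (simp only: add_eq_0_iff')
  qed
  have Hpair: "H i j k = H i j' k'"
    if "i \<in> ?S" "j \<in> ?S - {i}" "k \<in> ?S - {i}" "j \<noteq> k" "j' \<in> ?S - {i}" "k' \<in> ?S - {i}" "j' \<noteq> k'"
    for i j k j' k'
  proof (rule pair_function_constant[where S = "?S - {i}" and h = "H i",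
        OF _ _ that(2-7)])
    show "H i x y = H i y x" for x y by (rule H23)
    show "H i x y = H i x z"
      if "x \<in> ?S - {i}" "y \<in> ?S - {i}" "z \<in> ?S - {i}" "distinct [x, y, z]" for x y z
      by (rule Hstep) (use that \<open>i \<in> ?S\<close> in auto)
  qed
  have Hconst: "H i j k = H 2 3 4" if "i \<in> ?S" "j \<in> ?S" "k \<in> ?S" "distinct [i, j, k]" for i j k
  proof -
    obtain j' k' where jk': "j' \<in> ?S - {i, 2}" "k' \<in> ?S - {i, 2}" "j' \<noteq> k'"
      using two[of i 2 2, unfolded insert_absorb2] by (elim exE conjE)
    have "H i j k = H i j' k'" by (rule Hpair) (use that jk' in auto)
    also have "\<dots> = H j' k' i" using H12 H23 by metis
    also have "\<dots> = H j' k' 2" using Hstep[of j' k' i 2] jk' that n by (cases "i = 2") auto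
    also have "\<dots> = H 2 j' k'" using H12 H23 by metis
    also have "\<dots> = H 2 3 4" by (rule Hpair) (use n jk' in auto)
    finally show ?thesis .
  qed
  \<comment> \<open>The constant value \<open>H 2 3 4\<close> is absorbed into \<open>a\<close>: a triple avoiding \<open>1\<close> collects it three
    times, that is once. The values of \<open>b\<close> on pairs through \<open>1\<close> cancel the contribution of \<open>a\<close> on
    triples through \<open>1\<close>, and do not occur on the others.\<close>
  define a where "a B = (if B = {1} then 0 else \<alpha> (the_elem B) + H 2 3 4)" for B
  define b where "b B = (if 1 \<in> B then a (B - {1}) else f (insert 1 B))" for B
  show ?thesis
  proof (rule that[of a b])
    fix A assume A: "A \<in> \<Omega> n 3"
    then obtain i j k where ijk: "A = {i, j, k}" "distinct [i, j, k]" "j \<in> ?S" "k \<in> ?S" "i \<in> {1..n}"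
    proof -
      obtain x y z where xyz: "A = {x, y, z}" "distinct [x, y, z]" "x \<in> {1..n}" "y \<in> {1..n}" "z \<in> {1..n}"
        using A by (rule Omega_3E)
      show ?thesis
      proof (cases "y = 1 \<or> z = 1")
        case True
        then show ?thesis using xyz that[of y x z] that[of z x y]
          unfolding two_to_n_iff by (auto simp: insert_commute)
      next
        case False
        then show ?thesis using xyz that[of x y z] unfolding two_to_n_iff by auto
      qed
    qed
    have u1: "subset_sum n 1 a A = a {i} + (a {j} + a {k})" using subset_sum_1_triple A ijk(1) by blast
    have u2: "subset_sum n 2 b A = b {i, j} + (b {i, k} + b {j, k})"
      unfolding ijk(1) by (rule subset_sum_2_triple) (use ijk in auto)
    show "f A = subset_sum n 1 a A + subset_sum n 2 b A"
    proof (cases "i = 1")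
      case True
      have d: "{1, j} - {1} = {j}" "{1, k} - {1} = {k}" using ijk(3,4) by auto
      have "b {1, j} = a {j}" "b {1, k} = a {k}" by (simp_all only: b_def d) simp_all
      moreover have "b {j, k} = f {1, j, k}" using ijk(3,4) by (simp add: b_def)
      ultimately have "subset_sum n 2 b A = a {j} + (a {k} + f {1, j, k})"
        unfolding u2 True by (simp only:)
      moreover have "a {i} = 0" "f A = f {1, j, k}" using True ijk(1) by (simp_all add: a_def)
      ultimately show ?thesis unfolding u1 by (simp add: add_ac)
    next
      case False
      have b: "b {i, j} = f {1, i, j}" "b {i, k} = f {1, i, k}" "b {j, k} = f {1, j, k}"
        using False ijk by (auto simp: b_def)
      have "i \<in> ?S" unfolding two_to_n_iff using False ijk(5) by simp
      then have "H i j k = H 2 3 4" by (rule Hconst) (use ijk in auto)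
      then have "f {i, j, k} = f {i, j, k} + (H i j k + H 2 3 4)" by (simp only: add_self add_0_right)
      also have "\<dots> = f {1, i, j} + (f {1, i, k} + (f {1, j, k} + (\<alpha> i + (\<alpha> j + (\<alpha> k + H 2 3 4)))))"
        unfolding H_def[of i j k] F_def[of i j k] by (simp add: add_ac)
      also have "\<dots> = (a {i} + (a {j} + a {k})) + (f {1, i, j} + (f {1, i, k} + f {1, j, k}))"
      proof -
        have "a {i} = \<alpha> i + H 2 3 4" "a {j} = \<alpha> j + H 2 3 4" "a {k} = \<alpha> k + H 2 3 4"
          using False ijk(3,4) by (simp_all add: a_def)
        moreover have "x + (y + (z + (p + (q + (r + h))))) = ((p + h) + ((q + h) + (r + h))) + (x + (y + z))"
          for x y z p q r h :: 'k
          by (simp add: add_ac)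
        ultimately show ?thesis by (simp only:)
      qed
      finally show ?thesis unfolding u1 u2 b by (rule trans[OF arg_cong[OF ijk(1), of f]])
    qed
  qed
qed

end

section \<open>Submodules of the modules of pairs and triples\<close>

lemma perm_act_subset_sum:
  assumes g: "g permutes {1..n}"
  shows "perm_act g (subset_sum n s a) A = subset_sum n s (perm_act g a) A"
proof -
  have b: "bij g" using g by (rule permutes_bij)
  have "bij_betw (\<lambda>B. g -` B) {B \<in> \<Omega> n s. B \<subseteq> A} {B \<in> \<Omega> n s. B \<subseteq> g -` A}"
  proof (rule bij_betw_imageI)
    show "inj_on (\<lambda>B. g -` B) {B \<in> \<Omega> n s. B \<subseteq> A}"
      using bij_betw_imp_inj_on[OF bij_betw_vimage_Omega[OF g]] by (rule inj_on_subset) blast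
    show "(\<lambda>B. g -` B) ` {B \<in> \<Omega> n s. B \<subseteq> A} = {B \<in> \<Omega> n s. B \<subseteq> g -` A}"
    proof (intro Set.equalityI subsetI)
      fix B assume B: "B \<in> {B \<in> \<Omega> n s. B \<subseteq> g -` A}"
      have "B = g -` (g ` B)" using b by (simp add: bij_is_inj inj_vimage_image_eq)
      moreover from this have "g ` B \<in> \<Omega> n s" using B vimage_in_Omega_iff[OF g, of "g ` B"] by simp
      moreover have "g ` B \<subseteq> A" using B by blast
      ultimately show "B \<in> (\<lambda>B. g -` B) ` {B \<in> \<Omega> n s. B \<subseteq> A}" by blast
    qed (use vimage_in_Omega_iff[OF g] in auto)
  qed
  then show ?thesis
    unfolding perm_act_def subset_sum_def by (rule sum.reindex_bij_betw[symmetric])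
qed

lemma perm_act_superset_sum:
  assumes g: "g permutes {1..n}"
  shows "superset_sum n r (perm_act g v) B = perm_act g (superset_sum n r v) B"
proof -
  have b: "bij g" using g by (rule permutes_bij)
  have "bij_betw (\<lambda>A. g -` A) {A \<in> \<Omega> n r. B \<subseteq> A} {A \<in> \<Omega> n r. g -` B \<subseteq> A}"
  proof (rule bij_betw_imageI)
    show "inj_on (\<lambda>A. g -` A) {A \<in> \<Omega> n r. B \<subseteq> A}"
      using bij_betw_imp_inj_on[OF bij_betw_vimage_Omega[OF g]] by (rule inj_on_subset) blast
    show "(\<lambda>A. g -` A) ` {A \<in> \<Omega> n r. B \<subseteq> A} = {A \<in> \<Omega> n r. g -` B \<subseteq> A}"
    proof (intro Set.equalityI subsetI)
      fix A assume A: "A \<in> {A \<in> \<Omega> n r. g -` B \<subseteq> A}"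
      have "A = g -` (g ` A)" using b by (simp add: bij_is_inj inj_vimage_image_eq)
      moreover from this have "g ` A \<in> \<Omega> n r" using A vimage_in_Omega_iff[OF g, of "g ` A"] by simp
      moreover have "B \<subseteq> g ` A"
      proof -
        have "B = g ` (g -` B)" using b by (simp add: bij_is_surj surj_image_vimage_eq)
        then show ?thesis using A by blast
      qed
      ultimately show "A \<in> (\<lambda>A. g -` A) ` {A \<in> \<Omega> n r. B \<subseteq> A}" by blast
    qed (use vimage_in_Omega_iff[OF g] in auto)
  qed
  then show ?thesis
    unfolding perm_act_def superset_sum_def by (rule sum.reindex_bij_betw)
qed

lemma superset_sum_add: "superset_sum n r (\<lambda>A. v A + w A) B = superset_sum n r v B + superset_sum n r w B"
  by (simp add: superset_sum_def sum.distrib)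

lemma superset_sum_smult: "superset_sum n r (\<lambda>A. c * v A) B = c * superset_sum n r v B"
  by (simp add: superset_sum_def sum_distrib_left)

lemma superset_sum_cong: "(\<And>A. A \<in> \<Omega> n r \<Longrightarrow> v A = w A) \<Longrightarrow> superset_sum n r v B = superset_sum n r w B"
  by (simp add: superset_sum_def)

lemma perm_submodule_kernel: "perm_submodule n r {v. \<forall>B\<in>\<Omega> n s. superset_sum n r v B = 0}"
  unfolding perm_submodule_def
proof (intro conjI ballI allI impI)
  fix f f' :: "nat set \<Rightarrow> 'a" assume f: "f \<in> {v. \<forall>B\<in>\<Omega> n s. superset_sum n r v B = 0}"
  show "perm_act g f \<in> {v. \<forall>B\<in>\<Omega> n s. superset_sum n r v B = 0}" if g: "g permutes {1..n}" for g
    using f vimage_in_Omega_iff[OF g] unfolding mem_Collect_eq perm_act_superset_sum[OF g]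
    by (simp add: perm_act_def)
  show "f' \<in> {v. \<forall>B\<in>\<Omega> n s. superset_sum n r v B = 0}" if "\<forall>A\<in>\<Omega> n r. f A = f' A"
    using f superset_sum_cong[of n r f f'] that by simp
qed (simp_all add: superset_sum_add superset_sum_smult, simp add: superset_sum_def)

lemma perm_submodule_Int:
  assumes "perm_submodule n r M" "perm_submodule n r N"
  shows "perm_submodule n r (M \<inter> N)"
  using assms unfolding perm_submodule_def by (simp, blast)

lemma perm_submodule_image:
  assumes N: "perm_submodule n r N"
  shows "perm_submodule n s {w. \<exists>v\<in>N. \<forall>B\<in>\<Omega> n s. w B = superset_sum n r v B}"
    (is "perm_submodule n s ?I")
  unfolding perm_submodule_def
proof (intro conjI ballI allI impI)
  show "(\<lambda>_. 0) \<in> ?I"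
    using perm_submodule_zero[OF N] by (auto simp: superset_sum_def intro!: bexI[of _ "\<lambda>_. 0"])
next
  fix w assume "w \<in> ?I"
  then obtain v where v: "v \<in> N" "\<And>B. B \<in> \<Omega> n s \<Longrightarrow> w B = superset_sum n r v B" by blast
  show "(\<lambda>A. c * w A) \<in> ?I" for c
    using perm_submodule_smult[OF N v(1), of c] v(2)
    by (auto intro!: bexI[of _ "\<lambda>A. c * v A"] simp: superset_sum_smult)
  show "perm_act g w \<in> ?I" if g: "g permutes {1..n}" for g
    using perm_submodule_act[OF N g v(1)] v(2) vimage_in_Omega_iff[OF g]
    by (auto intro!: bexI[of _ "perm_act g v"] simp: perm_act_superset_sum[OF g]) (simp add: perm_act_def)
  show "w' \<in> ?I" if "\<forall>B\<in>\<Omega> n s. w B = w' B" for w' using v that by auto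
  fix w' assume "w' \<in> ?I"
  then obtain v' where v': "v' \<in> N" "\<And>B. B \<in> \<Omega> n s \<Longrightarrow> w' B = superset_sum n r v' B" by blast
  show "(\<lambda>A. w A + w' A) \<in> ?I"
    using perm_submodule_add[OF N v(1) v'(1)] v(2) v'(2)
    by (auto intro!: bexI[of _ "\<lambda>A. v A + v' A"] simp: superset_sum_add)
qed

lemma superset_sum_pairs:
  assumes "i \<in> {1..n}"
  shows "superset_sum n 2 v {i} = (\<Sum>j\<in>{1..n} - {i}. v {i, j})"
proof -
  have "inj_on (\<lambda>j. {i, j}) ({1..n} - {i})" by (rule inj_onI) (auto simp: doubleton_eq_iff)
  moreover have "{A \<in> \<Omega> n 2. {i} \<subseteq> A} = (\<lambda>j. {i, j}) ` ({1..n} - {i})"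
  proof (intro Set.equalityI subsetI)
    fix A assume "A \<in> {A \<in> \<Omega> n 2. {i} \<subseteq> A}"
    then obtain x y where "A = {x, y}" "x \<noteq> y" "x \<in> {1..n}" "y \<in> {1..n}" "i \<in> {x, y}"
      by (auto elim!: Omega_2E)
    then show "A \<in> (\<lambda>j. {i, j}) ` ({1..n} - {i})" by (auto simp: insert_commute)
  next
    fix A assume "A \<in> (\<lambda>j. {i, j}) ` ({1..n} - {i})"
    then obtain j where "A = {i, j}" "j \<in> {1..n} - {i}" by blast
    then show "A \<in> {A \<in> \<Omega> n 2. {i} \<subseteq> A}" using assms pair_in_Omega[of i j n] by auto
  qed
  ultimately show ?thesis by (simp add: superset_sum_def sum.reindex)
qed

context char_two
begin

text \<open>Every point lies in \<open>n - 1\<close> pairs, an odd number.\<close>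

lemma superset_sum_const_pairs:
  assumes "even n" "i \<in> {1..n}" "\<And>A. A \<in> \<Omega> n 2 \<Longrightarrow> v A = (c::'k)"
  shows "superset_sum n 2 v {i} = c"
proof -
  have "superset_sum n 2 v {i} = (\<Sum>j\<in>{1..n} - {i}. c)"
    unfolding superset_sum_pairs[OF assms(2)] by (rule sum.cong) (use assms in \<open>auto simp: pair_in_Omega\<close>)
  also have "\<dots> = of_nat (n - 1) * c" using assms(2) by simp
  also have "of_nat (n - 1) = (1::'k)"
  proof -
    have "odd (n - 1)" using assms(1,2) by (cases n) simp_all
    then obtain m where "n - 1 = 2 * m + 1" by (rule oddE)
    then show ?thesis by (simp add: two_eq_0)
  qed
  finally show ?thesis by simp
qed

text \<open>The sets split by \<open>(x, x') # ps\<close> arise from those split by \<open>ps\<close> by adding \<open>x\<close> or \<open>x'\<close>.\<close>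

lemma sum_polytabloid:
  fixes u :: "nat set \<Rightarrow> 'k"
  assumes "tableau n r ps"
  shows "(\<Sum>A\<in>\<Omega> n r. polytabloid ps A * u A) = altsum ps u"
proof -
  define S where "S ps = {A. A \<subseteq> set (points ps) \<and> splits ps A}" for ps
  have d: "distinct (points ps)" using assms by (simp add: tableau_def)
  have "(\<Sum>A\<in>S ps. u A) = altsum ps u"
    using d
  proof (induct ps arbitrary: u)
    case Nil
    then show ?case by (simp add: S_def)
  next
    case (Cons p ps)
    obtain x x' where p: "p = (x, x')" by (cases p)
    have dx: "x \<notin> set (points ps)" "x' \<notin> set (points ps)" "x \<noteq> x'" "distinct (points ps)"
      using Cons.prems p by auto
    have spl1: "splits ps (insert y A) \<longleftrightarrow> splits ps A" if "y \<notin> set (points ps)" for y A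
      by (rule splits_cong) (use that in auto)
    have spl2: "splits ps (A - {y}) \<longleftrightarrow> splits ps A" if "y \<notin> set (points ps)" for y A
      by (rule splits_cong) (use that in auto)
    note spl = spl1 spl2
    have S: "S (p # ps) = insert x ` S ps \<union> insert x' ` S ps"
    proof (intro Set.equalityI subsetI)
      fix A assume A: "A \<in> S (p # ps)"
      then have m: "x \<in> A \<longleftrightarrow> x' \<notin> A" by (simp add: S_def p)
      have "A - {x} \<in> S ps" "A = insert x (A - {x})" if "x \<in> A"
        using A m that dx by (auto simp: S_def p spl)
      moreover have "A - {x'} \<in> S ps" "A = insert x' (A - {x'})" if "x' \<in> A"
        using A m that dx by (auto simp: S_def p spl)
      ultimately show "A \<in> insert x ` S ps \<union> insert x' ` S ps" using m by blast
    next
      fix A assume "A \<in> insert x ` S ps \<union> insert x' ` S ps"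
      then show "A \<in> S (p # ps)" using dx by (auto simp: S_def p spl)
    qed
    have fin: "finite (S ps)" unfolding S_def by (rule finite_subset[of _ "Pow (set (points ps))"]) auto
    have inj: "inj_on (insert y) (S ps)" if "y \<notin> set (points ps)" for y
      using that by (auto simp: inj_on_def S_def insert_ident subset_iff)
    have disj: "insert x ` S ps \<inter> insert x' ` S ps = {}"
      using dx by (auto simp: S_def)
    have "(\<Sum>A\<in>S (p # ps). u A) = (\<Sum>A\<in>S ps. u (insert x A)) + (\<Sum>A\<in>S ps. u (insert x' A))"
      unfolding S using fin disj inj dx by (simp add: sum.union_disjoint sum.reindex)
    then show ?case unfolding p altsum.simps Cons.hyps[OF dx(4)] .
  qed
  moreover have "S ps = {A \<in> \<Omega> n r. A \<subseteq> set (points ps) \<and> splits ps A}"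
    using assms card_splits[OF d] by (auto simp: S_def \<Omega>_def tableau_def)
  moreover have "(\<Sum>A\<in>\<Omega> n r. polytabloid ps A * u A)
      = (\<Sum>A\<in>\<Omega> n r. if A \<subseteq> set (points ps) \<and> splits ps A then u A else 0)"
    by (rule sum.cong) (auto simp: polytabloid_def)
  ultimately show ?thesis by (simp add: sum.inter_filter)
qed

text \<open>The span of the polytabloids is the orthogonal complement of its orthogonal complement.\<close>

lemma mem_if_annihilated:
  fixes v :: "nat set \<Rightarrow> 'k"
  assumes N: "perm_submodule n r N" and e: "\<And>ps. tableau n r ps \<Longrightarrow> polytabloid ps \<in> N"
    and ann: "\<And>u. (\<And>ps. tableau n r ps \<Longrightarrow> altsum ps u = 0) \<Longrightarrow> (\<Sum>A\<in>\<Omega> n r. v A * u A) = 0"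
  shows "v \<in> N"
proof (rule ccontr)
  assume "v \<notin> N"
  then obtain u where u: "\<And>f. f \<in> N \<Longrightarrow> (\<Sum>A\<in>\<Omega> n r. f A * u A) = 0"
    "(\<Sum>A\<in>\<Omega> n r. v A * u A) \<noteq> 0"
    using perm_submodule_separation[OF N] by blast
  have "altsum ps u = 0" if "tableau n r ps" for ps
    using u(1)[OF e[OF that]] sum_polytabloid[OF that, of u] by simp
  then show False using ann u(2) by blast
qed

text \<open>By lemma \<open>orthogonal_pairs\<close>, a function orthogonal to all polytabloids is a sum of subset
  sums, and the pairing of \<open>v\<close> with a subset sum moves to a superset sum of \<open>v\<close>, which is zero.
  Hence the kernel of \<open>\<eta>\<close> on points and on the empty set is spanned by the four-cycles; the next
  lemma is the analogue for octahedra.\<close>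

lemma specht_pairs:
  fixes v :: "nat set \<Rightarrow> 'k"
  assumes N: "perm_submodule n 2 N" and e: "\<And>ps. tableau n 2 ps \<Longrightarrow> polytabloid ps \<in> N"
    and n: "n \<ge> 3"
    and v: "\<And>B. B \<in> \<Omega> n 0 \<Longrightarrow> superset_sum n 2 v B = 0" "\<And>B. B \<in> \<Omega> n 1 \<Longrightarrow> superset_sum n 2 v B = 0"
  shows "v \<in> N"
proof (rule mem_if_annihilated[OF N e])
  fix u :: "nat set \<Rightarrow> 'k" assume "\<And>ps. tableau n 2 ps \<Longrightarrow> altsum ps u = 0"
  then obtain a b where ab: "\<And>A. A \<in> \<Omega> n 2 \<Longrightarrow> u A = subset_sum n 1 a A + subset_sum n 0 b A"
    using orthogonal_pairs[OF n] by blast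
  have "(\<Sum>A\<in>\<Omega> n 2. v A * u A) = (\<Sum>A\<in>\<Omega> n 2. v A * subset_sum n 1 a A) + (\<Sum>A\<in>\<Omega> n 2. v A * subset_sum n 0 b A)"
    unfolding sum.distrib[symmetric] by (rule sum.cong) (simp_all only: ab distrib_left)
  also have "\<dots> = 0" unfolding subset_sum_superset_sum_adjoint using v by simp
  finally show "(\<Sum>A\<in>\<Omega> n 2. v A * u A) = 0" .
qed

lemma specht_triples:
  fixes v :: "nat set \<Rightarrow> 'k"
  assumes N: "perm_submodule n 3 N" and e: "\<And>ps. tableau n 3 ps \<Longrightarrow> polytabloid ps \<in> N"
    and n: "n \<ge> 6"
    and v: "\<And>B. B \<in> \<Omega> n 1 \<Longrightarrow> superset_sum n 3 v B = 0" "\<And>B. B \<in> \<Omega> n 2 \<Longrightarrow> superset_sum n 3 v B = 0"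
  shows "v \<in> N"
proof (rule mem_if_annihilated[OF N e])
  fix u :: "nat set \<Rightarrow> 'k" assume "\<And>ps. tableau n 3 ps \<Longrightarrow> altsum ps u = 0"
  then obtain a b where ab: "\<And>A. A \<in> \<Omega> n 3 \<Longrightarrow> u A = subset_sum n 1 a A + subset_sum n 2 b A"
    using orthogonal_triples[OF n] by blast
  have "(\<Sum>A\<in>\<Omega> n 3. v A * u A) = (\<Sum>A\<in>\<Omega> n 3. v A * subset_sum n 1 a A) + (\<Sum>A\<in>\<Omega> n 3. v A * subset_sum n 2 b A)"
    unfolding sum.distrib[symmetric] by (rule sum.cong) (simp_all only: ab distrib_left)
  also have "\<dots> = 0" unfolding subset_sum_superset_sum_adjoint using v by simp
  finally show "(\<Sum>A\<in>\<Omega> n 3. v A * u A) = 0" .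
qed

text \<open>The boundary of the cone with apex \<open>5\<close> over the four-cycle is the four-cycle, since each edge
  at the apex lies in two of the four triangles. The apex lies in all four triangles and every other
  vertex in two of them.\<close>

lemma cone_over_four_cycle:
  assumes n: "n \<ge> 5"
  defines "k0 \<equiv> \<lambda>A. of_bool (A \<in> {{1, 3, 5}, {1, 4, 5}, {2, 3, 5}, {2, 4, 5}}) :: 'k"
  shows "B \<in> \<Omega> n 2 \<Longrightarrow> superset_sum n 3 k0 B = polytabloid [(1, 2), (3, 4)] B"
    and "B \<in> \<Omega> n 1 \<Longrightarrow> superset_sum n 3 k0 B = 0"
proof -
  let ?T = "{{1, 3, 5}, {1, 4, 5}, {2, 3, 5}, {2, 4, 5}} :: nat set set"
  have T: "?T \<subseteq> \<Omega> n 3" using n by (auto simp: triple_in_Omega)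
  have dist: "distinct [{1, 3, 5}, {1, 4, 5}, {2, 3, 5}, {2, 4, 5::nat}]"
    by (simp add: set_eq_subset)
  have "superset_sum n 3 k0 B = (\<Sum>A\<in>?T. of_bool (B \<subseteq> A))" for B
  proof -
    have "superset_sum n 3 k0 B = (\<Sum>A\<in>\<Omega> n 3. if A \<in> ?T then of_bool (B \<subseteq> A) else 0)"
      unfolding superset_sum_def sum.inter_filter[OF finite_Omega] by (rule sum.cong) (auto simp: k0_def)
    also have "\<dots> = (\<Sum>A\<in>\<Omega> n 3 \<inter> ?T. of_bool (B \<subseteq> A))"
      by (rule sum.inter_restrict[symmetric]) simp
    finally show ?thesis using T by (simp only: Int_absorb1)
  qed
  then have k0: "superset_sum n 3 k0 B = of_bool (B \<subseteq> {1, 3, 5}) + (of_bool (B \<subseteq> {1, 4, 5})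
      + (of_bool (B \<subseteq> {2, 3, 5}) + of_bool (B \<subseteq> {2, 4, 5})))" for B
    using dist by simp
  have sub: "B \<subseteq> {1, 3, 5} \<longleftrightarrow> B \<subseteq> {1, 2, 3, 4, 5} \<and> 2 \<notin> B \<and> 4 \<notin> B"
    "B \<subseteq> {1, 4, 5} \<longleftrightarrow> B \<subseteq> {1, 2, 3, 4, 5} \<and> 2 \<notin> B \<and> 3 \<notin> B"
    "B \<subseteq> {2, 3, 5} \<longleftrightarrow> B \<subseteq> {1, 2, 3, 4, 5} \<and> 1 \<notin> B \<and> 4 \<notin> B"
    "B \<subseteq> {2, 4, 5} \<longleftrightarrow> B \<subseteq> {1, 2, 3, 4, 5} \<and> 1 \<notin> B \<and> 3 \<notin> B"
    "B \<subseteq> {1, 2, 3, 4} \<longleftrightarrow> B \<subseteq> {1, 2, 3, 4, 5} \<and> 5 \<notin> B" for B :: "nat set"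
    by auto
  have poly: "polytabloid [(1, 2), (3, 4)] B = of_bool (B \<subseteq> {1, 2, 3, 4, 5} \<and> 5 \<notin> B \<and>
      (1 \<in> B \<longleftrightarrow> 2 \<notin> B) \<and> (3 \<in> B \<longleftrightarrow> 4 \<notin> B))" for B
  proof -
    have p: "set (points [(1, 2), (3, 4)]) = {1, 2, 3, 4}" by auto
    show ?thesis unfolding polytabloid_def p sub(5)[of B] by simp
  qed
  have cd: "card B \<ge> card C" if "C \<subseteq> B" "B \<in> \<Omega> n r" for B C r
    using that finite_subset[of B "{1..n}"] by (intro card_mono) (auto simp: \<Omega>_def)
  show "superset_sum n 3 k0 B = polytabloid [(1, 2), (3, 4)] B" if B: "B \<in> \<Omega> n 2"
  proof -
    have "\<not> (5 \<in> B \<and> x \<in> B \<and> y \<in> B)" if "x \<in> {1, 2}" "y \<in> {3, 4}" for x y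
    proof
      assume "5 \<in> B \<and> x \<in> B \<and> y \<in> B"
      then have "card {5, x, y} \<le> card B" by (intro cd[OF _ B]) simp
      then show False using that B by (auto simp: \<Omega>_def)
    qed
    from this[of 1 3] this[of 1 4] this[of 2 3] this[of 2 4] show ?thesis
      unfolding k0 sub poly
      by (cases "B \<subseteq> {1, 2, 3, 4, 5}"; cases "1 \<in> B"; cases "2 \<in> B"; cases "3 \<in> B"; cases "4 \<in> B")
        simp_all
  qed
  show "superset_sum n 3 k0 B = 0" if B: "B \<in> \<Omega> n 1"
  proof -
    have "\<not> (x \<in> B \<and> y \<in> B)" if "x \<in> {1, 2}" "y \<in> {3, 4}" for x y
    proof
      assume "x \<in> B \<and> y \<in> B"
      then have "card {x, y} \<le> card B" by (intro cd[OF _ B]) simp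
      then show False using that B by (auto simp: \<Omega>_def)
    qed
    from this[of 1 3] this[of 1 4] this[of 2 3] this[of 2 4] show ?thesis
      unfolding k0 sub
      by (cases "B \<subseteq> {1, 2, 3, 4, 5}"; cases "1 \<in> B"; cases "2 \<in> B"; cases "3 \<in> B"; cases "4 \<in> B")
        simp_all
  qed
qed

lemma subset_sum_1_const_pair: "{i, j} \<in> \<Omega> n 2 \<Longrightarrow> (\<And>B. B \<in> \<Omega> n 1 \<Longrightarrow> a B = c) \<Longrightarrow> subset_sum n 1 a {i, j} = (0::'k)"
  by (subst subset_sum_1_pair) (auto simp: pair_in_Omega)

lemma subset_sum_const_triple:
  assumes "A \<in> \<Omega> n 3" "\<And>B. B \<in> \<Omega> n 1 \<Longrightarrow> a B = (c::'k)"
  shows "subset_sum n 1 a A = c"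
proof -
  obtain i j k where ijk: "A = {i, j, k}" "distinct [i, j, k]" "i \<in> {1..n}" "j \<in> {1..n}" "k \<in> {1..n}"
    using assms(1) by (rule Omega_3E)
  have "subset_sum n 1 a A = a {i} + (a {j} + a {k})" using subset_sum_1_triple assms(1) ijk(1) by blast
  also have "\<dots> = c" using ijk(3-5) assms(2) by simp
  finally show ?thesis .
qed

lemma subset_sum_2_const:
  assumes "A \<in> \<Omega> n 3"
  shows "subset_sum n 2 (\<lambda>_. c) A = (c::'k)"
  using assms by (auto elim!: Omega_3E simp: subset_sum_2_triple)

lemma const_if_subset_sum_pair_zero:
  fixes \<alpha> :: "nat set \<Rightarrow> 'k"
  assumes z: "\<And>A. A \<in> \<Omega> n 2 \<Longrightarrow> subset_sum n 1 \<alpha> A = 0"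
  obtains c where "\<And>B. B \<in> \<Omega> n 1 \<Longrightarrow> \<alpha> B = c"
proof (rule that[of "\<alpha> {1}"])
  fix B assume "B \<in> \<Omega> n 1"
  then obtain i where i: "B = {i}" "i \<in> {1..n}" by (rule Omega_1E)
  show "\<alpha> B = \<alpha> {1}"
  proof (cases "i = 1")
    case False
    then have "{1, i} \<in> \<Omega> n 2" using i by (auto simp: pair_in_Omega)
    then have "\<alpha> {1} + \<alpha> {i} = 0" using z subset_sum_1_pair by metis
    then show ?thesis using i by (simp add: add_eq_0_iff')
  qed (simp add: i)
qed

text \<open>Each edge of a tetrahedron lies in two of its faces and each vertex in three. So the sum of
  the equations for the four faces says that \<open>\<alpha>\<close> adds up to zero over the vertices of any
  tetrahedron. Exchanging one vertex shows that \<open>\<alpha>\<close> is constant.\<close>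

lemma const_if_subset_sum_triple_eq:
  fixes \<alpha> \<beta> :: "nat set \<Rightarrow> 'k"
  assumes n: "n \<ge> 5" and e: "\<And>A. A \<in> \<Omega> n 3 \<Longrightarrow> subset_sum n 1 \<alpha> A = subset_sum n 2 \<beta> A"
  obtains c where "\<And>B. B \<in> \<Omega> n 1 \<Longrightarrow> \<alpha> B = c"
proof -
  have t: "\<alpha> {i} + (\<alpha> {j} + \<alpha> {k}) = \<beta> {i, j} + (\<beta> {i, k} + \<beta> {j, k})"
    if "distinct [i, j, k]" "{i, j, k} \<subseteq> {1..n}" for i j k
  proof -
    have "{i, j, k} \<in> \<Omega> n 3" using that by (simp only: triple_in_Omega)
    then show ?thesis using e[of "{i, j, k}"] subset_sum_1_triple[of i j k n \<alpha>] subset_sum_2_triple[OF that, of \<beta>] by simp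
  qed
  have q: "\<alpha> {i} + (\<alpha> {j} + (\<alpha> {k} + \<alpha> {l})) = 0"
    if "distinct [i, j, k, l]" "{i, j, k, l} \<subseteq> {1..n}" for i j k l
  proof -
    let ?f = "\<lambda>i j k. \<alpha> {i} + (\<alpha> {j} + \<alpha> {k})"
    have "\<alpha> {i} + (\<alpha> {j} + (\<alpha> {k} + \<alpha> {l})) = ?f i j k + (?f i j l + (?f i k l + ?f j k l))"
      by (simp add: add_ac)
    also have "\<dots> = 0"
      using that by (simp add: t add_ac)
    finally show ?thesis .
  qed
  show ?thesis
  proof (rule that[of "\<alpha> {1}"])
    fix B assume "B \<in> \<Omega> n 1"
    then obtain i where i: "B = {i}" "i \<in> {1..n}" by (rule Omega_1E)
    have "card {1, i} \<le> 2" by (simp add: card_insert_if)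
    then have "3 \<le> card ({1..n} - {1, i})" using n diff_card_le_card_Diff[of "{1, i}" "{1..n}"] by simp
    then obtain U where U: "U \<subseteq> {1..n} - {1, i}" "card U = 3" by (metis obtain_subset_with_card_n)
    then obtain j k l where jkl: "U = {j, k, l}" "distinct [j, k, l]" by (auto simp: card_3_iff)
    have "\<alpha> {j} + (\<alpha> {k} + (\<alpha> {l} + \<alpha> {i})) = 0" "\<alpha> {j} + (\<alpha> {k} + (\<alpha> {l} + \<alpha> {1})) = 0"
      by (rule q; use U(1) i jkl n in auto)+
    then have "\<alpha> {i} = \<alpha> {1}" by (metis add_left_cancel)
    then show "\<alpha> B = \<alpha> {1}" by (simp add: i)
  qed
qed

lemma perm_submodule_fixed_mod:
  assumes N: "perm_submodule n r (N :: (nat set \<Rightarrow> 'k) set)"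
  shows "perm_submodule n r {f. \<forall>g. g permutes {1..n} \<longrightarrow> (\<lambda>A. perm_act g f A + f A) \<in> N}"
    (is "perm_submodule n r ?P")
  unfolding perm_submodule_def
proof (intro conjI ballI allI impI)
  show "(\<lambda>_. 0) \<in> ?P" using perm_submodule_zero[OF N] by (simp add: perm_act_def)
next
  fix f assume f: "f \<in> ?P"
  show "(\<lambda>A. c * f A) \<in> ?P" for c
  proof (intro CollectI allI impI)
    fix g assume "g permutes {1..n}"
    then have "(\<lambda>A. c * (perm_act g f A + f A)) \<in> N" using f perm_submodule_smult[OF N] by blast
    then show "(\<lambda>A. perm_act g (\<lambda>A. c * f A) A + c * f A) \<in> N"
      by (simp add: perm_act_def distrib_left)
  qed
  show "perm_act h f \<in> ?P" if h: "h permutes {1..n}" for h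
  proof (intro CollectI allI impI)
    fix g assume g: "g permutes {1..n}"
    have "(\<lambda>A. perm_act (g \<circ> h) f A + f A) \<in> N" "(\<lambda>A. perm_act h f A + f A) \<in> N"
      using f h g permutes_compose[OF h g] by blast+
    from perm_submodule_add[OF N this]
    show "(\<lambda>A. perm_act g (perm_act h f) A + perm_act h f A) \<in> N"
      by (simp add: perm_act_comp add_ac)
  qed
  show "f' \<in> ?P" if e: "\<forall>A\<in>\<Omega> n r. f A = f' A" for f'
  proof (intro CollectI allI impI)
    fix g assume g: "g permutes {1..n}"
    then have "(\<lambda>A. perm_act g f A + f A) \<in> N" using f by blast
    then show "(\<lambda>A. perm_act g f' A + f' A) \<in> N"
      by (rule perm_submodule_cong[OF N]) (use e vimage_in_Omega_iff[OF g] in \<open>simp add: perm_act_def\<close>)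
  qed
  fix f' assume f': "f' \<in> ?P"
  show "(\<lambda>A. f A + f' A) \<in> ?P"
  proof (intro CollectI allI impI)
    fix g assume "g permutes {1..n}"
    then have "(\<lambda>A. (perm_act g f A + f A) + (perm_act g f' A + f' A)) \<in> N"
      using f f' perm_submodule_add[OF N] by blast
    then show "(\<lambda>A. perm_act g (\<lambda>A. f A + f' A) A + (f A + f' A)) \<in> N"
      by (simp add: perm_act_def add_ac)
  qed
qed

text \<open>A triple contains three pairs and three points, so both ways of descending to the empty set
  give the total sum.\<close>

lemma superset_sum_0_superset_sum:
  assumes "\<And>B. B \<in> \<Omega> n 1 \<Longrightarrow> superset_sum n 3 k B = (0::'k)"
  shows "superset_sum n 2 (superset_sum n 3 k) {} = 0"
proof -
  have "superset_sum n 2 (superset_sum n 3 k) {} = (\<Sum>B\<in>\<Omega> n 2. superset_sum n 3 k B * 1)" by (simp add: superset_sum_def)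
  also have "\<dots> = (\<Sum>A\<in>\<Omega> n 3. k A * subset_sum n 2 (\<lambda>_. 1) A)" by (rule subset_sum_superset_sum_adjoint[symmetric])
  also have "\<dots> = (\<Sum>A\<in>\<Omega> n 3. k A * subset_sum n 1 (\<lambda>_. 1) A)"
    by (rule sum.cong[OF refl]) (simp only: subset_sum_2_const subset_sum_const_triple[where c = 1])
  also have "\<dots> = (\<Sum>B\<in>\<Omega> n 1. superset_sum n 3 k B * 1)" by (rule subset_sum_superset_sum_adjoint)
  also have "\<dots> = 0" using assms by simp
  finally show ?thesis .
qed

text \<open>Each point of a triple lies in two of its pairs.\<close>

lemma superset_sum_1_superset_sum:
  assumes "B \<in> \<Omega> n 1"
  shows "superset_sum n 2 (superset_sum n 3 k) B = (0::'k)"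
proof -
  define b where "b C = (of_bool (B \<subseteq> C) :: 'k)" for C
  have "superset_sum n 2 (superset_sum n 3 k) B = (\<Sum>C\<in>\<Omega> n 2. superset_sum n 3 k C * b C)"
    unfolding superset_sum_def[of n 2] sum.inter_filter[OF finite_Omega]
    by (rule sum.cong) (simp_all add: b_def)
  also have "\<dots> = (\<Sum>A\<in>\<Omega> n 3. k A * subset_sum n 2 b A)" by (rule subset_sum_superset_sum_adjoint[symmetric])
  also have "\<dots> = 0"
  proof (rule sum.neutral, rule ballI)
    fix A assume "A \<in> \<Omega> n 3"
    then obtain i j l where A: "A = {i, j, l}" "distinct [i, j, l]" "{i, j, l} \<subseteq> {1..n}"
      by (auto elim!: Omega_3E)
    obtain x where x: "B = {x}" using assms by (rule Omega_1E)
    have "subset_sum n 2 b A = 0"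
      unfolding A(1) subset_sum_2_triple[OF A(2,3)] b_def x using A(2)
      by (cases "x = i"; cases "x = j"; cases "x = l") simp_all
    then show "k A * subset_sum n 2 b A = 0" by simp
  qed
  finally show ?thesis .
qed

text \<open>The function \<open>f\<close> is not orthogonal to all octahedra: otherwise it would be the sum of a
  function \<open>a\<close> on points and a coboundary, where \<open>a\<close> is fixed by \<open>X\<close> up to constants, hence
  constant, hence itself a coboundary. Let \<open>P\<close> consist of the functions that the symmetric group
  fixes modulo \<open>N\<close>; by hypothesis it contains those that \<open>X\<close> fixes modulo \<open>N\<close>, such as \<open>f\<close>. So \<open>P\<close>
  contains the octahedra, and then \<open>N\<close> contains them. Let \<open>K\<close> consist of the functions on triples
  whose sums over the triples through each point vanish. Those elements of \<open>K\<close> whose boundary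
  vanishes are spanned by octahedra and lie in \<open>N\<close>. Now \<open>x\<close> has a preimage in \<open>K\<close> under the boundary
  map, which \<open>X\<close> fixes modulo \<open>N\<close> and which therefore lies in \<open>P\<close>. As \<open>x\<close> is not orthogonal to all
  four-cycles, the boundaries of \<open>K \<inter> P\<close> include the four-cycles, and then so do the boundaries of
  \<open>K \<inter> N\<close>. The four-cycles span the boundaries of \<open>K\<close>, so \<open>K\<close> and \<open>K \<inter> N\<close> have the same boundaries.\<close>

lemma kernel_in_submodule:
  fixes N :: "(nat set \<Rightarrow> 'k) set"
  assumes n: "n \<ge> 6" "even n" and N: "perm_submodule n 3 N"
    and X: "\<And>g. g \<in> X \<Longrightarrow> g permutes {1..n}"
    and fixed: "\<And>f g. (\<And>h. h \<in> X \<Longrightarrow> (\<lambda>A. perm_act h f A + f A) \<in> N) \<Longrightarrow> g permutes {1..n} \<Longrightarrow>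
      (\<lambda>A. perm_act g f A + f A) \<in> N"
    and const: "\<And>a :: nat set \<Rightarrow> 'k. (\<And>g. g \<in> X \<Longrightarrow> \<exists>c. \<forall>B\<in>\<Omega> n 1. perm_act g a B + a B = c) \<Longrightarrow>
      \<exists>c. \<forall>B\<in>\<Omega> n 1. a B = c"
    and x: "\<And>g A. g \<in> X \<Longrightarrow> A \<in> \<Omega> n 2 \<Longrightarrow> perm_act g x A = (x A :: 'k)"
      "superset_sum n 2 x {} = 0" "\<And>B. B \<in> \<Omega> n 1 \<Longrightarrow> superset_sum n 2 x B = 0"
      "A0 \<in> \<Omega> n 2" "x A0 \<noteq> 0"
    and f: "\<And>g A. g \<in> X \<Longrightarrow> A \<in> \<Omega> n 3 \<Longrightarrow> perm_act g f A = (f A :: 'k)"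
      "\<And>b. \<exists>A\<in>\<Omega> n 3. f A \<noteq> subset_sum n 2 b A"
    and k: "\<And>B. B \<in> \<Omega> n 1 \<Longrightarrow> superset_sum n 3 k B = 0"
  shows "k \<in> N"
proof -
  define P where "P = {f. \<forall>g. g permutes {1..n} \<longrightarrow> (\<lambda>A. perm_act g f A + f A) \<in> N}"
  define K where "K = {v :: nat set \<Rightarrow> 'k. \<forall>B\<in>\<Omega> n 1. superset_sum n 3 v B = 0}"
  have P: "perm_submodule n 3 P" unfolding P_def by (rule perm_submodule_fixed_mod[OF N])
  have K: "perm_submodule n 3 K" unfolding K_def by (rule perm_submodule_kernel)
  have fixP: "f \<in> P" if "\<And>g. g \<in> X \<Longrightarrow> (\<lambda>A. perm_act g f A + f A) \<in> N" for f
    unfolding P_def using fixed[OF that] by blast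
  have X_fixed: "perm_act g v A + v A = 0" if "\<And>g A. g \<in> X \<Longrightarrow> A \<in> \<Omega> n r \<Longrightarrow> perm_act g v A = (v A :: 'k)"
    "g \<in> X" "A \<in> \<Omega> n r" for v r g A using that by simp
  have fP: "f \<in> P"
  proof (rule fixP)
    fix g assume "g \<in> X"
    show "(\<lambda>A. perm_act g f A + f A) \<in> N"
      by (rule perm_submodule_cong[OF N perm_submodule_zero[OF N]])
        (use X_fixed[OF f(1) \<open>g \<in> X\<close>] in simp)
  qed
  have "\<exists>ps. tableau n 3 ps \<and> altsum ps f \<noteq> 0"
  proof (rule ccontr)
    assume "\<not> (\<exists>ps. tableau n 3 ps \<and> altsum ps f \<noteq> 0)"
    then obtain a b where ab: "\<And>A. A \<in> \<Omega> n 3 \<Longrightarrow> f A = subset_sum n 1 a A + subset_sum n 2 b A"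
      using orthogonal_triples[OF n(1), of f] by blast
    have "\<exists>c. \<forall>B\<in>\<Omega> n 1. a B = c"
    proof (rule const)
      fix g assume g: "g \<in> X"
      have "subset_sum n 1 (\<lambda>B. perm_act g a B + a B) A = subset_sum n 2 (\<lambda>B. perm_act g b B + b B) A"
        if A: "A \<in> \<Omega> n 3" for A
      proof -
        have gA: "g -` A \<in> \<Omega> n 3" using A vimage_in_Omega_iff[OF X[OF g]] by simp
        have "(subset_sum n 1 (perm_act g a) A + subset_sum n 2 (perm_act g b) A) + (subset_sum n 1 a A + subset_sum n 2 b A)
            = perm_act g f A + f A"
          unfolding perm_act_subset_sum[OF X[OF g], symmetric] using ab[OF A] ab[OF gA] by (simp add: perm_act_def)
        also have "\<dots> = 0" by (rule X_fixed[OF f(1) g A])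
        finally have "(subset_sum n 1 (perm_act g a) A + subset_sum n 1 a A) + (subset_sum n 2 (perm_act g b) A + subset_sum n 2 b A) = 0"
          by (simp add: add_ac)
        then have "subset_sum n 1 (perm_act g a) A + subset_sum n 1 a A = subset_sum n 2 (perm_act g b) A + subset_sum n 2 b A"
          by (simp only: add_eq_0_iff')
        then show ?thesis by (simp add: subset_sum_def sum.distrib)
      qed
      then obtain c where "\<And>B. B \<in> \<Omega> n 1 \<Longrightarrow> perm_act g a B + a B = c"
        using const_if_subset_sum_triple_eq[of n "\<lambda>B. perm_act g a B + a B" "\<lambda>B. perm_act g b B + b B"] n by auto
      then show "\<exists>c. \<forall>B\<in>\<Omega> n 1. perm_act g a B + a B = c" by blast
    qed
    then obtain c where c: "\<And>B. B \<in> \<Omega> n 1 \<Longrightarrow> a B = c" by blast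
    \<comment> \<open>The constant \<open>c\<close> on triples is the coboundary of the constant \<open>c\<close> on pairs, since a triple
      contains three pairs.\<close>
    have "f A = subset_sum n 2 (\<lambda>B. c + b B) A" if A: "A \<in> \<Omega> n 3" for A
    proof -
      have "subset_sum n 2 (\<lambda>B. c + b B) A = subset_sum n 2 (\<lambda>_. c) A + subset_sum n 2 b A" by (simp add: subset_sum_def sum.distrib)
      then show ?thesis using ab[OF A] subset_sum_2_const[OF A, of c] subset_sum_const_triple[OF A c] by simp
    qed
    then show False using f(2) by blast
  qed
  then have octP: "polytabloid qs \<in> P" if "tableau n 3 qs" for qs
    using james_submodule[OF P fP] that by blast
  have octN: "polytabloid qs \<in> N" if "tableau n 3 qs" for qs
    by (rule polytabloid_descends[OF N _ _ that]) (use octP in \<open>auto simp: P_def\<close>)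
  have kerN: "v \<in> N" if "v \<in> K" "\<And>B. B \<in> \<Omega> n 2 \<Longrightarrow> superset_sum n 3 v B = 0" for v
    by (rule specht_triples[OF N octN n(1)]) (use that in \<open>auto simp: K_def\<close>)

  define im where "im M = {w. \<exists>v\<in>M. \<forall>B\<in>\<Omega> n 2. w B = superset_sum n 3 v B}" for M :: "(nat set \<Rightarrow> 'k) set"
  have im: "perm_submodule n 2 (im M)" if "perm_submodule n 3 M" for M
    unfolding im_def by (rule perm_submodule_image[OF that])
  have pairs_in: "w \<in> M" if M: "perm_submodule n 2 M" and e: "polytabloid ps \<in> M" "tableau n 2 ps"
    and w: "superset_sum n 2 w {} = 0" "\<And>B. B \<in> \<Omega> n 1 \<Longrightarrow> superset_sum n 2 w B = 0" for M ps and w :: "nat set \<Rightarrow> 'k"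
    by (rule specht_pairs[OF M polytabloid_transitive[OF M e(2) _ e(1)]]) (use n w in auto)
  have xK: "x \<in> im K"
  proof (rule pairs_in[OF im[OF K] _ _ x(2,3)])
    show t: "tableau n 2 [(1, 2), (3, 4)]" using n by (auto simp: tableau_def)
    show "polytabloid [(1, 2), (3, 4)] \<in> im K"
      using cone_over_four_cycle[of n] n unfolding im_def K_def
      by (intro CollectI bexI[of _ "\<lambda>A. of_bool (A \<in> {{1, 3, 5}, {1, 4, 5}, {2, 3, 5}, {2, 4, 5}})"]) auto
  qed
  then obtain v where v: "v \<in> K" "\<And>B. B \<in> \<Omega> n 2 \<Longrightarrow> x B = superset_sum n 3 v B" unfolding im_def by blast
  \<comment> \<open>The translates of \<open>v\<close> by \<open>X\<close> differ from \<open>v\<close> by elements of \<open>K\<close> without boundary.\<close>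
  have "v \<in> P"
  proof (rule fixP, rule kerN)
    fix g assume g: "g \<in> X"
    show "(\<lambda>A. perm_act g v A + v A) \<in> K"
      by (rule perm_submodule_add[OF K perm_submodule_act[OF K X[OF g] v(1)] v(1)])
    fix B assume B: "B \<in> \<Omega> n 2"
    have gB: "g -` B \<in> \<Omega> n 2" using B vimage_in_Omega_iff[OF X[OF g]] by simp
    have "superset_sum n 3 (\<lambda>A. perm_act g v A + v A) B = perm_act g x B + x B"
      using v(2)[OF B] v(2)[OF gB] by (simp add: superset_sum_add perm_act_superset_sum[OF X[OF g]]) (simp add: perm_act_def)
    also have "\<dots> = 0" by (rule X_fixed[OF x(1) g B])
    finally show "superset_sum n 3 (\<lambda>A. perm_act g v A + v A) B = 0" .
  qed
  then have xPK: "x \<in> im (K \<inter> P)" using v unfolding im_def by blast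
  have PK: "perm_submodule n 2 (im (K \<inter> P))" by (intro im perm_submodule_Int K P)
  have NK: "perm_submodule n 2 (im (K \<inter> N))" by (intro im perm_submodule_Int K N)
  have "\<exists>ps. tableau n 2 ps \<and> altsum ps x \<noteq> 0"
  proof (rule ccontr)
    assume "\<not> (\<exists>ps. tableau n 2 ps \<and> altsum ps x \<noteq> 0)"
    then obtain a b where ab: "\<And>A. A \<in> \<Omega> n 2 \<Longrightarrow> x A = subset_sum n 1 a A + subset_sum n 0 b A"
      using orthogonal_pairs[of n x] n(1) by force
    have "\<exists>c. \<forall>B\<in>\<Omega> n 1. a B = c"
    proof (rule const)
      fix g assume g: "g \<in> X"
      have "subset_sum n 1 (\<lambda>B. perm_act g a B + a B) A = 0" if A: "A \<in> \<Omega> n 2" for A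
      proof -
        have gA: "g -` A \<in> \<Omega> n 2" using A vimage_in_Omega_iff[OF X[OF g]] by simp
        have "subset_sum n 1 (perm_act g a) A + subset_sum n 1 a A = perm_act g x A + x A"
          unfolding perm_act_subset_sum[OF X[OF g], symmetric] using ab[OF A] ab[OF gA]
          by (simp add: perm_act_def add_ac)
        also have "\<dots> = 0" by (rule X_fixed[OF x(1) g A])
        finally show ?thesis by (simp add: subset_sum_def sum.distrib)
      qed
      then obtain c where "\<And>B. B \<in> \<Omega> n 1 \<Longrightarrow> perm_act g a B + a B = c"
        using const_if_subset_sum_pair_zero[of n "\<lambda>B. perm_act g a B + a B"] by auto
      then show "\<exists>c. \<forall>B\<in>\<Omega> n 1. perm_act g a B + a B = c" by blast
    qed
    then obtain c where c: "\<And>B. B \<in> \<Omega> n 1 \<Longrightarrow> a B = c" by blast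
    \<comment> \<open>If \<open>a\<close> is constant, then \<open>x\<close> is constant, and its sum over the \<open>n - 1\<close> pairs through a point
      is this constant.\<close>
    have xc: "x A = b {}" if A: "A \<in> \<Omega> n 2" for A
    proof -
      obtain i j where "A = {i, j}" using A by (rule Omega_2E)
      then have "subset_sum n 1 a A = 0" using subset_sum_1_const_pair[of i j n a c] A c by blast
      then show ?thesis using ab[OF A] by simp
    qed
    have "{1} \<in> \<Omega> n 1" using n by simp
    then have "b {} = 0" using superset_sum_const_pairs[OF n(2) _ xc, of 1] x(3)[of "{1}"] n(1) by simp
    then show False using xc[OF x(4)] x(5) by simp
  qed
  then have cycP: "polytabloid qs \<in> im (K \<inter> P)" if "tableau n 2 qs" for qs
    using james_submodule[OF PK xPK] that by blast
  have cycN: "polytabloid qs \<in> im (K \<inter> N)" if "tableau n 2 qs" for qs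
  proof (rule polytabloid_descends[OF NK _ _ that])
    fix ps g assume ps: "tableau n 2 ps" and g: "g permutes {1..n}"
    obtain w where w: "w \<in> K" "w \<in> P" "\<And>B. B \<in> \<Omega> n 2 \<Longrightarrow> polytabloid ps B = superset_sum n 3 w B"
      using cycP[OF ps] unfolding im_def by blast
    let ?w = "\<lambda>A. perm_act g w A + w A"
    have "?w \<in> K" by (rule perm_submodule_add[OF K perm_submodule_act[OF K g w(1)] w(1)])
    moreover have "?w \<in> N" using w(2) g unfolding P_def by blast
    moreover have "perm_act g (polytabloid ps) B + polytabloid ps B = superset_sum n 3 ?w B" if B: "B \<in> \<Omega> n 2" for B
    proof -
      have gB: "g -` B \<in> \<Omega> n 2" using B vimage_in_Omega_iff[OF g] by simp
      show ?thesis using w(3)[OF B] w(3)[OF gB] by (simp add: superset_sum_add perm_act_superset_sum[OF g]) (simp add: perm_act_def)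
    qed
    ultimately show "(\<lambda>A. perm_act g (polytabloid ps) A + polytabloid ps A) \<in> im (K \<inter> N)"
      unfolding im_def by blast
  qed simp
  have kK: "k \<in> K" using k unfolding K_def by blast
  have "superset_sum n 3 k \<in> im (K \<inter> N)"
  proof (rule pairs_in[OF NK])
    show t: "tableau n 2 [(1, 2), (3, 4)]" using n by (auto simp: tableau_def)
    show "polytabloid [(1, 2), (3, 4)] \<in> im (K \<inter> N)" by (rule cycN[OF t])
    show "superset_sum n 2 (superset_sum n 3 k) {} = 0" by (rule superset_sum_0_superset_sum[OF k])
    show "superset_sum n 2 (superset_sum n 3 k) B = 0" if "B \<in> \<Omega> n 1" for B by (rule superset_sum_1_superset_sum[OF that])
  qed
  then obtain w where w: "w \<in> K" "w \<in> N" "\<And>B. B \<in> \<Omega> n 2 \<Longrightarrow> superset_sum n 3 k B = superset_sum n 3 w B"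
    unfolding im_def by blast
  have "(\<lambda>A. k A + w A) \<in> N"
    by (rule kerN) (use perm_submodule_add[OF K kK w(1)] w(3) in \<open>simp_all add: superset_sum_add\<close>)
  from perm_submodule_add[OF N this w(2)] show ?thesis by (simp add: add_ac)
qed

end

section \<open>The permutation modules as group modules\<close>

lemma perm_module_simps [simp]:
  "carrier (perm_module n r) = \<Omega> n r \<rightarrow>\<^sub>E (UNIV :: 'k::field set)"
  "\<zero>\<^bsub>perm_module n r\<^esub> = (\<lambda>A\<in>\<Omega> n r. 0 :: 'k)"
  "f \<oplus>\<^bsub>perm_module n r\<^esub> f' = (\<lambda>A\<in>\<Omega> n r. f A + f' A :: 'k)"
  "c \<odot>\<^bsub>perm_module n r\<^esub> f = (\<lambda>A\<in>\<Omega> n r. c * f A :: 'k)"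
  "act (perm_module n r) g f = (\<lambda>A\<in>\<Omega> n r. f (g -` A))"
  by (simp_all add: perm_module_def module.extend_def gmodule.fields_def class_ring.func_space_def)

lemma perm_module_vectorspace: "vectorspace class_ring (perm_module n r :: ('k::field, _, _) gmodule)"
  by (rule vectorspace_cong[OF func_space_vectorspace[of "\<Omega> n r"]])
    (simp_all add: class_ring.func_space_def)

lemma fin_dim_perm_module: "vectorspace.fin_dim class_ring (perm_module n r :: ('k::field, _, _) gmodule)"
proof -
  let ?M = "perm_module n r :: ('k, _, _) gmodule"
  let ?F = "class_ring.func_space (\<Omega> n r) :: ('k, nat set \<Rightarrow> 'k) module"
  interpret T: linear_map class_ring ?M ?F "\<lambda>f. f"
    by (rule linear_mapI[OF perm_module_vectorspace func_space_vectorspace])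
      (auto simp: LinearCombinations.module_hom_def class_ring.func_space_def)
  show ?thesis by (rule T.fin_dim_if_inj(1)) (simp_all add: fin_dim_func_space(1))
qed

lemma perm_group_module: "group_module (sym_group n) (perm_module n r :: ('k::field, _, _) gmodule)"
proof (intro group_module.intro group_module_axioms.intro)
  show "group (sym_group n)" by (rule sym_group_is_group)
  show "vectorspace class_ring (perm_module n r :: ('k, _, _) gmodule)" by (rule perm_module_vectorspace)
  fix g assume "g \<in> carrier (sym_group n)"
  then have g: "g permutes {1..n}" by (simp add: sym_group_carrier)
  show "act (perm_module n r :: ('k, _, _) gmodule) g
      \<in> LinearCombinations.module_hom class_ring (perm_module n r) (perm_module n r)"
    using vimage_in_Omega_iff[OF g, of _ r]
    by (auto simp: LinearCombinations.module_hom_def fun_eq_iff)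
  fix h :: "nat \<Rightarrow> nat" and f :: "nat set \<Rightarrow> 'k"
  show "act (perm_module n r) (g \<otimes>\<^bsub>sym_group n\<^esub> h) f = act (perm_module n r) g (act (perm_module n r) h f)"
    using vimage_in_Omega_iff[OF g, of _ r] by (auto simp: sym_group_mult vimage_comp fun_eq_iff)
next
  fix f :: "nat set \<Rightarrow> 'k" assume "f \<in> carrier (perm_module n r)"
  then show "act (perm_module n r) \<one>\<^bsub>sym_group n\<^esub> f = f"
    by (auto simp: sym_group_one fun_eq_iff PiE_def extensional_def)
qed

lemma restrict_in_perm_module [simp]: "restrict f (\<Omega> n r) \<in> \<Omega> n r \<rightarrow>\<^sub>E (UNIV :: 'k set)"
  by auto

lemma act_restrict:
  "g permutes {1..n} \<Longrightarrow> act (perm_module n r) g (restrict f (\<Omega> n r)) = restrict (perm_act g f) (\<Omega> n r)"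
  using vimage_in_Omega_iff[of g n] by (auto simp: perm_act_def fun_eq_iff)

text \<open>The bridge between the two encodings of a submodule, by extensional and by unrestricted
  functions.\<close>

lemma perm_submodule_of_group_submodule:
  assumes "group_submodule (sym_group n) N (perm_module n r :: ('k::field, _, _) gmodule)"
  shows "perm_submodule n r {f. restrict f (\<Omega> n r) \<in> N}"
proof -
  let ?M = "perm_module n r :: ('k, _, _) gmodule"
  have sub: "subspace class_ring N ?M"
    and act: "\<And>g f. g permutes {1..n} \<Longrightarrow> f \<in> N \<Longrightarrow> act ?M g f \<in> N"
    using assms by (auto simp: group_submodule_def sym_group_carrier)
  show ?thesis
    unfolding perm_submodule_def
  proof (intro conjI ballI allI impI)
    show "(\<lambda>_. 0) \<in> {f. restrict f (\<Omega> n r) \<in> N}" using subspace_zero[OF sub] by simp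
    fix f assume f: "f \<in> {f. restrict f (\<Omega> n r) \<in> N}"
    show "(\<lambda>A. c * f A) \<in> {f. restrict f (\<Omega> n r) \<in> N}" for c
      using subspace_smult[OF sub, of c "restrict f (\<Omega> n r)"] f by (simp cong: restrict_cong)
    show "perm_act g f \<in> {f. restrict f (\<Omega> n r) \<in> N}" if g: "g permutes {1..n}" for g
      using act[OF g, of "restrict f (\<Omega> n r)"] f unfolding act_restrict[OF g] by simp
    show "f' \<in> {f. restrict f (\<Omega> n r) \<in> N}" if "\<forall>A\<in>\<Omega> n r. f A = f' A" for f'
    proof -
      have "restrict f' (\<Omega> n r) = restrict f (\<Omega> n r)" by (rule restrict_ext) (simp add: that)
      then show ?thesis using f by simp
    qed
    fix f' assume f': "f' \<in> {f. restrict f (\<Omega> n r) \<in> N}"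
    show "(\<lambda>A. f A + f' A) \<in> {f. restrict f (\<Omega> n r) \<in> N}"
      using subspace_add[OF sub, of "restrict f (\<Omega> n r)" "restrict f' (\<Omega> n r)"] f f'
      by (simp cong: restrict_cong)
  qed
qed

lemma fixed_points_perm_module_iff:
  assumes "\<And>g. g \<in> X \<Longrightarrow> g permutes {1..n}"
  shows "restrict f (\<Omega> n r) \<in> fixed_points X (perm_module n r :: ('k::field, _, _) gmodule) \<longleftrightarrow>
    (\<forall>g\<in>X. \<forall>A\<in>\<Omega> n r. perm_act g f A = f A)"
  using vimage_in_Omega_iff[OF assms]
  by (auto simp: fixed_points_def perm_act_def fun_eq_iff)

lemma finsum_perm_module:
  fixes F :: "'i \<Rightarrow> nat set \<Rightarrow> 'k::field"
  assumes S: "finite S" and F: "\<And>s. s \<in> S \<Longrightarrow> F s \<in> carrier (perm_module n r)" and A: "A \<in> \<Omega> n r"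
  shows "(\<Oplus>\<^bsub>perm_module n r\<^esub>s\<in>S. F s) A = (\<Sum>s\<in>S. F s A)"
proof -
  interpret M: vectorspace class_ring "perm_module n r :: ('k, _, _) gmodule"
    by (rule perm_module_vectorspace)
  show ?thesis
    using S F
  proof (induct S)
    case empty
    then show ?case using A by simp
  next
    case (insert s S)
    have "F \<in> S \<rightarrow> carrier (perm_module n r)" "F s \<in> carrier (perm_module n r)"
      using insert.prems by auto
    then show ?case using insert A M.M.finsum_insert[of S s F] by simp
  qed
qed

lemma finsum_in_perm_module:
  fixes F :: "'i \<Rightarrow> nat set \<Rightarrow> 'k::field"
  assumes "\<And>s. s \<in> S \<Longrightarrow> F s \<in> carrier (perm_module n r)"
  shows "(\<Oplus>\<^bsub>perm_module n r\<^esub>s\<in>S. F s) \<in> carrier (perm_module n r)"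
proof -
  interpret M: vectorspace class_ring "perm_module n r :: ('k, _, _) gmodule"
    by (rule perm_module_vectorspace)
  show ?thesis using assms by (intro M.M.finsum_closed) blast
qed

lemma basis_vec_in_perm_module: "basis_vec n r A \<in> carrier (perm_module n r)"
  by (auto simp: basis_vec_def)

lemma T1_eq: "T1 n = (\<lambda>A\<in>\<Omega> n 1. 1 :: 'k::field)"
proof
  fix A
  show "T1 n A = (\<lambda>A\<in>\<Omega> n 1. 1 :: 'k) A"
  proof (cases "A \<in> \<Omega> n 1")
    case True
    then have "T1 n A = (\<Sum>B\<in>\<Omega> n 1. basis_vec n 1 B A :: 'k)"
      unfolding T1_def by (intro finsum_perm_module finite_Omega basis_vec_in_perm_module)
    also have "\<dots> = 1" using True by (simp add: basis_vec_def)
    finally show ?thesis using True by simp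
  next
    case False
    have "T1 n \<in> carrier (perm_module n 1 :: ('k, _, _) gmodule)"
      unfolding T1_def by (intro finsum_in_perm_module basis_vec_in_perm_module)
    then show ?thesis using False by (auto simp: PiE_def extensional_def)
  qed
qed

lemma eta20_eq: "eta20 n f = superset_sum n 2 f {}"
  by (simp add: eta20_def superset_sum_def)

lemma eta21_eq:
  fixes f :: "nat set \<Rightarrow> 'k::field"
  assumes B: "B \<in> \<Omega> n 1"
  shows "eta21 n f B = superset_sum n 2 f B"
proof -
  obtain x where x: "B = {x}" "x \<in> {1..n}" using B by (rule Omega_1E)
  let ?M = "perm_module n 1 :: ('k, _, _) gmodule"
  let ?b = "\<lambda>A. (\<Oplus>\<^bsub>?M\<^esub>i\<in>A. basis_vec n 1 {i})"
  have fin: "finite A" if "A \<in> \<Omega> n 2" for A using that finite_subset by (auto simp: \<Omega>_def)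
  have b: "?b A \<in> carrier ?M" for A by (intro finsum_in_perm_module basis_vec_in_perm_module)
  have "?b A B = of_bool (B \<subseteq> A)" if A: "A \<in> \<Omega> n 2" for A
  proof -
    have "?b A B = (\<Sum>i\<in>A. basis_vec n 1 {i} B)"
      by (intro finsum_perm_module fin[OF A] basis_vec_in_perm_module B)
    also have "\<dots> = (\<Sum>i\<in>A. if i = x then 1 else 0)"
      by (rule sum.cong) (use B in \<open>auto simp: basis_vec_def x\<close>)
    also have "\<dots> = of_bool (B \<subseteq> A)" using fin[OF A] by (simp add: x)
    finally show ?thesis .
  qed
  then have "eta21 n f B = (\<Sum>A\<in>\<Omega> n 2. f A * of_bool (B \<subseteq> A))"
    unfolding eta21_def using B
    by (subst finsum_perm_module) auto
  also have "\<dots> = superset_sum n 2 f B"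
    unfolding superset_sum_def sum.inter_filter[OF finite_Omega] by (rule sum.cong) auto
  finally show ?thesis .
qed

section \<open>Fixed points\<close>

lemma (in vectorspace) multiple_if_dim_1:
  assumes fd: fin_dim and dim: "dim = 1" and v: "v \<in> carrier V" "v \<noteq> \<zero>\<^bsub>V\<^esub>" and w: "w \<in> carrier V"
  obtains c where "c \<in> carrier K" "w = c \<odot>\<^bsub>V\<^esub> v"
proof -
  have "lin_indpt {}" by (auto simp: lin_dep_def)
  then have "lin_indpt {v}" using lin_dep_iff_in_span[of "{}" v] v span_empty by simp
  then have "basis {v}" by (intro dim_li_is_basis[OF fd]) (use v dim in auto)
  then have "w \<in> span {v}" using w by (simp add: basis_def)
  then obtain a where "a \<in> {v} \<rightarrow> carrier K" "lincomb a {v} = w"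
    using finite_in_span[of "{v}" w] v by auto
  moreover from this(1) have "lincomb a {v} = a v \<odot>\<^bsub>V\<^esub> v"
    using lincomb_insert2[of "{}" a v] v by simp
  ultimately show ?thesis using that[of "a v"] by auto
qed

locale o2_group = char_two ty for ty :: "'k::field itself" +
  fixes n :: nat and X :: "(nat \<Rightarrow> nat) set"
  assumes n: "n \<ge> 6" "even n" and X: "subgroup X (sym_group n)"
    and O2: "X = O_upper 2 ((sym_group n)\<lparr>carrier := X\<rparr>)"
    and f1: "f_inv TYPE('k) n 1 X = 1"
begin

abbreviation M :: "nat \<Rightarrow> ('k, nat set \<Rightarrow> 'k, nat \<Rightarrow> nat) gmodule" where
  "M \<equiv> perm_module n"

abbreviation MX :: "nat \<Rightarrow> ('k, nat set \<Rightarrow> 'k, nat \<Rightarrow> nat) gmodule" where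
  "MX r \<equiv> (M r)\<lparr>carrier := fixed_points X (M r)\<rparr>"

lemma X_permutes: "g \<in> X \<Longrightarrow> g permutes {1..n}"
  using subgroup.subset[OF X] sym_group_carrier by blast

lemma finite_X: "finite X"
  by (rule finite_subset[OF _ finite_permutations[of "{1..n}"]]) (use X_permutes in auto)

lemma fixed_subspace: "subspace class_ring (fixed_points X (M r)) (M r)"
  by (rule group_module.fixed_points_subspace[OF perm_group_module]) (rule subgroup.subset[OF X])

lemma MX_vectorspace: "vectorspace class_ring (MX r)"
  by (rule vectorspace.subspace_is_vs[OF perm_module_vectorspace fixed_subspace])

lemma fin_dim_MX: "vectorspace.fin_dim class_ring (MX r)"
  by (rule vectorspace.fin_dim_subspace(1)[OF perm_module_vectorspace fin_dim_perm_module fixed_subspace])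

lemma in_fixed_points_iff:
  "restrict f (\<Omega> n r) \<in> fixed_points X (M r) \<longleftrightarrow> (\<forall>g\<in>X. \<forall>A\<in>\<Omega> n r. perm_act g f A = f A)"
  by (rule fixed_points_perm_module_iff) (rule X_permutes)

text \<open>By \<open>f1\<close> the fixed functions on points form a line, and this line contains the constants; in
  other words, \<open>X\<close> is transitive.\<close>

lemma fixed_constant:
  fixes a :: "nat set \<Rightarrow> 'k"
  assumes "\<And>g B. g \<in> X \<Longrightarrow> B \<in> \<Omega> n 1 \<Longrightarrow> perm_act g a B = a B"
  obtains c where "\<And>B. B \<in> \<Omega> n 1 \<Longrightarrow> a B = c"
proof -
  interpret F: vectorspace class_ring "MX 1" by (rule MX_vectorspace)
  have 1: "{1} \<in> \<Omega> n 1" using n by simp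
  have "(\<lambda>A\<in>\<Omega> n 1. 1) \<in> carrier (MX 1)"
    using in_fixed_points_iff[of "\<lambda>_. 1" 1] by (simp add: perm_act_def)
  moreover have "(\<lambda>A\<in>\<Omega> n 1. 1 :: 'k) \<noteq> \<zero>\<^bsub>MX 1\<^esub>" using 1 by (auto dest: fun_cong[of _ _ "{1}"])
  moreover have "restrict a (\<Omega> n 1) \<in> carrier (MX 1)"
    using in_fixed_points_iff[of a 1] assms by simp
  ultimately obtain c where "restrict a (\<Omega> n 1) = c \<odot>\<^bsub>MX 1\<^esub> (\<lambda>A\<in>\<Omega> n 1. 1)"
    using F.multiple_if_dim_1[OF fin_dim_MX] f1 unfolding f_inv_def by metis
  then have "a B = c" if "B \<in> \<Omega> n 1" for B using that by (auto dest: fun_cong[of _ _ B])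
  then show ?thesis using that by blast
qed

text \<open>The constant \<open>c(g)\<close> by which \<open>g\<close> moves \<open>a\<close> is additive in \<open>g\<close>, so it vanishes because
  \<open>O\<^sup>2(X) = X\<close>. Hence \<open>a\<close> is fixed by \<open>X\<close>.\<close>

lemma constant_if_fixed_mod_constants:
  fixes a :: "nat set \<Rightarrow> 'k"
  assumes a: "\<And>g. g \<in> X \<Longrightarrow> \<exists>c. \<forall>B\<in>\<Omega> n 1. perm_act g a B + a B = c"
  shows "\<exists>c. \<forall>B\<in>\<Omega> n 1. a B = c"
proof -
  let ?G = "(sym_group n)\<lparr>carrier := X\<rparr>"
  have 1: "{1} \<in> \<Omega> n 1" using n by simp
  define c where "c g = perm_act g a {1} + a {1}" for g
  have c: "perm_act g a B + a B = c g" if "g \<in> X" "B \<in> \<Omega> n 1" for g B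
    using a[OF that(1)] that(2) 1 unfolding c_def by metis
  have "c g = 0" if g: "g \<in> X" for g
  proof (rule additive_hom_trivial[where G = ?G and p = 2 and c = c])
    show "group ?G" by (rule group.subgroup_imp_group[OF sym_group_is_group X])
    show "finite (carrier ?G)" using finite_X by simp
    show "carrier ?G = O_upper 2 ?G" using O2 by simp
    fix g h assume gh: "g \<in> carrier ?G" "h \<in> carrier ?G"
    have g1: "g -` {1} \<in> \<Omega> n 1" using vimage_in_Omega_iff[OF X_permutes, of g] gh(1) 1 by simp
    have "c (g \<circ> h) = perm_act h a (g -` {1}) + a {1}"
      unfolding c_def perm_act_comp by (simp add: perm_act_def)
    also have "\<dots> = (perm_act h a (g -` {1}) + a (g -` {1})) + (perm_act g a {1} + a {1})"
      by (simp add: perm_act_def add_ac)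
    also have "\<dots> = c h + c g" using c[of h, OF _ g1] gh(2) by (simp add: c_def)
    finally show "c (g \<otimes>\<^bsub>?G\<^esub> h) = c g + c h" by (simp add: sym_group_mult add.commute)
  qed (use g char2 in auto)
  then have "perm_act g a B = a B" if "g \<in> X" "B \<in> \<Omega> n 1" for g B
    using c[OF that] that(1) by (simp add: add_eq_0_iff')
  then obtain c where "\<And>B. B \<in> \<Omega> n 1 \<Longrightarrow> a B = c" using fixed_constant[of a] by blast
  then show ?thesis by blast
qed

lemma carrier_specht2:
  "carrier (specht2 n :: ('k, _, _) gmodule) =
    {f \<in> carrier (M 2). superset_sum n 2 f {} = 0 \<and> (\<forall>B\<in>\<Omega> n 1. superset_sum n 2 f B = 0)}"
proof -
  have "eta21 n f = \<zero>\<^bsub>M 1\<^esub> \<longleftrightarrow> (\<forall>B\<in>\<Omega> n 1. superset_sum n 2 f B = 0)" for f :: "nat set \<Rightarrow> 'k"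
  proof
    assume "eta21 n f = \<zero>\<^bsub>M 1\<^esub>"
    then show "\<forall>B\<in>\<Omega> n 1. superset_sum n 2 f B = 0" by (auto simp flip: eta21_eq)
  next
    assume d: "\<forall>B\<in>\<Omega> n 1. superset_sum n 2 f B = 0"
    have "eta21 n f \<in> carrier (M 1)"
      unfolding eta21_def by (intro finsum_in_perm_module) simp
    then show "eta21 n f = \<zero>\<^bsub>M 1\<^esub>"
      by (intro extensionalityI[of _ "\<Omega> n 1"]) (use d in \<open>auto simp: eta21_eq PiE_def\<close>)
  qed
  then show ?thesis
    unfolding specht2_def by (auto simp: a_kernel_def kernel_def eta20_eq)
qed

text \<open>In the first case, the two conditions that the total sum and the sum over the pairs through
  the point \<open>1\<close> vanish leave a nonzero function in a space of dimension at least three. The sums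
  over the pairs through a point form an \<open>X\<close>-fixed function on points; it is constant, so all of
  them vanish.\<close>

lemma exists_fixed_specht:
  assumes "f_inv TYPE('k) n 2 X \<ge> 3 \<or>
    fixed_points X (specht2 n :: ('k, _, _) gmodule) \<noteq> {\<zero>\<^bsub>(specht2 n :: ('k, _, _) gmodule)\<^esub>}"
  obtains x :: "nat set \<Rightarrow> 'k" and A where "\<And>g A. g \<in> X \<Longrightarrow> A \<in> \<Omega> n 2 \<Longrightarrow> perm_act g x A = x A"
    "superset_sum n 2 x {} = 0" "\<And>B. B \<in> \<Omega> n 1 \<Longrightarrow> superset_sum n 2 x B = 0" "A \<in> \<Omega> n 2" "x A \<noteq> 0"
proof -
  have "\<exists>x \<in> fixed_points X (M 2). x \<noteq> \<zero>\<^bsub>M 2\<^esub> \<and> superset_sum n 2 x {} = 0 \<and> (\<forall>B\<in>\<Omega> n 1. superset_sum n 2 x B = 0)"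
    using assms
  proof
    assume f2: "f_inv TYPE('k) n 2 X \<ge> 3"
    let ?F = "class_ring.func_space {0, 1 :: nat} :: ('k, nat \<Rightarrow> 'k) module"
    let ?T = "\<lambda>f. \<lambda>i\<in>{0, 1 :: nat}. if i = 0 then superset_sum n 2 f {} else superset_sum n 2 f {1}"
    have dc: "superset_sum n 2 (restrict f (\<Omega> n 2)) B = superset_sum n 2 f B" for f B by (rule superset_sum_cong) simp
    interpret T: linear_map class_ring "MX 2" ?F ?T
      by (rule linear_mapI[OF MX_vectorspace func_space_vectorspace])
        (auto simp: LinearCombinations.module_hom_def class_ring.func_space_def fun_eq_iff dc
          superset_sum_add superset_sum_smult)
    have "\<not> inj_on ?T (carrier (MX 2))"
    proof
      assume "inj_on ?T (carrier (MX 2))"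
      then have "vectorspace.dim class_ring (MX 2) \<le> vectorspace.dim class_ring ?F"
        by (rule T.fin_dim_if_inj(2)) (rule fin_dim_func_space(1), simp)
      also have "\<dots> \<le> 2" using fin_dim_func_space(2)[of "{0, 1 :: nat}"] by (simp add: numeral_2_eq_2)
      finally show False using f2 by (simp add: f_inv_def)
    qed
    then obtain x where x: "x \<in> fixed_points X (M 2)" "x \<noteq> \<zero>\<^bsub>M 2\<^esub>" "?T x = \<zero>\<^bsub>?F\<^esub>"
    proof -
      have "T.ker \<noteq> {\<zero>\<^bsub>MX 2\<^esub>}" using \<open>\<not> inj_on ?T (carrier (MX 2))\<close> T.Ke0_imp_inj by auto
      then obtain x where x: "x \<in> T.ker" "x \<noteq> \<zero>\<^bsub>MX 2\<^esub>"
        using subspace_zero[OF T.kerT_is_subspace] by blast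
      from x(1) have "x \<in> carrier (MX 2)" "?T x = \<zero>\<^bsub>?F\<^esub>" unfolding T.ker_def by blast+
      then show ?thesis using that[of x] x(2) by simp
    qed
    have x0: "superset_sum n 2 x {} = 0" "superset_sum n 2 x {1} = 0"
      using fun_cong[OF x(3), of 0] fun_cong[OF x(3), of 1] by (simp_all add: class_ring.func_space_def)
    have xr: "restrict x (\<Omega> n 2) = x"
      using x(1) by (auto simp: fixed_points_def PiE_def extensional_restrict)
    have "perm_act g (superset_sum n 2 x) B = superset_sum n 2 x B" if g: "g \<in> X" for g B
    proof -
      have "perm_act g x A = x A" if "A \<in> \<Omega> n 2" for A
        using in_fixed_points_iff[of x 2] x(1) xr g that by simp
      then have "superset_sum n 2 (perm_act g x) B = superset_sum n 2 x B" by (rule superset_sum_cong)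
      then show ?thesis using perm_act_superset_sum[OF X_permutes[OF g]] by metis
    qed
    then obtain c where c: "\<And>B. B \<in> \<Omega> n 1 \<Longrightarrow> superset_sum n 2 x B = c" using fixed_constant[of "superset_sum n 2 x"] by blast
    have "{1} \<in> \<Omega> n 1" using n by simp
    then have "c = 0" using c x0(2) by metis
    then show ?thesis using x x0(1) c by blast
  next
    let ?S = "specht2 n :: ('k, _, _) gmodule"
    assume ne: "fixed_points X ?S \<noteq> {\<zero>\<^bsub>?S\<^esub>}"
    have S: "fixed_points X ?S = {f \<in> fixed_points X (M 2). superset_sum n 2 f {} = 0 \<and> (\<forall>B\<in>\<Omega> n 1. superset_sum n 2 f B = 0)}"
      unfolding fixed_points_def carrier_specht2 by (auto simp: specht2_def)
    have "\<zero>\<^bsub>M 2\<^esub> \<in> fixed_points X ?S"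
      unfolding S using subspace_zero[OF fixed_subspace[of 2]] by (auto simp: superset_sum_def \<Omega>_def)
    moreover have "\<zero>\<^bsub>?S\<^esub> = \<zero>\<^bsub>M 2\<^esub>" by (simp add: specht2_def)
    ultimately have "\<exists>x\<in>fixed_points X ?S. x \<noteq> \<zero>\<^bsub>M 2\<^esub>" using ne by (metis (no_types) empty_iff
      insert_iff subsetI subset_antisym)
    then show ?thesis unfolding S by blast
  qed
  then obtain x where x: "x \<in> fixed_points X (M 2)" "x \<noteq> \<zero>\<^bsub>M 2\<^esub>" "superset_sum n 2 x {} = 0"
    "\<And>B. B \<in> \<Omega> n 1 \<Longrightarrow> superset_sum n 2 x B = 0" by blast
  have xe: "x \<in> extensional (\<Omega> n 2)" using x(1) by (auto simp: fixed_points_def PiE_def)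
  then have "restrict x (\<Omega> n 2) = x" by (rule extensional_restrict)
  then have fx: "perm_act g x A = x A" if "g \<in> X" "A \<in> \<Omega> n 2" for g A
    using in_fixed_points_iff[of x 2] x(1) that by simp
  obtain A where "A \<in> \<Omega> n 2" "x A \<noteq> 0"
    using x(2) xe extensionalityI[of x "\<Omega> n 2" "\<zero>\<^bsub>M 2\<^esub>"] by auto
  then show ?thesis using that[of x A] fx x(3,4) by blast
qed

end

section \<open>Fixed functions on triples and the first cohomology\<close>

text \<open>The contracting homotopy of the full simplex given by the cone with apex \<open>1\<close>: if \<open>f\<close> is a
  coboundary, it is the coboundary of \<open>cone_section f\<close>.\<close>

definition cone_section :: "(nat set \<Rightarrow> 'k::field) \<Rightarrow> nat set \<Rightarrow> 'k" where
  "cone_section f B = (if 1 \<in> B then 0 else f (insert 1 B))"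

lemma insert_1_in_Omega:
  assumes "B \<in> \<Omega> n r" "1 \<notin> B" "n \<ge> 1" "s = Suc r"
  shows "insert 1 B \<in> \<Omega> n s"
  using assms finite_subset[of B "{1..n}"] by (auto simp: \<Omega>_def)

lemma cone_section_add:
  assumes "n \<ge> 1" "s = Suc r" "B \<in> \<Omega> n r" "\<And>A. A \<in> \<Omega> n s \<Longrightarrow> h A = f A + f' A"
  shows "cone_section h B = cone_section f B + cone_section f' B"
  using assms insert_1_in_Omega[of B n r s] by (simp add: cone_section_def)

lemma cone_section_smult:
  assumes "n \<ge> 1" "s = Suc r" "B \<in> \<Omega> n r" "\<And>A. A \<in> \<Omega> n s \<Longrightarrow> h A = c * f A"
  shows "cone_section h B = c * cone_section f B"
  using assms insert_1_in_Omega[of B n r s] by (simp add: cone_section_def)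

context char_two
begin

lemma subset_sum_cone_section_triple:
  assumes n: "n \<ge> 1" and A: "A \<in> \<Omega> n 3" and f: "\<And>A. A \<in> \<Omega> n 3 \<Longrightarrow> f A = subset_sum n 2 b A"
  shows "subset_sum n 2 (cone_section f) A = (f A :: 'k)"
proof -
  have f': "f {x, y, z} = b {x, y} + (b {x, z} + b {y, z})"
    if "distinct [x, y, z]" "{x, y, z} \<subseteq> {1..n}" for x y z
    using f[of "{x, y, z}"] subset_sum_2_triple[OF that, of b] that by (simp only: triple_in_Omega)
  show ?thesis
  proof (cases "1 \<in> A")
    case True
    obtain i j k where "A = {i, j, k}" "distinct [i, j, k]" "i \<in> {1..n}" "j \<in> {1..n}" "k \<in> {1..n}"
      using A by (rule Omega_3E)
    then obtain j k where jk: "A = {1, j, k}" "distinct [1, j, k]" "{1, j, k} \<subseteq> {1..n}"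
      using True by (auto simp: insert_commute)
    have "subset_sum n 2 (cone_section f) A = cone_section f {j, k}"
      unfolding jk(1) subset_sum_2_triple[OF jk(2,3)] by (simp add: cone_section_def)
    then show ?thesis using jk by (simp add: cone_section_def)
  next
    case False
    obtain i j k where ijk: "A = {i, j, k}" "distinct [i, j, k]" "i \<in> {1..n}" "j \<in> {1..n}" "k \<in> {1..n}"
      using A by (rule Omega_3E)
    have sub: "{i, j, k} \<subseteq> {1..n}" using ijk by auto
    have "1 \<notin> {i, j, k}" using False ijk(1) by simp
    then have "subset_sum n 2 (cone_section f) A = f {1, i, j} + (f {1, i, k} + f {1, j, k})"
      unfolding ijk(1) subset_sum_2_triple[OF ijk(2) sub] by (simp add: cone_section_def)
    also have "f {1, i, j} = b {1, i} + (b {1, j} + b {i, j})"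
      by (rule f') (use ijk \<open>1 \<notin> {i, j, k}\<close> n in auto)
    also have "f {1, i, k} = b {1, i} + (b {1, k} + b {i, k})"
      by (rule f') (use ijk \<open>1 \<notin> {i, j, k}\<close> n in auto)
    also have "f {1, j, k} = b {1, j} + (b {1, k} + b {j, k})"
      by (rule f') (use ijk \<open>1 \<notin> {i, j, k}\<close> n in auto)
    also have "(b {1, i} + (b {1, j} + b {i, j})) + ((b {1, i} + (b {1, k} + b {i, k}))
        + (b {1, j} + (b {1, k} + b {j, k}))) = b {i, j} + (b {i, k} + b {j, k})"
      by (simp add: add_ac)
    also have "\<dots> = f A" unfolding ijk(1) using f'[OF ijk(2) sub] by simp
    finally show ?thesis .
  qed
qed

lemma subset_sum_cone_section_pair:
  assumes n: "n \<ge> 1" and A: "A \<in> \<Omega> n 2" and u: "\<And>A. A \<in> \<Omega> n 3 \<Longrightarrow> subset_sum n 2 u A = 0"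
  shows "subset_sum n 1 (cone_section u) A = (u A :: 'k)"
proof -
  obtain i j where ij: "A = {i, j}" "i \<noteq> j" "i \<in> {1..n}" "j \<in> {1..n}" using A by (rule Omega_2E)
  have up: "subset_sum n 1 (cone_section u) A = cone_section u {i} + cone_section u {j}"
    using subset_sum_1_pair[of i j n] A ij(1) by simp
  consider "i = 1" | "j = 1" | "i \<noteq> 1" "j \<noteq> 1" by blast
  then show ?thesis
  proof cases
    case 3
    have d: "distinct [1, i, j]" "{1, i, j} \<subseteq> {1..n}" using 3 ij n by auto
    then have "{1, i, j} \<in> \<Omega> n 3" by (simp only: triple_in_Omega)
    then have "u {1, i} + (u {1, j} + u {i, j}) = 0" using u subset_sum_2_triple[OF d, of u] by simp
    then have "u {1, i} + u {1, j} = u {i, j}" by (simp only: add.assoc[symmetric] add_eq_0_iff')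
    then show ?thesis using 3 unfolding up by (simp add: cone_section_def ij(1))
  qed (use ij up in \<open>auto simp: cone_section_def insert_commute\<close>)
qed

lemma subset_sum_2_subset_sum_1:
  assumes "A \<in> \<Omega> n 3"
  shows "subset_sum n 2 (subset_sum n 1 a) A = (0 :: 'k)"
proof -
  obtain i j k where ijk: "A = {i, j, k}" "distinct [i, j, k]" "i \<in> {1..n}" "j \<in> {1..n}" "k \<in> {1..n}"
    using assms by (rule Omega_3E)
  have sub: "{i, j, k} \<subseteq> {1..n}" using ijk by auto
  have "{i, j} \<in> \<Omega> n 2" "{i, k} \<in> \<Omega> n 2" "{j, k} \<in> \<Omega> n 2" using ijk by (auto simp: pair_in_Omega)
  then show ?thesis
    unfolding ijk(1) subset_sum_2_triple[OF ijk(2) sub] by (simp only: subset_sum_1_pair) (simp add: add_ac)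
qed

lemma subset_sum_add: "subset_sum n s (\<lambda>A. a A + b A) A = subset_sum n s a A + subset_sum n s b A"
  by (simp add: subset_sum_def sum.distrib)

lemma subset_sum_cong: "(\<And>B. B \<in> \<Omega> n s \<Longrightarrow> a B = b B) \<Longrightarrow> subset_sum n s a A = subset_sum n s b A"
  by (simp add: subset_sum_def)

end

context o2_group
begin

abbreviation constants :: "(nat set \<Rightarrow> 'k) set" where
  "constants \<equiv> {c \<odot>\<^bsub>M 1\<^esub> T1 n | c. True}"

abbreviation GX :: "(nat \<Rightarrow> nat) monoid" where
  "GX \<equiv> (sym_group n)\<lparr>carrier := X\<rparr>"

abbreviation Q :: "('k, (nat set \<Rightarrow> 'k) set, nat \<Rightarrow> nat) gmodule" where
  "Q \<equiv> Q_module n"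

abbreviation Q_class :: "(nat set \<Rightarrow> 'k) \<Rightarrow> (nat set \<Rightarrow> 'k) set" where
  "Q_class a \<equiv> constants +>\<^bsub>M 1\<^esub> restrict a (\<Omega> n 1)"

lemma constants_eq: "constants = {\<lambda>B\<in>\<Omega> n 1. c | c. True}"
proof -
  have "c \<odot>\<^bsub>M 1\<^esub> T1 n = (\<lambda>B\<in>\<Omega> n 1. c)" for c by (auto simp: T1_eq)
  then show ?thesis by simp
qed

lemma M_group_module: "group_module GX (M r)"
  by (rule group_module.restrict_group_module[OF perm_group_module X])

lemma constants_subspace: "subspace class_ring constants (M 1)"
proof (rule vectorspace.subspaceI[OF perm_module_vectorspace])
  show "v \<oplus>\<^bsub>M 1\<^esub> w \<in> constants" if "v \<in> constants" "w \<in> constants" for v w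
    using that unfolding constants_eq by (auto cong: restrict_cong)
  show "c \<odot>\<^bsub>M 1\<^esub> v \<in> constants" if "v \<in> constants" for c v
    using that unfolding constants_eq by (auto cong: restrict_cong)
qed (unfold constants_eq, auto)

lemma constants_submodule: "group_submodule GX constants (M 1)"
proof -
  have act: "act (M 1) g w \<in> constants" if g: "g \<in> X" and w: "w \<in> constants" for g w
  proof -
    obtain c where "w = (\<lambda>B\<in>\<Omega> n 1. c)" using w unfolding constants_eq by blast
    then have "act (M 1) g w = (\<lambda>B\<in>\<Omega> n 1. c)"
      using act_restrict[OF X_permutes[OF g], of 1 "\<lambda>_. c"] by (simp only: perm_act_def)
    then show ?thesis unfolding constants_eq by blast
  qed
  show ?thesis
    unfolding group_submodule_def
  proof (intro conjI ballI)
    fix g w assume g: "g \<in> carrier GX" and w: "w \<in> constants"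
    have "g \<in> X" using g by simp
    then show "act (M 1) g w \<in> constants" using w by (rule act)
  qed (rule constants_subspace)
qed

lemma Q_group_module: "group_module GX Q"
  unfolding Q_module_def by (rule group_module.quotient_group_module(1)[OF M_group_module constants_submodule])

lemma Q_linear: "linear_map class_ring (M 1) Q (\<lambda>a. constants +>\<^bsub>M 1\<^esub> a)"
  unfolding Q_module_def by (rule group_module.quotient_group_module(2)[OF M_group_module constants_submodule])

lemma act_Q_class: "g \<in> X \<Longrightarrow> act Q g (Q_class a) = Q_class (perm_act g a)"
  unfolding Q_module_def
  by (subst group_module.quotient_group_module(3)[OF M_group_module constants_submodule])
    (simp_all add: act_restrict[OF X_permutes] del: perm_module_simps(5))

lemma Q_class_closed: "Q_class a \<in> carrier Q"
  by (rule mod_hom.f_im[OF linear_map.axioms(3)[OF Q_linear]]) simp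

lemma carrier_Q: "carrier Q = range Q_class"
proof -
  have "carrier Q = (\<lambda>a. constants +>\<^bsub>M 1\<^esub> a) ` carrier (M 1)"
    unfolding carrier_quotient[OF perm_module_vectorspace constants_subspace, symmetric]
    unfolding Q_module_def quotient_gmodule_def by (simp add: module.extend_def gmodule.fields_def)
  also have "\<dots> = range Q_class"
  proof (intro Set.equalityI subsetI)
    fix q assume "q \<in> (\<lambda>a. constants +>\<^bsub>M 1\<^esub> a) ` carrier (M 1)"
    then obtain a where "q = constants +>\<^bsub>M 1\<^esub> a" "restrict a (\<Omega> n 1) = a"
      by (auto simp: PiE_def extensional_restrict)
    then show "q \<in> range Q_class" by (intro range_eqI[of _ _ a]) simp
  qed auto
  finally show ?thesis .
qed

lemma fin_dim_Q: "vectorspace.fin_dim class_ring Q"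
proof (rule linear_map.surj_fin_dim[OF Q_linear fin_dim_perm_module])
  show "(\<lambda>a. constants +>\<^bsub>M 1\<^esub> a) ` carrier (M 1) = carrier Q"
    unfolding carrier_quotient[OF perm_module_vectorspace constants_subspace, symmetric]
    unfolding Q_module_def quotient_gmodule_def by (simp add: module.extend_def gmodule.fields_def)
qed

lemma Q_class_add: "Q_class a \<oplus>\<^bsub>Q\<^esub> Q_class b = Q_class (\<lambda>B. a B + b B)"
proof -
  have "Q_class (\<lambda>B. a B + b B) = constants +>\<^bsub>M 1\<^esub> (restrict a (\<Omega> n 1) \<oplus>\<^bsub>M 1\<^esub> restrict b (\<Omega> n 1))"
    by (simp cong: restrict_cong)
  also have "\<dots> = Q_class a \<oplus>\<^bsub>Q\<^esub> Q_class b"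
    by (rule hom_add[OF mod_hom.f_hom[OF linear_map.axioms(3)[OF Q_linear]]]) simp_all
  finally show ?thesis by simp
qed

lemma Q_class_smult: "c \<odot>\<^bsub>Q\<^esub> Q_class a = Q_class (\<lambda>B. c * a B)"
proof -
  have "Q_class (\<lambda>B. c * a B) = constants +>\<^bsub>M 1\<^esub> (c \<odot>\<^bsub>M 1\<^esub> restrict a (\<Omega> n 1))"
    by (simp cong: restrict_cong)
  also have "\<dots> = c \<odot>\<^bsub>Q\<^esub> Q_class a"
    by (rule hom_smult[OF mod_hom.f_hom[OF linear_map.axioms(3)[OF Q_linear]]]) simp_all
  finally show ?thesis by simp
qed

lemma Q_class_cong: "(\<And>B. B \<in> \<Omega> n 1 \<Longrightarrow> a B = b B) \<Longrightarrow> Q_class a = Q_class b"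
  by (rule arg_cong[OF restrict_ext])

lemma minus_M: "a \<in> carrier (M r) \<Longrightarrow> b \<in> carrier (M r) \<Longrightarrow> a \<ominus>\<^bsub>M r\<^esub> b = a \<oplus>\<^bsub>M r\<^esub> b"
proof -
  assume a: "a \<in> carrier (M r)" and b: "b \<in> carrier (M r)"
  interpret V: vectorspace class_ring "M r" by (rule perm_module_vectorspace)
  have "b \<oplus>\<^bsub>M r\<^esub> b = \<zero>\<^bsub>M r\<^esub>" by (simp cong: restrict_cong)
  then have "\<ominus>\<^bsub>M r\<^esub> b = b" using b by (intro V.M.minus_equality)
  then show ?thesis by (simp only: a_minus_def)
qed

lemma Q_class_eq_iff: "Q_class a = Q_class b \<longleftrightarrow> (\<exists>c. \<forall>B\<in>\<Omega> n 1. a B + b B = c)"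
proof -
  have "Q_class a = Q_class b \<longleftrightarrow> restrict a (\<Omega> n 1) \<ominus>\<^bsub>M 1\<^esub> restrict b (\<Omega> n 1) \<in> constants"
    by (rule coset_eq_iff[OF perm_module_vectorspace constants_subspace]) simp_all
  also have "restrict a (\<Omega> n 1) \<ominus>\<^bsub>M 1\<^esub> restrict b (\<Omega> n 1) = (\<lambda>B\<in>\<Omega> n 1. a B + b B)"
    by (subst minus_M) (simp_all cong: restrict_cong)
  also have "(\<lambda>B\<in>\<Omega> n 1. a B + b B) \<in> constants \<longleftrightarrow> (\<exists>c. \<forall>B\<in>\<Omega> n 1. a B + b B = c)"
  proof
    assume "(\<lambda>B\<in>\<Omega> n 1. a B + b B) \<in> constants"
    then obtain c where c: "(\<lambda>B\<in>\<Omega> n 1. a B + b B) = (\<lambda>B\<in>\<Omega> n 1. c)" unfolding constants_eq by blast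
    have "a B + b B = c" if "B \<in> \<Omega> n 1" for B using fun_cong[OF c, of B] that by simp
    then show "\<exists>c. \<forall>B\<in>\<Omega> n 1. a B + b B = c" by blast
  next
    assume "\<exists>c. \<forall>B\<in>\<Omega> n 1. a B + b B = c"
    then obtain c where "\<forall>B\<in>\<Omega> n 1. a B + b B = c" ..
    then have "(\<lambda>B\<in>\<Omega> n 1. a B + b B) = (\<lambda>B\<in>\<Omega> n 1. c)" by (intro restrict_ext) simp
    then show "(\<lambda>B\<in>\<Omega> n 1. a B + b B) \<in> constants" unfolding constants_eq by blast
  qed
  finally show ?thesis .
qed

text \<open>If the coboundary of \<open>cone_section f\<close> is an \<open>X\<close>-fixed function \<open>f\<close> on triples, then the defect
  of \<open>g\<close> has coboundary zero. So it is the coboundary of a function on points, which is unique up to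
  constants and gives an element of \<open>Q\<close>. This is the connecting map from fixed functions on triples
  to \<open>H\<^sup>1(X, Q)\<close>, on the level of cocycles.\<close>

definition defect :: "(nat set \<Rightarrow> 'k) \<Rightarrow> (nat \<Rightarrow> nat) \<Rightarrow> nat set \<Rightarrow> 'k" where
  "defect f g = (\<lambda>A. perm_act g (cone_section f) A + cone_section f A)"

definition connecting :: "(nat set \<Rightarrow> 'k) \<Rightarrow> (nat \<Rightarrow> nat) \<Rightarrow> (nat set \<Rightarrow> 'k) set" where
  "connecting f = (\<lambda>g\<in>X. Q_class (cone_section (defect f g)))"

lemma connecting_linear:
  assumes "f \<in> carrier (M 3)" "f' \<in> carrier (M 3)"
  shows "connecting (f \<oplus>\<^bsub>M 3\<^esub> f') = connecting f \<oplus>\<^bsub>fun_module X Q\<^esub> connecting f'"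
    and "connecting (c \<odot>\<^bsub>M 3\<^esub> f) = c \<odot>\<^bsub>fun_module X Q\<^esub> connecting f"
proof -
  have n1: "n \<ge> 1" using n by simp
  have add: "cone_section (f \<oplus>\<^bsub>M 3\<^esub> f') A = cone_section f A + cone_section f' A" if "A \<in> \<Omega> n 2" for A
    by (rule cone_section_add[OF n1 _ that, where s = 3]) simp_all
  have smult: "cone_section (c \<odot>\<^bsub>M 3\<^esub> f) A = c * cone_section f A" if "A \<in> \<Omega> n 2" for A
    by (rule cone_section_smult[OF n1 _ that, where s = 3]) simp_all
  have dadd: "defect (f \<oplus>\<^bsub>M 3\<^esub> f') g A = defect f g A + defect f' g A" if "A \<in> \<Omega> n 2" "g \<in> X" for A g
    using add[of A] add[of "g -` A"] that vimage_in_Omega_iff[OF X_permutes[OF that(2)]]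
    unfolding defect_def perm_act_def by (simp only: add_ac)
  have dsmult: "defect (c \<odot>\<^bsub>M 3\<^esub> f) g A = c * defect f g A" if "A \<in> \<Omega> n 2" "g \<in> X" for A g
    using smult[of A] smult[of "g -` A"] that vimage_in_Omega_iff[OF X_permutes[OF that(2)]]
    unfolding defect_def perm_act_def by (simp only: distrib_left)
  have "Q_class (cone_section (defect (f \<oplus>\<^bsub>M 3\<^esub> f') g))
      = Q_class (cone_section (defect f g)) \<oplus>\<^bsub>Q\<^esub> Q_class (cone_section (defect f' g))" if g: "g \<in> X" for g
  proof -
    have "cone_section (defect (f \<oplus>\<^bsub>M 3\<^esub> f') g) B = cone_section (defect f g) B + cone_section (defect f' g) B"
      if "B \<in> \<Omega> n 1" for B
      by (rule cone_section_add[OF n1 _ that, where s = 2]) (use dadd[OF _ g] in simp_all)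
    then show ?thesis unfolding Q_class_add by (rule Q_class_cong)
  qed
  then show "connecting (f \<oplus>\<^bsub>M 3\<^esub> f') = connecting f \<oplus>\<^bsub>fun_module X Q\<^esub> connecting f'"
    by (simp add: connecting_def fun_module_def del: perm_module_simps cong: restrict_cong)
  have "Q_class (cone_section (defect (c \<odot>\<^bsub>M 3\<^esub> f) g)) = c \<odot>\<^bsub>Q\<^esub> Q_class (cone_section (defect f g))"
    if g: "g \<in> X" for g
  proof -
    have "cone_section (defect (c \<odot>\<^bsub>M 3\<^esub> f) g) B = c * cone_section (defect f g) B"
      if "B \<in> \<Omega> n 1" for B
      by (rule cone_section_smult[OF n1 _ that, where s = 2]) (use dsmult[OF _ g] in simp_all)
    then show ?thesis unfolding Q_class_smult by (rule Q_class_cong)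
  qed
  then show "connecting (c \<odot>\<^bsub>M 3\<^esub> f) = c \<odot>\<^bsub>fun_module X Q\<^esub> connecting f"
    by (simp add: connecting_def fun_module_def del: perm_module_simps cong: restrict_cong)
qed

context
  fixes f :: "nat set \<Rightarrow> 'k"
  assumes fixed: "\<And>g A. g \<in> X \<Longrightarrow> A \<in> \<Omega> n 3 \<Longrightarrow> perm_act g f A = f A"
    and coboundary: "\<exists>b. \<forall>A\<in>\<Omega> n 3. f A = subset_sum n 2 b A"
begin

lemma subset_sum_cone_section_f: "A \<in> \<Omega> n 3 \<Longrightarrow> subset_sum n 2 (cone_section f) A = f A"
  using subset_sum_cone_section_triple[of n A f] coboundary n by auto

lemma subset_sum_defect:
  assumes g: "g \<in> X" and A: "A \<in> \<Omega> n 2"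
  shows "subset_sum n 1 (cone_section (defect f g)) A = defect f g A"
proof (rule subset_sum_cone_section_pair[OF _ A])
  fix A assume A: "A \<in> \<Omega> n 3"
  have "g -` A \<in> \<Omega> n 3" using A vimage_in_Omega_iff[OF X_permutes[OF g]] by simp
  then have "subset_sum n 2 (defect f g) A = perm_act g f A + f A"
    using subset_sum_cone_section_f A unfolding defect_def subset_sum_add perm_act_subset_sum[OF X_permutes[OF g], symmetric]
    by (simp add: perm_act_def)
  then show "subset_sum n 2 (defect f g) A = 0" using fixed[OF g A] by simp
qed (use n in simp)

text \<open>The defects satisfy the cocycle identity, and two functions on points with the same coboundary
  differ by a constant.\<close>

lemma connecting_cocycle: "connecting f \<in> cocycles1 GX Q"
proof -
  have "Q_class (cone_section (defect f (g \<circ> h)))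
      = Q_class (cone_section (defect f g)) \<oplus>\<^bsub>Q\<^esub> act Q g (Q_class (cone_section (defect f h)))"
    if g: "g \<in> X" and h: "h \<in> X" for g h
  proof -
    let ?q = "\<lambda>g. cone_section (defect f g)"
    let ?d = "\<lambda>B. ?q (g \<circ> h) B + (?q g B + perm_act g (?q h) B)"
    have gh: "g \<circ> h \<in> X" using subgroup.m_closed[OF X g h] by (simp add: sym_group_mult)
    have "subset_sum n 1 ?d A = 0" if A: "A \<in> \<Omega> n 2" for A
    proof -
      have gA: "g -` A \<in> \<Omega> n 2" using A vimage_in_Omega_iff[OF X_permutes[OF g]] by simp
      have "subset_sum n 1 ?d A = defect f (g \<circ> h) A + (defect f g A + perm_act g (defect f h) A)"
        unfolding subset_sum_add perm_act_subset_sum[OF X_permutes[OF g], symmetric] subset_sum_defect[OF gh A] subset_sum_defect[OF g A]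
        using subset_sum_defect[OF h gA] by (simp add: perm_act_def)
      also have "\<dots> = 0" unfolding defect_def perm_act_comp by (simp add: perm_act_def add_ac)
      finally show ?thesis .
    qed
    then obtain c where "\<And>B. B \<in> \<Omega> n 1 \<Longrightarrow> ?d B = c" using const_if_subset_sum_pair_zero[of n ?d] by blast
    then show ?thesis unfolding act_Q_class[OF g] Q_class_add Q_class_eq_iff by blast
  qed
  then show ?thesis
    unfolding cocycles1_def connecting_def
    using subgroup.m_closed[OF X] Q_class_closed by (auto simp: sym_group_mult)
qed

text \<open>If the cocycle is the coboundary of the class of \<open>a\<close>, then adding the coboundary of \<open>a\<close> to
  \<open>cone_section f\<close> gives an \<open>X\<close>-fixed function on pairs, and its coboundary is still \<open>f\<close>.\<close>

lemma fixed_pair_if_coboundary: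
  assumes "connecting f \<in> coboundaries1 GX Q"
  obtains b where "b \<in> fixed_points X (M 2)" "\<And>A. A \<in> \<Omega> n 3 \<Longrightarrow> f A = subset_sum n 2 b A"
proof -
  obtain v where v: "connecting f = (\<lambda>g\<in>X. act Q g v \<ominus>\<^bsub>Q\<^esub> v)" "v \<in> carrier Q"
    using assms unfolding coboundaries1_def by auto
  obtain a where a: "v = Q_class a" using v(2) carrier_Q by auto
  interpret Q: vectorspace class_ring Q using Q_group_module by (rule group_module.axioms)
  have neg: "\<ominus>\<^bsub>Q\<^esub> Q_class a = Q_class a"
  proof (rule Q.M.minus_equality)
    have "\<zero>\<^bsub>Q\<^esub> = 0 \<odot>\<^bsub>Q\<^esub> Q_class a" using Q.lmult_0[OF Q_class_closed] by simp
    then show "Q_class a \<oplus>\<^bsub>Q\<^esub> Q_class a = \<zero>\<^bsub>Q\<^esub>" unfolding Q_class_smult Q_class_add by simp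
  qed (rule Q_class_closed)+
  let ?b = "\<lambda>A. cone_section f A + subset_sum n 1 a A"
  have "perm_act g ?b A = ?b A" if g: "g \<in> X" and A: "A \<in> \<Omega> n 2" for g A
  proof -
    have gA: "g -` A \<in> \<Omega> n 2" using A vimage_in_Omega_iff[OF X_permutes[OF g]] by simp
    have "Q_class (cone_section (defect f g)) = act Q g v \<ominus>\<^bsub>Q\<^esub> v"
      using fun_cong[OF v(1), of g] g by (simp only: connecting_def restrict_apply')
    also have "\<dots> = Q_class (\<lambda>B. perm_act g a B + a B)"
      unfolding a a_minus_def neg act_Q_class[OF g] Q_class_add ..
    finally have "Q_class (cone_section (defect f g)) = Q_class (\<lambda>B. perm_act g a B + a B)" .
    then obtain c where c: "\<And>B. B \<in> \<Omega> n 1 \<Longrightarrow> cone_section (defect f g) B + (perm_act g a B + a B) = c"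
      unfolding Q_class_eq_iff by blast
    obtain i j where ij: "A = {i, j}" using A by (rule Omega_2E)
    have "subset_sum n 1 (\<lambda>B. cone_section (defect f g) B + (perm_act g a B + a B)) {i, j} = 0"
      by (rule subset_sum_1_const_pair[OF _ c]) (use A ij in auto)
    then have "0 = subset_sum n 1 (\<lambda>B. cone_section (defect f g) B + (perm_act g a B + a B)) A"
      unfolding ij by (rule sym)
    also have "\<dots> = defect f g A + (perm_act g (subset_sum n 1 a) A + subset_sum n 1 a A)"
      unfolding subset_sum_add subset_sum_defect[OF g A] perm_act_subset_sum[OF X_permutes[OF g]] ..
    also have "\<dots> = perm_act g ?b A + ?b A"
      unfolding defect_def by (simp add: perm_act_def add_ac)
    finally show ?thesis by (simp only: add_eq_0_iff' eq_commute[of 0])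
  qed
  then have "restrict ?b (\<Omega> n 2) \<in> fixed_points X (M 2)" unfolding in_fixed_points_iff by blast
  moreover have "f A = subset_sum n 2 (restrict ?b (\<Omega> n 2)) A" if A: "A \<in> \<Omega> n 3" for A
  proof -
    have "subset_sum n 2 (restrict ?b (\<Omega> n 2)) A = subset_sum n 2 ?b A" by (rule subset_sum_cong) simp
    also have "\<dots> = f A" unfolding subset_sum_add subset_sum_cone_section_f[OF A] subset_sum_2_subset_sum_1[OF A] by simp
    finally show ?thesis by simp
  qed
  ultimately show ?thesis using that by blast
qed

end

text \<open>If all fixed functions on triples are coboundaries, the connecting map to \<open>H\<^sup>1(X, Q)\<close> is
  defined on all of them, and its kernel consists of coboundaries of fixed functions on pairs.\<close>

lemma fixed_triples_le:
  assumes cob: "\<And>f. f \<in> fixed_points X (M 3) \<Longrightarrow> \<exists>b. \<forall>A\<in>\<Omega> n 3. f A = subset_sum n 2 b A"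
  shows "f_inv TYPE('k) n 3 X \<le> f_inv TYPE('k) n 2 X + h_inv TYPE('k) n X"
proof -
  have fx: "perm_act g f A = f A" if "f \<in> fixed_points X (M 3)" "g \<in> X" "A \<in> \<Omega> n 3" for f g A
  proof -
    have "restrict f (\<Omega> n 3) = f" using that(1) by (auto simp: fixed_points_def PiE_def extensional_restrict)
    then show ?thesis using in_fixed_points_iff[of f 3] that by simp
  qed
  let ?Z = "(fun_module X Q)\<lparr>carrier := cocycles1 GX Q\<rparr>"
  interpret Q: group_module GX Q by (rule Q_group_module)
  have Zeq: "Q.cocycle_space = ?Z" by simp
  let ?\<pi> = "\<lambda>z. coboundaries1 GX Q +>\<^bsub>?Z\<^esub> z"
  interpret P: linear_map class_ring ?Z "cohomology1 GX Q" ?\<pi>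
    using Q.cohomology1_linear unfolding Zeq .
  let ?\<Theta> = "\<lambda>f. ?\<pi> (connecting f)"
  have cc: "connecting f \<in> cocycles1 GX Q" if "f \<in> fixed_points X (M 3)" for f
    by (rule connecting_cocycle) (use fx[OF that] cob[OF that] in auto)
  have car: "f \<in> carrier (M 3)" if "f \<in> fixed_points X (M 3)" for f
    using that by (simp add: fixed_points_def)
  interpret T: linear_map class_ring "MX 3" "cohomology1 GX Q" ?\<Theta>
  proof (rule linear_mapI[OF MX_vectorspace P.W.vectorspace_axioms])
    show "?\<Theta> \<in> LinearCombinations.module_hom class_ring (MX 3) (cohomology1 GX Q)"
      unfolding LinearCombinations.module_hom_def
    proof (intro CollectI conjI allI impI Pi_I)
      fix f assume "f \<in> carrier (MX 3)"
      then show "?\<Theta> f \<in> carrier (cohomology1 GX Q)" using cc by (intro P.f_im) simp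
    next
      fix f f' assume "f \<in> carrier (MX 3) \<and> f' \<in> carrier (MX 3)"
      then have f: "f \<in> fixed_points X (M 3)" "f' \<in> fixed_points X (M 3)" by simp_all
      have "connecting (f \<oplus>\<^bsub>M 3\<^esub> f') = connecting f \<oplus>\<^bsub>?Z\<^esub> connecting f'"
        using connecting_linear(1)[OF car[OF f(1)] car[OF f(2)]] by simp
      then show "?\<Theta> (f \<oplus>\<^bsub>MX 3\<^esub> f') = ?\<Theta> f \<oplus>\<^bsub>cohomology1 GX Q\<^esub> ?\<Theta> f'"
        using P.f_add[of "connecting f" "connecting f'"] cc[OF f(1)] cc[OF f(2)]
        by (simp del: perm_module_simps)
    next
      fix c :: 'k and f assume "c \<in> carrier class_ring \<and> f \<in> carrier (MX 3)"
      then have f: "f \<in> fixed_points X (M 3)" by simp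
      have "connecting (c \<odot>\<^bsub>M 3\<^esub> f) = c \<odot>\<^bsub>?Z\<^esub> connecting f"
        using connecting_linear(2)[OF car[OF f] car[OF f]] by simp
      then show "?\<Theta> (c \<odot>\<^bsub>MX 3\<^esub> f) = c \<odot>\<^bsub>cohomology1 GX Q\<^esub> ?\<Theta> f"
        using P.f_smult[of c "connecting f"] cc[OF f] by (simp del: perm_module_simps)
    qed
  qed
  let ?S = "\<lambda>b. \<lambda>A\<in>\<Omega> n 3. subset_sum n 2 b A"
  have ur: "subset_sum n 2 (restrict b (\<Omega> n 2)) A = subset_sum n 2 b A" for b A by (rule subset_sum_cong) simp
  interpret S: linear_map class_ring "MX 2" "MX 3" ?S
  proof (rule linear_mapI[OF MX_vectorspace MX_vectorspace])
    have "?S b \<in> fixed_points X (M 3)" if b: "b \<in> fixed_points X (M 2)" for b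
    proof -
      have "restrict b (\<Omega> n 2) = b" using b by (auto simp: fixed_points_def PiE_def extensional_restrict)
      then have bf: "perm_act g b A = b A" if "g \<in> X" "A \<in> \<Omega> n 2" for g A
        using in_fixed_points_iff[of b 2] b that by simp
      show ?thesis
        unfolding in_fixed_points_iff
        using perm_act_subset_sum[OF X_permutes] subset_sum_cong[of n 2 "perm_act _ b" b] bf by metis
    qed
    then show "?S \<in> LinearCombinations.module_hom class_ring (MX 2) (MX 3)"
      by (auto simp: LinearCombinations.module_hom_def ur subset_sum_add subset_sum_def sum_distrib_left
          simp del: perm_module_simps(1) cong: restrict_cong)
  qed
  have ker: "T.ker \<subseteq> ?S ` carrier (MX 2)"
  proof
    fix f assume f: "f \<in> T.ker"
    then have ff: "f \<in> fixed_points X (M 3)" and z: "?\<Theta> f = \<zero>\<^bsub>cohomology1 GX Q\<^esub>"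
      unfolding T.ker_def by auto
    have "connecting f \<in> coboundaries1 GX Q"
      using Q.cohomology1_eq_zero_iff[OF cc[OF ff]] z unfolding Zeq by blast
    then obtain b where b: "b \<in> fixed_points X (M 2)" "\<And>A. A \<in> \<Omega> n 3 \<Longrightarrow> f A = subset_sum n 2 b A"
      using fixed_pair_if_coboundary[of f] fx[OF ff] cob[OF ff] by blast
    have "f = ?S b"
      using car[OF ff] b(2) by (intro extensionalityI[of _ "\<Omega> n 3"]) (auto simp: PiE_def)
    then show "f \<in> ?S ` carrier (MX 2)" using b(1) by simp
  qed
  have "vectorspace.dim class_ring (MX 3) \<le> vectorspace.dim class_ring (cohomology1 GX Q)
      + vectorspace.dim class_ring (T.V.vs T.ker)"
    by (rule T.dim_le_dim_plus_ker[OF fin_dim_MX Q.fin_dim_cohomology1])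
      (simp_all add: finite_X fin_dim_Q)
  also have "vectorspace.dim class_ring (T.V.vs T.ker) \<le> vectorspace.dim class_ring (MX 2)"
    by (rule S.dim_le_if_subset_im[OF fin_dim_MX T.kerT_is_subspace ker])
  finally show ?thesis by (simp add: f_inv_def h_inv_def add.commute)
qed

lemma exists_fixed_not_coboundary:
  assumes "e3_inv TYPE('k) n X \<ge> int (h_inv TYPE('k) n X) + 1"
  obtains f :: "nat set \<Rightarrow> 'k" where
    "\<And>g A. g \<in> X \<Longrightarrow> A \<in> \<Omega> n 3 \<Longrightarrow> perm_act g f A = f A" "\<And>b. \<exists>A\<in>\<Omega> n 3. f A \<noteq> subset_sum n 2 b A"
proof -
  have "\<not> f_inv TYPE('k) n 3 X \<le> f_inv TYPE('k) n 2 X + h_inv TYPE('k) n X"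
    using assms by (simp add: e3_inv_def)
  then obtain f where f: "f \<in> fixed_points X (M 3)" "\<And>b. \<exists>A\<in>\<Omega> n 3. f A \<noteq> subset_sum n 2 b A"
    using fixed_triples_le by blast
  have "restrict f (\<Omega> n 3) = f" using f(1) by (auto simp: fixed_points_def PiE_def extensional_restrict)
  then show ?thesis using in_fixed_points_iff[of f 3] f that[of f] by auto
qed

end

section \<open>Homomorphisms from a permutation module to endomorphisms\<close>

lemma module_extend_simps:
  "carrier (module.extend R (gmodule.fields a)) = carrier R"
  "\<zero>\<^bsub>module.extend R (gmodule.fields a)\<^esub> = \<zero>\<^bsub>R\<^esub>"
  "add (module.extend R (gmodule.fields a)) = add R"
  "smult (module.extend R (gmodule.fields a)) = smult R"
  "act (module.extend R (gmodule.fields a)) = a"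
  by (simp_all add: module.extend_def gmodule.fields_def)

context group_module
begin

lemma end_module_simps:
  "carrier (end_module G V) = LinearCombinations.module_hom class_ring V V \<inter> extensional (carrier V)"
  "\<zero>\<^bsub>end_module G V\<^esub> = (\<lambda>v\<in>carrier V. \<zero>\<^bsub>V\<^esub>)"
  "\<phi> \<oplus>\<^bsub>end_module G V\<^esub> \<psi> = (\<lambda>v\<in>carrier V. \<phi> v \<oplus>\<^bsub>V\<^esub> \<psi> v)"
  "c \<odot>\<^bsub>end_module G V\<^esub> \<phi> = (\<lambda>v\<in>carrier V. c \<odot>\<^bsub>V\<^esub> \<phi> v)"
  "act (end_module G V) g \<phi> = (\<lambda>v\<in>carrier V. act V g (\<phi> (act V (inv\<^bsub>G\<^esub> g) v)))"
  unfolding end_module_def module_extend_simps by (simp_all add: lin_maps_def fun_module_def)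

lemma end_module_vectorspace: "vectorspace class_ring (end_module G V)"
  by (rule vectorspace_cong[OF lin_maps_vectorspace[OF V.vectorspace_axioms V.vectorspace_axioms]])
    (simp_all add: end_module_def module_extend_simps)

lemma fin_dim_end_module:
  assumes "V.fin_dim"
  shows "vectorspace.fin_dim class_ring (end_module G V)"
proof -
  note L = lin_maps_vectorspace[OF V.vectorspace_axioms V.vectorspace_axioms]
  interpret T: linear_map class_ring "end_module G V" "lin_maps V V" "\<lambda>\<phi>. \<phi>"
    by (rule linear_mapI[OF end_module_vectorspace L])
      (simp add: LinearCombinations.module_hom_def end_module_def module_extend_simps)
  show ?thesis
    by (rule T.fin_dim_if_inj(1)[OF _ fin_dim_lin_maps[OF V.vectorspace_axioms V.vectorspace_axioms assms assms]]) simp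
qed

lemma end_group_module: "group_module G (end_module G V)"
proof (intro group_module.intro group_module_axioms.intro)
  let ?E = "end_module G V"
  show "group G" by (rule G.group_axioms)
  show "vectorspace class_ring ?E" by (rule end_module_vectorspace)
  fix g assume g: "g \<in> carrier G"
  have ig: "inv\<^bsub>G\<^esub> g \<in> carrier G" using g by simp
  have acts: "act V g \<in> LinearCombinations.module_hom class_ring V V"
    "act V (inv\<^bsub>G\<^esub> g) \<in> LinearCombinations.module_hom class_ring V V"
    by (rule act_linear[OF g], rule act_linear[OF ig])
  have hom: "\<phi> (act V (inv\<^bsub>G\<^esub> g) v) \<in> carrier V"
    if "\<phi> \<in> LinearCombinations.module_hom class_ring V V" "v \<in> carrier V" for \<phi> v
    by (rule hom_closed[OF that(1) hom_closed[OF acts(2) that(2)]])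
  show "act ?E g \<in> LinearCombinations.module_hom class_ring ?E ?E"
    unfolding LinearCombinations.module_hom_def
  proof (intro CollectI conjI allI impI Pi_I)
    fix \<phi> assume "\<phi> \<in> carrier ?E"
    then have p: "\<phi> \<in> LinearCombinations.module_hom class_ring V V" by (simp add: end_module_simps)
    have "act ?E g \<phi> \<in> LinearCombinations.module_hom class_ring V V"
      unfolding LinearCombinations.module_hom_def end_module_simps
      using g ig p by (auto simp: act_closed act_add act_smult hom_closed[OF p] hom_add[OF p] hom_smult[OF p])
    then show "act ?E g \<phi> \<in> carrier ?E" by (simp add: end_module_simps)
  next
    fix \<phi> \<psi> assume "\<phi> \<in> carrier ?E \<and> \<psi> \<in> carrier ?E"
    then have p: "\<phi> \<in> LinearCombinations.module_hom class_ring V V" "\<psi> \<in> LinearCombinations.module_hom class_ring V V"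
      by (simp_all add: end_module_simps)
    show "act ?E g (\<phi> \<oplus>\<^bsub>?E\<^esub> \<psi>) = act ?E g \<phi> \<oplus>\<^bsub>?E\<^esub> act ?E g \<psi>"
      unfolding end_module_simps
      by (rule restrict_ext) (use g ig hom[OF p(1)] hom[OF p(2)] in \<open>simp add: act_closed act_add\<close>)
  next
    fix c :: 'k and \<phi> assume "c \<in> carrier class_ring \<and> \<phi> \<in> carrier ?E"
    then have p: "\<phi> \<in> LinearCombinations.module_hom class_ring V V" by (simp add: end_module_simps)
    show "act ?E g (c \<odot>\<^bsub>?E\<^esub> \<phi>) = c \<odot>\<^bsub>?E\<^esub> act ?E g \<phi>"
      unfolding end_module_simps
      by (rule restrict_ext) (use g ig hom[OF p] in \<open>simp add: act_closed act_smult\<close>)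
  qed
  fix h \<phi> assume h: "h \<in> carrier G" and "\<phi> \<in> carrier ?E"
  then have p: "\<phi> \<in> LinearCombinations.module_hom class_ring V V" by (simp add: end_module_simps)
  show "act ?E (g \<otimes>\<^bsub>G\<^esub> h) \<phi> = act ?E g (act ?E h \<phi>)"
    unfolding end_module_simps
    by (rule restrict_ext)
      (use g h ig hom_closed[OF p] in \<open>simp add: G.inv_mult_group act_mult act_closed\<close>)
next
  fix \<phi> assume "\<phi> \<in> carrier (end_module G V)"
  then have p: "\<phi> \<in> LinearCombinations.module_hom class_ring V V" "\<phi> \<in> extensional (carrier V)"
    by (simp_all add: end_module_simps)
  show "act (end_module G V) \<one>\<^bsub>G\<^esub> \<phi> = \<phi>"
    unfolding end_module_simps
    by (rule extensionalityI[OF _ p(2)]) (simp_all add: act_one hom_closed[OF p(1)])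
qed

end

lemma group_hom_space_subspace:
  assumes U: "group_module G U" and W: "group_module G W"
  shows "subspace class_ring (carrier (group_hom_space G U W)) (lin_maps U W)"
proof -
  interpret U: group_module G U by (rule U)
  interpret W: group_module G W by (rule W)
  note L = lin_maps_vectorspace[OF U.V.vectorspace_axioms W.V.vectorspace_axioms]
  interpret L: vectorspace class_ring "lin_maps U W" by (rule L)
  have ops: "\<phi> \<oplus>\<^bsub>lin_maps U W\<^esub> \<psi> = (\<lambda>u\<in>carrier U. \<phi> u \<oplus>\<^bsub>W\<^esub> \<psi> u)"
    "c \<odot>\<^bsub>lin_maps U W\<^esub> \<phi> = (\<lambda>u\<in>carrier U. c \<odot>\<^bsub>W\<^esub> \<phi> u)"
    "\<zero>\<^bsub>lin_maps U W\<^esub> = (\<lambda>u\<in>carrier U. \<zero>\<^bsub>W\<^esub>)" for \<phi> \<psi> c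
    by (simp_all add: lin_maps_def fun_module_def)
  have closed: "\<phi> u \<in> carrier W" if "\<phi> \<in> carrier (lin_maps U W)" "u \<in> carrier U" for \<phi> u
    using that hom_closed unfolding lin_maps_def by fastforce
  show ?thesis
  proof (rule L.subspaceI)
    show "carrier (group_hom_space G U W) \<subseteq> carrier (lin_maps U W)"
      by (simp add: group_hom_space_def Collect_restrict)
    show "\<zero>\<^bsub>lin_maps U W\<^esub> \<in> carrier (group_hom_space G U W)"
      using L.M.zero_closed by (simp add: group_hom_space_def ops(3) U.act_closed W.act_zero)
  next
    fix \<phi> \<psi> assume "\<phi> \<in> carrier (group_hom_space G U W)" "\<psi> \<in> carrier (group_hom_space G U W)"
    then show "\<phi> \<oplus>\<^bsub>lin_maps U W\<^esub> \<psi> \<in> carrier (group_hom_space G U W)"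
      using L.M.add.m_closed[of \<phi> \<psi>]
      by (simp add: group_hom_space_def ops(1) U.act_closed W.act_add closed)
  next
    fix c and \<phi> assume "\<phi> \<in> carrier (group_hom_space G U W)"
    then show "c \<odot>\<^bsub>lin_maps U W\<^esub> \<phi> \<in> carrier (group_hom_space G U W)"
      using L.smult_closed[of c \<phi>]
      by (simp add: group_hom_space_def ops(2) U.act_closed W.act_smult closed)
  qed
qed

lemma group_hom_space_vectorspace:
  assumes U: "group_module G U" and W: "group_module G W"
  shows "vectorspace class_ring (group_hom_space G U W)"
    and "vectorspace.fin_dim class_ring U \<Longrightarrow> vectorspace.fin_dim class_ring W \<Longrightarrow>
      vectorspace.fin_dim class_ring (group_hom_space G U W)"
proof -
  note vs = group_module.axioms(2)[OF U] group_module.axioms(2)[OF W]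
  have e: "group_hom_space G U W = (lin_maps U W)\<lparr>carrier := carrier (group_hom_space G U W)\<rparr>"
    by (simp add: group_hom_space_def)
  show "vectorspace class_ring (group_hom_space G U W)"
    by (subst e) (rule vectorspace.subspace_is_vs[OF lin_maps_vectorspace[OF vs] group_hom_space_subspace[OF U W]])
  show "vectorspace.fin_dim class_ring (group_hom_space G U W)"
    if "vectorspace.fin_dim class_ring U" "vectorspace.fin_dim class_ring W"
    by (subst e) (rule vectorspace.fin_dim_subspace(1)[OF lin_maps_vectorspace[OF vs]
          fin_dim_lin_maps[OF vs that] group_hom_space_subspace[OF U W]])
qed

lemma carrier_group_hom_space:
  "\<psi> \<in> carrier (group_hom_space G U W) \<longleftrightarrow> \<psi> \<in> LinearCombinations.module_hom class_ring U W \<and>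
    \<psi> \<in> extensional (carrier U) \<and> (\<forall>g\<in>carrier G. \<forall>u\<in>carrier U. \<psi> (act U g u) = act W g (\<psi> u))"
  by (auto simp: group_hom_space_def lin_maps_def)

lemma group_hom_space_ops:
  "\<phi> \<oplus>\<^bsub>group_hom_space G U W\<^esub> \<psi> = (\<lambda>u\<in>carrier U. \<phi> u \<oplus>\<^bsub>W\<^esub> \<psi> u)"
  "c \<odot>\<^bsub>group_hom_space G U W\<^esub> \<phi> = (\<lambda>u\<in>carrier U. c \<odot>\<^bsub>W\<^esub> \<phi> u)"
  by (simp_all add: group_hom_space_def lin_maps_def fun_module_def)

context char_two
begin

text \<open>A function that pairs to zero with the image has sum zero over the points of every triple. It
  is therefore constant, and three times this constant is zero.\<close>

lemma superset_sum_surjective: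
  fixes m :: "nat set \<Rightarrow> 'k"
  assumes n: "n \<ge> 5"
  obtains k where "\<And>B. B \<in> \<Omega> n 1 \<Longrightarrow> superset_sum n 3 k B = m B"
proof -
  define I where "I = {w :: nat set \<Rightarrow> 'k. \<exists>v\<in>UNIV. \<forall>B\<in>\<Omega> n 1. w B = superset_sum n 3 v B}"
  have I: "perm_submodule n 1 I"
    unfolding I_def by (rule perm_submodule_image) (simp add: perm_submodule_def)
  have "m \<in> I"
  proof (rule ccontr)
    assume "m \<notin> I"
    then obtain u where u: "\<And>w. w \<in> I \<Longrightarrow> (\<Sum>B\<in>\<Omega> n 1. w B * u B) = 0" "(\<Sum>B\<in>\<Omega> n 1. m B * u B) \<noteq> 0"
      using perm_submodule_separation[OF I] by blast
    have z: "subset_sum n 1 u A = 0" if A: "A \<in> \<Omega> n 3" for A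
    proof -
      let ?k = "\<lambda>A'. if A' = A then 1 else 0"
      have "superset_sum n 3 ?k \<in> I" unfolding I_def by blast
      then have "0 = (\<Sum>B\<in>\<Omega> n 1. superset_sum n 3 ?k B * u B)" using u(1) by simp
      also have "\<dots> = (\<Sum>A'\<in>\<Omega> n 3. ?k A' * subset_sum n 1 u A')"
        by (rule subset_sum_superset_sum_adjoint[symmetric])
      also have "\<dots> = (\<Sum>A'\<in>\<Omega> n 3. if A' = A then subset_sum n 1 u A' else 0)"
        by (rule sum.cong) simp_all
      also have "\<dots> = subset_sum n 1 u A" using A by simp
      finally show ?thesis by simp
    qed
    have "subset_sum n 1 u A = subset_sum n 2 (\<lambda>_. 0) A" if "A \<in> \<Omega> n 3" for A
      using z[OF that] by (simp add: subset_sum_def)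
    then obtain c where c: "\<And>B. B \<in> \<Omega> n 1 \<Longrightarrow> u B = c"
      using const_if_subset_sum_triple_eq[OF n] by blast
    have A: "{1, 2, 3} \<in> \<Omega> n 3" unfolding triple_in_Omega using n by auto
    have "c = 0" using z[OF A] subset_sum_const_triple[OF A c] by simp
    then have "(\<Sum>B\<in>\<Omega> n 1. m B * u B) = 0" using c by simp
    then show False using u(2) by blast
  qed
  then obtain k where "\<forall>B\<in>\<Omega> n 1. m B = superset_sum n 3 k B" unfolding I_def by blast
  then show ?thesis using that[of k] by simp
qed

lemma char_two_add_self:
  assumes "vectorspace (class_ring :: 'k ring) V" "v \<in> carrier V"
  shows "v \<oplus>\<^bsub>V\<^esub> v = \<zero>\<^bsub>V\<^esub>"
proof -
  interpret V: vectorspace "class_ring :: 'k ring" V by (rule assms(1))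
  have "v \<oplus>\<^bsub>V\<^esub> v = (1 + 1 :: 'k) \<odot>\<^bsub>V\<^esub> v" using V.smult_l_distr[of 1 1 v] V.smult_one[of v] assms(2) by simp
  also have "\<dots> = \<zero>\<^bsub>V\<^esub>" using V.lmult_0[OF assms(2)] by simp
  finally show ?thesis .
qed

lemma char_two_eq_if_add_zero:
  assumes "vectorspace (class_ring :: 'k ring) V" "v \<in> carrier V" "w \<in> carrier V" "v \<oplus>\<^bsub>V\<^esub> w = \<zero>\<^bsub>V\<^esub>"
  shows "v = w"
proof -
  interpret V: vectorspace "class_ring :: 'k ring" V by (rule assms(1))
  have "v \<oplus>\<^bsub>V\<^esub> w = w \<oplus>\<^bsub>V\<^esub> w" using assms char_two_add_self[OF assms(1,3)] by simp
  then show ?thesis by (rule V.add.right_cancel[THEN iffD1, OF assms(3,2,3)])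
qed

text \<open>The hypothesis says that a homomorphism on \<open>M\<^sub>3\<close> depends only on the sums over the triples
  through each point. Any section \<open>\<sigma>\<close> of the surjective map from \<open>M\<^sub>3\<close> to \<open>M\<^sub>1\<close> given by these sums
  is linear and equivariant up to elements annihilated by all homomorphisms. So composition with \<open>\<sigma>\<close>
  maps homomorphisms on \<open>M\<^sub>3\<close> injectively to homomorphisms on \<open>M\<^sub>1\<close>.\<close>

lemma d_inv_le_if_kernel_vanishes:
  fixes V :: "('k, 'v, nat \<Rightarrow> nat) gmodule"
  assumes n: "n \<ge> 5" and V: "group_module (sym_group n) V" "vectorspace.fin_dim class_ring V"
    and vanish: "\<And>\<psi> k. \<psi> \<in> carrier (group_hom_space (sym_group n) (perm_module n 3) (end_module (sym_group n) V)) \<Longrightarrow>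
      k \<in> carrier (perm_module n 3) \<Longrightarrow> (\<And>B. B \<in> \<Omega> n 1 \<Longrightarrow> superset_sum n 3 k B = 0) \<Longrightarrow>
      \<psi> k = \<zero>\<^bsub>end_module (sym_group n) V\<^esub>"
  shows "d_inv n 3 V \<le> d_inv n 1 V"
proof -
  let ?G = "sym_group n" and ?M1 = "perm_module n 1 :: ('k, _, _) gmodule"
  let ?M3 = "perm_module n 3 :: ('k, _, _) gmodule"
  interpret V: group_module ?G V by (rule V(1))
  let ?E = "end_module ?G V"
  let ?H3 = "group_hom_space ?G ?M3 ?E" and ?H1 = "group_hom_space ?G ?M1 ?E"
  have E: "group_module ?G ?E" by (rule V.end_group_module)
  interpret E: group_module ?G ?E by (rule E)
  have fdE: "E.V.fin_dim" by (rule V.fin_dim_end_module[OF V(2)])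
  have eq: "\<psi> k = \<psi> k'"
    if p: "\<psi> \<in> carrier ?H3" and k: "k \<in> carrier ?M3" "k' \<in> carrier ?M3"
      and s: "\<And>B. B \<in> \<Omega> n 1 \<Longrightarrow> superset_sum n 3 k B = superset_sum n 3 k' B" for \<psi> k k'
  proof (rule char_two_eq_if_add_zero[OF E.V.vectorspace_axioms])
    have h: "\<psi> \<in> LinearCombinations.module_hom class_ring ?M3 ?E"
      using p by (simp only: carrier_group_hom_space)
    show "\<psi> k \<in> carrier ?E" "\<psi> k' \<in> carrier ?E" by (rule hom_closed[OF h k(1)], rule hom_closed[OF h k(2)])
    have "\<psi> k \<oplus>\<^bsub>?E\<^esub> \<psi> k' = \<psi> (k \<oplus>\<^bsub>?M3\<^esub> k')" by (rule hom_add[OF h k, symmetric])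
    also have "\<dots> = \<zero>\<^bsub>?E\<^esub>"
    proof (rule vanish[OF p])
      show "k \<oplus>\<^bsub>?M3\<^esub> k' \<in> carrier ?M3" by simp
      show "superset_sum n 3 (k \<oplus>\<^bsub>?M3\<^esub> k') B = 0" if B: "B \<in> \<Omega> n 1" for B
      proof -
        have "superset_sum n 3 (k \<oplus>\<^bsub>?M3\<^esub> k') B = superset_sum n 3 (\<lambda>A. k A + k' A) B"
          by (rule superset_sum_cong) simp
        then show ?thesis using s[OF B] by (simp add: superset_sum_add)
      qed
    qed
    finally show "\<psi> k \<oplus>\<^bsub>?E\<^esub> \<psi> k' = \<zero>\<^bsub>?E\<^esub>" .
  qed
  define \<sigma> where "\<sigma> m = (SOME k. k \<in> carrier ?M3 \<and> (\<forall>B\<in>\<Omega> n 1. superset_sum n 3 k B = m B))"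
    for m :: "nat set \<Rightarrow> 'k"
  have "\<exists>k. k \<in> carrier ?M3 \<and> (\<forall>B\<in>\<Omega> n 1. superset_sum n 3 k B = m B)" for m :: "nat set \<Rightarrow> 'k"
  proof -
    obtain k where k: "\<And>B. B \<in> \<Omega> n 1 \<Longrightarrow> superset_sum n 3 k B = m B"
      using superset_sum_surjective[OF n, of m] by blast
    have "superset_sum n 3 (restrict k (\<Omega> n 3)) B = superset_sum n 3 k B" for B
      by (rule superset_sum_cong) simp
    then show ?thesis using k by (intro exI[of _ "restrict k (\<Omega> n 3)"]) simp
  qed
  then have \<sigma>: "\<sigma> m \<in> carrier ?M3 \<and> (\<forall>B\<in>\<Omega> n 1. superset_sum n 3 (\<sigma> m) B = m B)" for m
    unfolding \<sigma>_def by (rule someI_ex)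
  then have \<sigma>c: "\<sigma> m \<in> carrier ?M3" and \<sigma>s: "\<And>B. B \<in> \<Omega> n 1 \<Longrightarrow> superset_sum n 3 (\<sigma> m) B = m B" for m
    by blast+
  let ?S = "\<lambda>\<psi>. \<lambda>m\<in>carrier ?M1. \<psi> (\<sigma> m)"
  have S_in: "?S \<psi> \<in> carrier ?H1" if p: "\<psi> \<in> carrier ?H3" for \<psi>
  proof -
    have h: "\<psi> \<in> LinearCombinations.module_hom class_ring ?M3 ?E"
      and eqv: "\<And>g u. g \<in> carrier ?G \<Longrightarrow> u \<in> carrier ?M3 \<Longrightarrow> \<psi> (act ?M3 g u) = act ?E g (\<psi> u)"
      using p by (auto simp only: carrier_group_hom_space)
    interpret M1: group_module ?G ?M1 by (rule perm_group_module)
    interpret M3: group_module ?G ?M3 by (rule perm_group_module)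
    have add: "\<psi> (\<sigma> (m \<oplus>\<^bsub>?M1\<^esub> m')) = \<psi> (\<sigma> m) \<oplus>\<^bsub>?E\<^esub> \<psi> (\<sigma> m')" for m m'
    proof -
      have "\<psi> (\<sigma> (m \<oplus>\<^bsub>?M1\<^esub> m')) = \<psi> (\<sigma> m \<oplus>\<^bsub>?M3\<^esub> \<sigma> m')"
      proof (rule eq[OF p \<sigma>c M3.V.M.add.m_closed[OF \<sigma>c \<sigma>c]])
        fix B assume B: "B \<in> \<Omega> n 1"
        have "superset_sum n 3 (\<sigma> m \<oplus>\<^bsub>?M3\<^esub> \<sigma> m') B = superset_sum n 3 (\<lambda>A. \<sigma> m A + \<sigma> m' A) B"
          by (rule superset_sum_cong) simp
        then show "superset_sum n 3 (\<sigma> (m \<oplus>\<^bsub>?M1\<^esub> m')) B = superset_sum n 3 (\<sigma> m \<oplus>\<^bsub>?M3\<^esub> \<sigma> m') B"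
          using \<sigma>s[OF B] B by (simp add: superset_sum_add)
      qed
      also have "\<dots> = \<psi> (\<sigma> m) \<oplus>\<^bsub>?E\<^esub> \<psi> (\<sigma> m')" by (rule hom_add[OF h \<sigma>c \<sigma>c])
      finally show ?thesis .
    qed
    have smult: "\<psi> (\<sigma> (c \<odot>\<^bsub>?M1\<^esub> m)) = c \<odot>\<^bsub>?E\<^esub> \<psi> (\<sigma> m)" for c m
    proof -
      have "\<psi> (\<sigma> (c \<odot>\<^bsub>?M1\<^esub> m)) = \<psi> (c \<odot>\<^bsub>?M3\<^esub> \<sigma> m)"
      proof (rule eq[OF p \<sigma>c])
        show "c \<odot>\<^bsub>?M3\<^esub> \<sigma> m \<in> carrier ?M3" by simp
        fix B assume B: "B \<in> \<Omega> n 1"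
        have "superset_sum n 3 (c \<odot>\<^bsub>?M3\<^esub> \<sigma> m) B = superset_sum n 3 (\<lambda>A. c * \<sigma> m A) B"
          by (rule superset_sum_cong) simp
        then show "superset_sum n 3 (\<sigma> (c \<odot>\<^bsub>?M1\<^esub> m)) B = superset_sum n 3 (c \<odot>\<^bsub>?M3\<^esub> \<sigma> m) B"
          using \<sigma>s[OF B] B by (simp add: superset_sum_smult)
      qed
      also have "\<dots> = c \<odot>\<^bsub>?E\<^esub> \<psi> (\<sigma> m)" by (rule hom_smult[OF h \<sigma>c])
      finally show ?thesis .
    qed
    have act: "\<psi> (\<sigma> (act ?M1 g m)) = act ?E g (\<psi> (\<sigma> m))" if g: "g \<in> carrier ?G" for g m
    proof -
      have gp: "g permutes {1..n}" using g by (simp add: sym_group_carrier)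
      have "\<psi> (\<sigma> (act ?M1 g m)) = \<psi> (act ?M3 g (\<sigma> m))"
      proof (rule eq[OF p \<sigma>c M3.act_closed[OF g \<sigma>c]])
        fix B assume B: "B \<in> \<Omega> n 1"
        have gB: "g -` B \<in> \<Omega> n 1" using B vimage_in_Omega_iff[OF gp] by simp
        have "superset_sum n 3 (act ?M3 g (\<sigma> m)) B = superset_sum n 3 (perm_act g (\<sigma> m)) B"
          by (rule superset_sum_cong) (simp add: perm_act_def)
        also have "\<dots> = m (g -` B)"
          unfolding perm_act_superset_sum[OF gp] by (simp only: perm_act_def \<sigma>s[OF gB])
        finally show "superset_sum n 3 (\<sigma> (act ?M1 g m)) B = superset_sum n 3 (act ?M3 g (\<sigma> m)) B"
          using \<sigma>s[OF B, of "act ?M1 g m"] B by simp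
      qed
      also have "\<dots> = act ?E g (\<psi> (\<sigma> m))" by (rule eqv[OF g \<sigma>c])
      finally show ?thesis .
    qed
    show ?thesis
      unfolding carrier_group_hom_space LinearCombinations.module_hom_def
      using add smult act M1.act_closed M1.V.M.add.m_closed M1.V.smult_closed hom_closed[OF h \<sigma>c]
      by (simp del: perm_module_simps)
  qed
  interpret S: linear_map class_ring ?H3 ?H1 ?S
  proof (rule linear_mapI)
    show "vectorspace class_ring ?H3" "vectorspace class_ring ?H1"
      by (rule group_hom_space_vectorspace(1)[OF perm_group_module E])+
    show "?S \<in> LinearCombinations.module_hom class_ring ?H3 ?H1"
      unfolding LinearCombinations.module_hom_def
    proof (intro CollectI conjI allI impI Pi_I)
      show "?S (\<phi> \<oplus>\<^bsub>?H3\<^esub> \<psi>) = ?S \<phi> \<oplus>\<^bsub>?H1\<^esub> ?S \<psi>" for \<phi> \<psi>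
        unfolding group_hom_space_ops by (rule restrict_ext) (simp add: \<sigma>c del: perm_module_simps)
      show "?S (c \<odot>\<^bsub>?H3\<^esub> \<phi>) = c \<odot>\<^bsub>?H1\<^esub> ?S \<phi>" for c \<phi>
        unfolding group_hom_space_ops by (rule restrict_ext) (simp add: \<sigma>c del: perm_module_simps)
    qed (rule S_in)
  qed
  have "vectorspace.dim class_ring ?H3 \<le> vectorspace.dim class_ring ?H1"
  proof (rule S.fin_dim_if_inj(2))
    show "vectorspace.fin_dim class_ring ?H1"
      by (rule group_hom_space_vectorspace(2)[OF perm_group_module E fin_dim_perm_module fdE])
    show "inj_on ?S (carrier ?H3)"
    proof (rule inj_onI)
      fix \<phi> \<psi> assume p: "\<phi> \<in> carrier ?H3" "\<psi> \<in> carrier ?H3" and e: "?S \<phi> = ?S \<psi>"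
      have "\<phi> k = \<psi> k" if k: "k \<in> carrier ?M3" for k
      proof -
        let ?m = "\<lambda>B\<in>\<Omega> n 1. superset_sum n 3 k B"
        have m: "?m \<in> carrier ?M1" by simp
        have s: "superset_sum n 3 k B = superset_sum n 3 (\<sigma> ?m) B" if "B \<in> \<Omega> n 1" for B
          using \<sigma>s[OF that, of ?m] that by simp
        have "\<phi> k = \<phi> (\<sigma> ?m)" by (rule eq[OF p(1) k \<sigma>c s])
        also have "\<dots> = \<psi> (\<sigma> ?m)" using fun_cong[OF e, of ?m] m by (simp only: restrict_apply')
        also have "\<dots> = \<psi> k" by (rule eq[OF p(2) k \<sigma>c s, symmetric])
        finally show ?thesis .
      qed
      then show "\<phi> = \<psi>"
        using p by (intro extensionalityI[of _ "carrier ?M3"]) (simp_all only: carrier_group_hom_space)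
    qed
  qed
  then show ?thesis by (simp only: d_inv_def)
qed

end

section \<open>Reducibility of the restriction\<close>

theorem theorem6p5:
  fixes n :: nat
    and V :: "('k::alg_closed_field, 'v, nat \<Rightarrow> nat) gmodule"
    and X :: "(nat \<Rightarrow> nat) set"
  assumes "CHAR('k) = 2"
    and "n \<ge> 6" and "even n"
    and "irreducible_module (sym_group n) V"
    and "d_inv n 3 V > d_inv n 1 V"
    and "subgroup X (sym_group n)"
    and "X = O_upper 2 ((sym_group n)\<lparr>carrier := X\<rparr>)"
    and "f_inv TYPE('k) n 1 X = 1"
    and "e3_inv TYPE('k) n X \<ge> int (h_inv TYPE('k) n X) + 1"
    and "f_inv TYPE('k) n 2 X \<ge> 3 \<or>
         fixed_points X (specht2 n :: ('k, _, _) gmodule) \<noteq> {\<zero>\<^bsub>(specht2 n :: ('k, _, _) gmodule)\<^esub>}"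
  shows "reducible_module ((sym_group n)\<lparr>carrier := X\<rparr>) V"
proof (rule ccontr)
  let ?G = "sym_group n"
  assume not_red: "\<not> reducible_module (?G\<lparr>carrier := X\<rparr>) V"
  interpret o2_group "TYPE('k)" n X
    using assms(1-3,6-8) by (simp add: o2_group_def o2_group_axioms_def char_two_def)
  interpret V: group_module ?G V using assms(4) by (simp add: irreducible_module_def)
  have VX: "group_module GX V" by (rule V.restrict_group_module[OF X])
  interpret VX: group_module GX V by (rule VX)
  have "finite (carrier ?G)" using finite_permutations[of "{1..n}"] by (simp add: sym_group_def)
  then have fdV: "V.V.fin_dim" by (rule irreducible_fin_dim[OF assms(4)])
  obtain v0 where v0: "v0 \<in> carrier V" "v0 \<noteq> \<zero>\<^bsub>V\<^esub>"
    using assms(4) V.V.M.zero_closed unfolding irreducible_module_def by blast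
  have irr: "W = {\<zero>\<^bsub>V\<^esub>} \<or> W = carrier V" if "group_submodule GX W V" for W
    using not_red VX that unfolding reducible_module_def by blast
  obtain x A where x: "\<And>g A. g \<in> X \<Longrightarrow> A \<in> \<Omega> n 2 \<Longrightarrow> perm_act g x A = (x A :: 'k)"
    "superset_sum n 2 x {} = 0" "\<And>B. B \<in> \<Omega> n 1 \<Longrightarrow> superset_sum n 2 x B = 0" "A \<in> \<Omega> n 2" "x A \<noteq> 0"
    by (rule exists_fixed_specht[OF assms(10)], rule that)
  obtain f where f: "\<And>g A. g \<in> X \<Longrightarrow> A \<in> \<Omega> n 3 \<Longrightarrow> perm_act g f A = (f A :: 'k)"
    "\<And>b. \<exists>A\<in>\<Omega> n 3. f A \<noteq> subset_sum n 2 b A"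
    by (rule exists_fixed_not_coboundary[OF assms(9)], rule that)
  let ?E = "end_module ?G V"
  interpret E: group_module ?G ?E by (rule V.end_group_module)
  have "d_inv n 3 V \<le> d_inv n 1 V"
  proof (rule d_inv_le_if_kernel_vanishes[OF _ V.group_module_axioms fdV])
    fix \<psi> and k :: "nat set \<Rightarrow> 'k"
    assume \<psi>: "\<psi> \<in> carrier (group_hom_space ?G (M 3) ?E)" and k: "k \<in> carrier (M 3)"
      and k0: "\<And>B. B \<in> \<Omega> n 1 \<Longrightarrow> superset_sum n 3 k B = 0"
    have hom: "\<psi> \<in> LinearCombinations.module_hom class_ring (M 3) ?E"
      and eqv: "\<And>g m. g \<in> carrier ?G \<Longrightarrow> m \<in> carrier (M 3) \<Longrightarrow> \<psi> (act (M 3) g m) = act ?E g (\<psi> m)"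
      using \<psi> unfolding carrier_group_hom_space by blast+
    interpret T: linear_map class_ring "M 3" ?E \<psi>
      by (rule linear_mapI[OF perm_module_vectorspace E.V.vectorspace_axioms hom])
    interpret M3: group_module ?G "M 3" by (rule perm_group_module)
    have "group_submodule ?G T.ker (M 3)"
      unfolding group_submodule_def
    proof (intro conjI ballI)
      show "subspace class_ring T.ker (M 3)" by (rule T.kerT_is_subspace)
      fix g m assume g: "g \<in> carrier ?G" and m: "m \<in> T.ker"
      then have "m \<in> carrier (M 3)" "\<psi> m = \<zero>\<^bsub>?E\<^esub>" unfolding T.ker_def by blast+
      then show "act (M 3) g m \<in> T.ker"
        unfolding T.ker_def using eqv[OF g] M3.act_closed[OF g] E.act_zero[OF g] by simp
    qed
    from perm_submodule_of_group_submodule[OF this]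
    have N: "perm_submodule n 3 {f. restrict f (\<Omega> n 3) \<in> T.ker}" .
    \<comment> \<open>In characteristic two, \<open>f\<close> is fixed by \<open>g\<close> modulo the kernel of \<open>\<psi>\<close> exactly if \<open>g\<close> fixes the
      image of \<open>f\<close>.\<close>
    have mem: "(\<lambda>A. perm_act g f A + f A) \<in> {f. restrict f (\<Omega> n 3) \<in> T.ker} \<longleftrightarrow>
        act ?E g (\<psi> (restrict f (\<Omega> n 3))) = \<psi> (restrict f (\<Omega> n 3))"
      if g: "g permutes {1..n}" for g and f :: "nat set \<Rightarrow> 'k"
    proof -
      let ?m = "restrict f (\<Omega> n 3)"
      have m: "?m \<in> carrier (M 3)" by simp
      have gG: "g \<in> carrier ?G" using g by (simp add: sym_group_carrier)
      have "restrict (\<lambda>A. perm_act g f A + f A) (\<Omega> n 3) = act (M 3) g ?m \<oplus>\<^bsub>M 3\<^esub> ?m"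
        unfolding act_restrict[OF g] by (simp cong: restrict_cong)
      then have e: "\<psi> (restrict (\<lambda>A. perm_act g f A + f A) (\<Omega> n 3)) = act ?E g (\<psi> ?m) \<oplus>\<^bsub>?E\<^esub> \<psi> ?m"
        using hom_add[OF hom M3.act_closed[OF gG m] m] eqv[OF gG m] by simp
      have c: "\<psi> ?m \<in> carrier ?E" "act ?E g (\<psi> ?m) \<in> carrier ?E"
        using hom_closed[OF hom m] E.act_closed[OF gG] by simp_all
      show ?thesis
        unfolding T.ker_def mem_Collect_eq e
        using char_two_eq_if_add_zero[OF E.V.vectorspace_axioms c(2,1)]
          char_two_add_self[OF E.V.vectorspace_axioms c(1)] by auto
    qed
    have "k \<in> {f. restrict f (\<Omega> n 3) \<in> T.ker}"
    proof (rule kernel_in_submodule[OF n N X_permutes _ constant_if_fixed_mod_constants x f k0])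
      fix f' :: "nat set \<Rightarrow> 'k" and g
      let ?\<phi> = "\<psi> (restrict f' (\<Omega> n 3))"
      assume fx: "\<And>h. h \<in> X \<Longrightarrow> (\<lambda>A. perm_act h f' A + f' A) \<in> {f. restrict f (\<Omega> n 3) \<in> T.ker}"
        and g: "g permutes {1..n}"
      have "?\<phi> \<in> carrier ?E" by (rule hom_closed[OF hom]) simp
      then have \<phi>: "?\<phi> \<in> LinearCombinations.module_hom class_ring V V" "?\<phi> \<in> extensional (carrier V)"
        by (simp_all add: V.end_module_simps)
      \<comment> \<open>A function fixed by \<open>X\<close> modulo the kernel is mapped to an endomorphism that commutes with
        \<open>X\<close>, which is a scalar by Schur's lemma.\<close>
      have comm: "?\<phi> (act V h v) = act V h (?\<phi> v)" if h: "h \<in> carrier GX" and v: "v \<in> carrier V" for h v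
      proof -
        have hX: "h \<in> X" using h by simp
        then have hG: "h \<in> carrier ?G" using subgroup.subset[OF X] by blast
        have "act ?E h ?\<phi> = ?\<phi>" using fx[OF hX] mem[OF X_permutes[OF hX]] by blast
        then have "?\<phi> (act V h v) = act ?E h ?\<phi> (act V h v)" by simp
        also have "\<dots> = act V h (?\<phi> (act V (inv\<^bsub>?G\<^esub> h) (act V h v)))"
          unfolding V.end_module_simps by (rule restrict_apply'[OF V.act_closed[OF hG v]])
        also have "act V (inv\<^bsub>?G\<^esub> h) (act V h v) = v"
          using V.act_mult[of "inv\<^bsub>?G\<^esub> h" h v] V.act_one[OF v] hG v V.G.l_inv[OF hG] V.G.inv_closed[OF hG]
          by (simp del: sym_group_inv_equality)
        finally show ?thesis .
      qed
      obtain c where c: "\<And>v. v \<in> carrier V \<Longrightarrow> ?\<phi> v = c \<odot>\<^bsub>V\<^esub> v"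
        by (rule schur[OF VX fdV v0 irr \<phi>(1) comm]; (assumption | rule that))
      have gG: "g \<in> carrier ?G" using g by (simp add: sym_group_carrier)
      have "act ?E g ?\<phi> = ?\<phi>"
        unfolding V.end_module_simps
      proof (rule extensionalityI[OF _ \<phi>(2)])
        fix v assume v: "v \<in> carrier V"
        have iv: "act V (inv\<^bsub>?G\<^esub> g) v \<in> carrier V" by (rule V.act_closed[OF V.G.inv_closed[OF gG] v])
        have "act V g (act V (inv\<^bsub>?G\<^esub> g) v) = v"
          using V.act_mult[OF gG V.G.inv_closed[OF gG] v] V.act_one[OF v] V.G.r_inv[OF gG]
          by (simp del: sym_group_inv_equality)
        then show "(\<lambda>v\<in>carrier V. act V g (?\<phi> (act V (inv\<^bsub>?G\<^esub> g) v))) v = ?\<phi> v"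
          using v c[OF iv] c[OF v] V.act_smult[OF gG iv] by (simp del: sym_group_inv_equality)
      qed simp
      then show "(\<lambda>A. perm_act g f' A + f' A) \<in> {f. restrict f (\<Omega> n 3) \<in> T.ker}"
        using mem[OF g] by blast
    qed
    moreover have "restrict k (\<Omega> n 3) = k" using k by (auto simp: PiE_def extensional_restrict)
    ultimately show "\<psi> k = \<zero>\<^bsub>?E\<^esub>" unfolding T.ker_def by simp
  qed (use n in simp)
  then show False using assms(5) by simp
qed

end
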